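(* Let $X_1,\ldots,X_n$ be i.i.d. real random variables with common density $f\in\mathbb{L}_\infty(\mathbb{R})$. Let $$\mathcal{F}=\left\{\frac1\sigma f_0\left(\frac{\cdot-\mu}{\sigma}\right),\ (\mu,\sigma)\in K\right\},$$ where $f_0$ is some given bounded density and $K=[\underline\mu,\overline\mu]\times[\underline\sigma,\overline\sigma]$, $\underline\mu,\overline\mu,\underline\sigma,\overline\sigma$ being real numbers such that $\underline\sigma>0$. Suppose that the following hypotheses hold: $(h_1)$ There exists a constant $C_{f_0}>0$ such that for all $x,y$ in the support of $f$, $(\mu,\sigma)\in K$, $(\mu',\sigma')\in K$, $$\left|f_0\left(\frac{x-\mu}{\sigma}\right)-f_0\left(\frac{y-\mu'}{\sigma'}\right)\right|\le C_{f_0}\left|\frac{x-\mu}{\sigma}-\frac{y-\mu'}{\sigma'}\right|.$$ $(h_2)$ There exist $\nu>0$ and $c>0$ such that for all integers $k\ge2$, $\mathbb{E}(|X_i|^k)\le\frac{k!}{2}\nu c^{k-2}$. Let $\alpha\in\,]0,1[$ and let $\tilde T_\alpha=\sup_{m\in\mathcal{M}}(\tilde T_m(X_1,\ldots,X_n)-\tilde q_{m,\alpha})$ be the test statistic defined in the context. Assume that $\mathcal{D}_2\ne\varnothing$ and that $n$ is large enough so that $n\ge3$ and $n^2\big((\overline\mu-\underline\mu)\wedge(\overline\sigma-\underline\sigma)\big)\ge2$. Fix some $\beta\in\,]0,1[$. For all $\varepsilon\in\,]0,2[$, there exists a positive constant $C=C(\underline\mu,\overline\mu,\underline\sigma,\overline\sigma,\|f_0\|_\infty,C_{f_0},\|f\|_\infty,\nu,c,\beta,\varepsilon)$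 such that, setting $$\tilde V_D(\beta)=C\left(\frac{\sqrt D}{n}\sqrt{\log(n^2D)}+\frac{D}{n^2}\log^2(n^2D)+\frac{\log(n^2D)}{n}\right),$$ if $f$ satisfies $$\inf_{(\mu,\sigma)\in K}\sigma\left\|f-\frac1\sigma f_0\left(\frac{\cdot-\mu}{\sigma}\right)\right\|_2^2\ge(1+\varepsilon)\inf_{D\in\mathcal{D}_2}\left\{\sup_{(\mu,\sigma)\in K}\left\|\sigma f(\sigma\cdot+\mu)-\Pi_{S_{(2,D)}}(\sigma f(\sigma\cdot+\mu))\right\|_2^2+\tilde V_D(\beta)+\tilde q_{(2,D),\alpha}\right\},$$ then $$\mathbb{P}_f(\tilde T_\alpha\le0)\le\beta.$$
   Context: Notation: $\|\cdot\|_2$ is the usual norm of $\mathbb{L}_2(\mathbb{R})$ (Lebesgue measure); $\|g\|_\infty=\sup_{x\in\mathbb{R}}|g(x)|$; $a\wedge b=\min(a,b)$; $\sigma f(\sigma\cdot+\mu)$ is the function $x\mapsto\sigma f(\sigma x+\mu)$; $\mathbb{P}_g$ denotes the law of $(X_1,\ldots,X_n)$ when the $X_i$ are i.i.d. with density $g$. Let $\mathbb{D}_1=\mathbb{N}^*=\{1,2,\ldots\}$ and $\mathbb{D}_2=\{2^J,\ J\in\mathbb{N}\}$. (i) For $D\in\mathbb{D}_1$ and $k\in\mathbb{Z}$, $I_{D,k}=\sqrt D\,\mathbb{I}_{[k/D,(k+1)/D[}$. For $m=(1,D)$, $$\hat T_m(x_1,\ldots,x_n)=\frac{1}{n(n-1)}\sum_{k\in\mathbb{Z}}\sum_{i\ne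 j=1}^n I_{D,k}(x_i)I_{D,k}(x_j)+\|f_0\|_2^2-\frac2n\sum_{i=1}^n f_0(x_i).$$ (ii) $(\varphi,\psi)$ is a fixed pair of compactly supported orthonormal wavelets such that for all $J\in\mathbb{N}$, $\{\varphi_{J,k}=2^{J/2}\varphi(2^J\cdot-k),k\in\mathbb{Z}\}\cup\{\psi_{j,k}=2^{j/2}\psi(2^j\cdot-k),j\in\mathbb{N},j\ge J,k\in\mathbb{Z}\}$ is an orthonormal basis of $\mathbb{L}_2(\mathbb{R})$, and the scaling function $\varphi$ is Lipschitz: $|\varphi(x)-\varphi(y)|\le C_\varphi|x-y|$ for all $x,y\in\mathbb{R}$. For $D=2^J\in\mathbb{D}_2$, $S_{(2,D)}$ is the closed subspace of $\mathbb{L}_2(\mathbb{R})$ with orthonormal basis $\{\varphi_{J,k},k\in\mathbb{Z}\}$, $\Pi_{S_{(2,D)}}$ is the orthogonal projection onto it, and for $m=(2,D)$, $$\hat T_m(x_1,\ldots,x_n)=\frac{1}{n(n-1)}\sum_{k\in\mathbb{Z}}\sum_{i\ne j=1}^n\varphi_{J,k}(x_i)\varphi_{J,k}(x_j)+\|f_0\|_2^2-\frac2n\sum_{i=1}^n f_0(x_i).$$ Let $\mathcal{D}_1\subset\mathbb{D}_1$, $\mathcal{D}_2\subset\mathbb{D}_2$ with $\mathcal{D}_1\cup\mathcal{D}_2\ne\varnothing$, and $\mathcal{M}=\{(l,D),\ l\in\{1,2\},\ D\in\mathcal{D}_l\}$. For $m\in\mathcal{M}$, $$\tilde T_m(X_1,\ldots,X_n)=\inf_{(\mu,\sigma)\in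 K}\hat T_m\left(\frac{X_1-\mu}{\sigma},\ldots,\frac{X_n-\mu}{\sigma}\right).$$ Finally $\{\tilde q_{m,\alpha},\ m\in\mathcal{M}\}$ is a family of positive numbers such that $\sup_{f\in\mathcal{F}}\mathbb{P}_f(\tilde T_\alpha>0)\le\alpha$, where $\tilde T_\alpha=\sup_{m\in\mathcal{M}}(\tilde T_m(X_1,\ldots,X_n)-\tilde q_{m,\alpha})$. The null hypothesis "$f\in\mathcal{F}$" is rejected when $\tilde T_\alpha>0$. The constant $C$ depends only on the quantities displayed as its arguments, and possibly on the choice of $\varphi$. *)

theory Defs
  imports "HOL-Analysis.Analysis"
begin

section \<open>The space of square integrable functions on the real line\<close>

text \<open>Elements of L2 are represented by Borel functions; no quotient by almost-everywhere
  equality is taken, so the distance between two functions may vanish without their being equal.\<close>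

definition L2 :: "(real \<Rightarrow> real) set" where
  "L2 = {g \<in> borel_measurable borel. integrable lborel (\<lambda>x. (g x)\<^sup>2)}"

definition L2_inner :: "(real \<Rightarrow> real) \<Rightarrow> (real \<Rightarrow> real) \<Rightarrow> real" where
  "L2_inner g h = (\<integral>x. g x * h x \<partial>lborel)"

definition L2_norm :: "(real \<Rightarrow> real) \<Rightarrow> real" where
  "L2_norm g = sqrt (\<integral>x. (g x)\<^sup>2 \<partial>lborel)"

definition L2_closed_span :: "('i \<Rightarrow> real \<Rightarrow> real) \<Rightarrow> 'i set \<Rightarrow> (real \<Rightarrow> real) set" where
  "L2_closed_span e I = {g \<in> L2. \<forall>\<eta>>0. \<exists>F a. finite F \<and> F \<subseteq> I \<and>
     L2_norm (\<lambda>x. g x - (\<Sum>i\<in>F. a i * e i x)) < \<eta>}"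

definition L2_orthonormal_basis ::
    "('i \<Rightarrow> real \<Rightarrow> real) \<Rightarrow> 'i set \<Rightarrow> (real \<Rightarrow> real) set \<Rightarrow> bool" where
  "L2_orthonormal_basis e I S \<longleftrightarrow>
     (\<forall>i\<in>I. e i \<in> L2) \<and>
     (\<forall>i\<in>I. \<forall>j\<in>I. L2_inner (e i) (e j) = (if i = j then 1 else 0)) \<and>
     L2_closed_span e I = S"

text \<open>The orthogonal projection is unique only up to almost-everywhere equality, hence the
  choice of a representative.\<close>

definition L2_proj :: "(real \<Rightarrow> real) set \<Rightarrow> (real \<Rightarrow> real) \<Rightarrow> real \<Rightarrow> real" where
  "L2_proj S g = (SOME p. p \<in> S \<and> (\<forall>h\<in>S. L2_inner (\<lambda>x. g x - p x) h = 0))"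

text \<open>Intended for bounded \<open>g\<close> only (the real supremum is unspecified otherwise).\<close>

definition sup_norm :: "(real \<Rightarrow> real) \<Rightarrow> real" where
  "sup_norm g = (SUP x. \<bar>g x\<bar>)"


section \<open>Histogram and wavelet systems\<close>

definition histogram :: "nat \<Rightarrow> int \<Rightarrow> real \<Rightarrow> real" where
  "histogram D k x = sqrt (real D) * indicator {of_int k / real D ..< (of_int k + 1) / real D} x"

text \<open>Indexed by \<open>D\<close> rather than by the level \<open>J\<close>: for \<open>D = 2 ^ J\<close> this is the function
  \<open>x \<mapsto> 2\<^bsup>J/2\<^esup> g (2\<^bsup>J\<^esup> x - k)\<close>.\<close>

definition dilate :: "(real \<Rightarrow> real) \<Rightarrow> nat \<Rightarrow> int \<Rightarrow> real \<Rightarrow> real" where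
  "dilate g D k x = sqrt (real D) * g (real D * x - of_int k)"

definition wavelet_pair :: "(real \<Rightarrow> real) \<Rightarrow> (real \<Rightarrow> real) \<Rightarrow> bool" where
  "wavelet_pair \<phi> \<psi> \<longleftrightarrow>
     compact (closure {x. \<phi> x \<noteq> 0}) \<and> compact (closure {x. \<psi> x \<noteq> 0}) \<and>
     (\<forall>J. L2_orthonormal_basis
            (case_sum (\<lambda>k. dilate \<phi> (2 ^ J) k) (\<lambda>(j, k). dilate \<psi> (2 ^ j) k))
            ((UNIV :: int set) <+> ({J..} \<times> (UNIV :: int set))) L2) \<and>
     (\<exists>C\<^sub>\<phi>. \<forall>x y. \<bar>\<phi> x - \<phi> y\<bar> \<le> C\<^sub>\<phi> * \<bar>x - y\<bar>)"

definition wavelet_space :: "(real \<Rightarrow> real) \<Rightarrow> nat \<Rightarrow> (real \<Rightarrow> real) set" where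
  "wavelet_space \<phi> D = L2_closed_span (dilate \<phi> D) UNIV"

definition \<D>\<^sub>1_max :: "nat set" where "\<D>\<^sub>1_max = {1..}"

definition \<D>\<^sub>2_max :: "nat set" where "\<D>\<^sub>2_max = range (\<lambda>J. 2 ^ J)"


section \<open>Densities and the law of a sample\<close>

definition bounded_density :: "(real \<Rightarrow> real) \<Rightarrow> bool" where
  "bounded_density g \<longleftrightarrow> g \<in> borel_measurable borel \<and> (\<forall>x. 0 \<le> g x) \<and>
     (\<integral>\<^sup>+x. ennreal (g x) \<partial>lborel) = 1 \<and> bounded (range g)"

definition density_law :: "(real \<Rightarrow> real) \<Rightarrow> real measure" where
  "density_law g = density lborel (\<lambda>x. ennreal (g x))"

definition sample_law :: "nat \<Rightarrow> (real \<Rightarrow> real) \<Rightarrow> (nat \<Rightarrow> real) measure" where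
  "sample_law n g = (\<Pi>\<^sub>M i\<in>{1..n}. density_law g)"

text \<open>The test statistic involves an infimum over a continuum of parameters, so its level sets
  are measurable for the completed law but need not be Borel. The probability is therefore taken as
  an outer measure, which coincides with the completed law on completion-measurable events (whereas
  \<open>measure\<close> would assign 0 to an event that is not Borel).\<close>

definition sample_prob ::
    "nat \<Rightarrow> (real \<Rightarrow> real) \<Rightarrow> ((nat \<Rightarrow> real) \<Rightarrow> bool) \<Rightarrow> ennreal" where
  "sample_prob n g P = outer_measure_of (sample_law n g) {X \<in> space (sample_law n g). P X}"


section \<open>The location-scale family and the test\<close>

definition loc_scale :: "(real \<Rightarrow> real) \<Rightarrow> real \<times> real \<Rightarrow> real \<Rightarrow> real" where
  "loc_scale f\<^sub>0 = (\<lambda>(\<mu>, \<sigma>) x. 1 / \<sigma> * f\<^sub>0 ((x - \<mu>) / \<sigma>))"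

text \<open>A model is a pair \<open>(l, D)\<close>, with \<open>l = 1\<close> for histograms and \<open>l = 2\<close> for wavelets.\<close>

definition models :: "nat set \<Rightarrow> nat set \<Rightarrow> (nat \<times> nat) set" where
  "models \<D>\<^sub>1 \<D>\<^sub>2 = {1} \<times> \<D>\<^sub>1 \<union> {2} \<times> \<D>\<^sub>2"

definition model_system :: "(real \<Rightarrow> real) \<Rightarrow> nat \<times> nat \<Rightarrow> int \<Rightarrow> real \<Rightarrow> real" where
  "model_system \<phi> = (\<lambda>(l, D). if l = 1 then histogram D else dilate \<phi> D)"

definition T_hat ::
    "(real \<Rightarrow> real) \<Rightarrow> (real \<Rightarrow> real) \<Rightarrow> nat \<Rightarrow> nat \<times> nat \<Rightarrow> (nat \<Rightarrow> real) \<Rightarrow> real" where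
  "T_hat \<phi> f\<^sub>0 n m x =
     1 / (real n * (real n - 1)) *
       (\<Sum>\<^sub>\<infinity>k\<in>UNIV. \<Sum>i=1..n. \<Sum>j\<in>{1..n} - {i}. model_system \<phi> m k (x i) * model_system \<phi> m k (x j))
     + (L2_norm f\<^sub>0)\<^sup>2 - 2 / real n * (\<Sum>i=1..n. f\<^sub>0 (x i))"

definition T_tilde ::
    "(real \<Rightarrow> real) \<Rightarrow> (real \<Rightarrow> real) \<Rightarrow> (real \<times> real) set \<Rightarrow> nat \<Rightarrow> nat \<times> nat \<Rightarrow> (nat \<Rightarrow> real) \<Rightarrow> real"
  where
  "T_tilde \<phi> f\<^sub>0 K n m X = (INF (\<mu>, \<sigma>)\<in>K. T_hat \<phi> f\<^sub>0 n m (\<lambda>i. (X i - \<mu>) / \<sigma>))"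

text \<open>The family of models may be infinite, hence the extended real supremum.\<close>

definition test_stat ::
    "(real \<Rightarrow> real) \<Rightarrow> (real \<Rightarrow> real) \<Rightarrow> (real \<times> real) set \<Rightarrow> nat \<Rightarrow> (nat \<times> nat) set \<Rightarrow>
     (nat \<times> nat \<Rightarrow> real) \<Rightarrow> (nat \<Rightarrow> real) \<Rightarrow> ereal" where
  "test_stat \<phi> f\<^sub>0 K n \<M> q X = (SUP m\<in>\<M>. ereal (T_tilde \<phi> f\<^sub>0 K n m X - q m))"

definition V_tilde :: "real \<Rightarrow> nat \<Rightarrow> nat \<Rightarrow> real" where
  "V_tilde C n D =
     C * (sqrt (real D) / real n * sqrt (ln (real n ^ 2 * real D))
          + real D / real n ^ 2 * (ln (real n ^ 2 * real D))\<^sup>2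
          + ln (real n ^ 2 * real D) / real n)"

definition lipschitz_hyp ::
    "(real \<Rightarrow> real) \<Rightarrow> (real \<Rightarrow> real) \<Rightarrow> (real \<times> real) set \<Rightarrow> real \<Rightarrow> bool" where
  "lipschitz_hyp f\<^sub>0 f K L \<longleftrightarrow>
     (\<forall>x\<in>{x. f x \<noteq> 0}. \<forall>y\<in>{x. f x \<noteq> 0}. \<forall>(\<mu>, \<sigma>)\<in>K. \<forall>(\<mu>', \<sigma>')\<in>K.
        \<bar>f\<^sub>0 ((x - \<mu>) / \<sigma>) - f\<^sub>0 ((y - \<mu>') / \<sigma>')\<bar> \<le> L * \<bar>(x - \<mu>) / \<sigma> - (y - \<mu>') / \<sigma>'\<bar>)"

text \<open>The moments are Lebesgue integrals of nonnegative functions, so the bound includes their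
  finiteness.\<close>

definition moment_hyp :: "(real \<Rightarrow> real) \<Rightarrow> real \<Rightarrow> real \<Rightarrow> bool" where
  "moment_hyp f \<nu> c \<longleftrightarrow>
     (\<forall>k\<ge>2. (\<integral>\<^sup>+x. ennreal (\<bar>x\<bar> ^ k) \<partial>density_law f) \<le> ennreal (fact k / 2 * \<nu> * c ^ (k - 2)))"

end

theory Submission
  imports Defs "HOL-Probability.Probability"
begin

text \<open>Fix a wavelet resolution \<open>D\<close> and write \<open>g\<close> for the density \<open>\<sigma> f(\<sigma> \<cdot> + \<mu>)\<close> of the standardized
observation \<open>(X - \<mu>) / \<sigma>\<close>, \<open>p\<close> for its projection onto the scaling space, \<open>b\<close> for the squared distance
from \<open>g\<close> to \<open>p\<close> and \<open>\<Delta>\<close> for the squared distance from \<open>g\<close> to \<open>f\<^sub>0\<close>. A change of variables shows that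
\<open>\<Delta>\<close> is \<open>\<sigma>\<close> times the squared distance in the separation condition, and \<open>T_hat\<close> evaluated at the
standardized sample has mean \<open>\<Delta> - b\<close>. Separation makes this mean exceed the critical value by a
multiple of \<open>\<Delta>\<close> plus \<open>V_tilde\<close>. Hence it is enough that, outside an event of probability \<open>\<beta>\<close>, the
statistic does not fall below its mean by more than that, simultaneously for all parameters in \<open>K\<close>.

For one parameter, \<open>n (n - 1)\<close> times the deviation is the sum of a degenerate quadratic form, whose
kernel \<open>ckernel\<close> is the Gram kernel of the functions \<open>ker x - p\<close>, and of a linear statistic in
\<open>p - f\<^sub>0\<close>. The heart of the matter is an exponential inequality for the lower tail of such a form,
\<open>chaos_exp_moment\<close>. The observations are integrated out one at a time, and the
conditional variance of the last increment is, by the Gram property, at most a multiple of the quadratic form in the remaining observations. A small positive multiple of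
that form carried along in the exponent therefore reproduces itself at each step. What this yields is
the Gaussian term of order \<open>sqrt D / n\<close> with the correct power of the logarithm. The increments have
to be bounded for this; since the kernel vanishes for points further apart than a multiple of
\<open>1 / D\<close>, such a bound amounts to a bound on the number of neighbours of each observation, which is a
binomial tail (\<open>neighbour_count_tail\<close>). The variance of the linear statistic is at most a multiple of
\<open>\<Delta> / n\<close>, and its fluctuation is traded against \<open>\<Delta>\<close>. All this is \<open>standardized_T_hat_lower_tail\<close>.

The probability of failure for one parameter can be made smaller than any given negative power of \<open>n\<^sup>2 D\<close> at
the price of a constant, so a union bound over a grid in \<open>K\<close> with polynomially many points is affordable. Between
grid points, the Lipschitz properties of \<open>\<phi>\<close> and of \<open>f\<^sub>0\<close> control the statistic as long as the
observations are not too large, which Chebyshev's inequality ensures. This is \<open>uniform_power\<close>; the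
theorem follows by choosing a resolution that nearly attains the infimum over \<open>\<D>\<^sub>2\<close>.\<close>

section \<open>Lower tail of degenerate quadratic forms\<close>

lemma exp_le_quadratic:
  fixes u :: real
  assumes "u \<le> 1"
  shows "exp u \<le> 1 + u + u\<^sup>2"
proof (cases "0 \<le> u")
  case True
  then show ?thesis using exp_bound[of u] assms by simp
next
  case False
  have "exp u * (1 - u) \<le> exp u * exp (- u)"
    using exp_ge_add_one_self[of "-u"] by (intro mult_left_mono) auto
  also have "\<dots> \<le> 1 - u ^ 3"
    using False zero_le_odd_power[of 3 u] by (simp add: exp_minus)
  also have "\<dots> = (1 + u + u\<^sup>2) * (1 - u)"
    by (simp add: algebra_simps power2_eq_square power3_eq_cube)
  finally show ?thesis using False by simp
qed

text \<open>For a symmetric kernel centred in each argument these are the increments of a martingale that ends at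
half the off-diagonal quadratic form.\<close>
definition chaos_inc :: "('a \<Rightarrow> 'a \<Rightarrow> real) \<Rightarrow> (nat \<Rightarrow> 'a) \<Rightarrow> nat \<Rightarrow> real" where
  "chaos_inc H X j = (\<Sum>i\<in>{1..<j}. H (X i) (X j))"

text \<open>On the truncation event, and by the bound on \<open>r\<close>, the exponent \<open>u\<close> is at most \<open>1\<close>, so that \<open>exp u \<le> 1 + u + u\<^sup>2\<close>. The quadratic
\<open>1 + u + u\<^sup>2\<close> is positive for every real \<open>u\<close>, hence it also dominates the truncated exponential off
that event, and its linear term integrates to zero although the truncation itself is not centred. The
term with \<open>a\<close> anticipates the induction in \<open>chaos_exp_moment\<close>.\<close>
lemma truncated_exp_moment:
  fixes Z r :: "'a \<Rightarrow> real"
  assumes "prob_space M"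
    and [measurable]: "Z \<in> borel_measurable M" "r \<in> borel_measurable M"
    and Zb: "\<And>y. y \<in> space M \<Longrightarrow> \<bar>Z y\<bar> \<le> cZ"
    and rb: "\<And>y. y \<in> space M \<Longrightarrow> 2 * lam * kap * \<bar>r y\<bar> \<le> 1"
    and Z0: "(\<integral>y. Z y \<partial>M) = 0" and r0: "(\<integral>y. r y \<partial>M) = 0"
    and ZV: "(\<integral>y. (Z y)\<^sup>2 \<partial>M) \<le> VZ" and rV: "(\<integral>y. (r y)\<^sup>2 \<partial>M) \<le> v"
    and rc: "\<And>y. y \<in> space M \<Longrightarrow> \<bar>r y\<bar> \<le> cr"
    and a: "0 \<le> a" "a \<le> lam" and kap: "0 \<le> kap"
  shows "(\<integral>\<^sup>+y. (if 4 * lam * \<bar>Z y\<bar> \<le> 1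
            then ennreal (exp (- lam * (2 * Z y + kap * r y) + a * (2 * Z y))) else 0) \<partial>M)
         \<le> ennreal (exp (8 * lam\<^sup>2 * VZ + 2 * lam\<^sup>2 * kap\<^sup>2 * v))"
proof -
  interpret prob_space M by fact
  define u where "u y = - 2 * (lam - a) * Z y - lam * kap * r y" for y
  have [measurable]: "u \<in> borel_measurable M" unfolding u_def by measurable
  have iZ: "integrable M Z" by (rule integrable_const_bound[of _ cZ]) (auto intro!: AE_I2 Zb)
  have ir: "integrable M r" by (rule integrable_const_bound[of _ cr]) (auto intro!: AE_I2 rc)
  have iZ2: "integrable M (\<lambda>y. (Z y)\<^sup>2)"
    by (rule integrable_const_bound[of _ "cZ\<^sup>2"]) (auto intro!: AE_I2 power_mono dest: Zb simp: abs_le_square_iff[symmetric] intro: order_trans[OF Zb abs_ge_self])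
  have ir2: "integrable M (\<lambda>y. (r y)\<^sup>2)"
    by (rule integrable_const_bound[of _ "cr\<^sup>2"]) (auto intro!: AE_I2 simp: abs_le_square_iff[symmetric] intro: order_trans[OF rc abs_ge_self])
  have iu: "integrable M u" unfolding u_def using iZ ir by auto
  have u0: "(\<integral>y. u y \<partial>M) = 0" unfolding u_def using iZ ir Z0 r0 by simp
  have u2le: "(u y)\<^sup>2 \<le> 8 * lam\<^sup>2 * (Z y)\<^sup>2 + 2 * lam\<^sup>2 * kap\<^sup>2 * (r y)\<^sup>2" for y
  proof -
    have "(u y)\<^sup>2 \<le> 2 * (2 * (lam - a) * Z y)\<^sup>2 + 2 * (lam * kap * r y)\<^sup>2"
      unfolding u_def using sum_squares_ge_zero[of "2 * (lam - a) * Z y - lam * kap * r y" 0]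
      by (simp add: power2_eq_square algebra_simps)
    also have "\<dots> = 8 * (lam - a)\<^sup>2 * (Z y)\<^sup>2 + 2 * lam\<^sup>2 * kap\<^sup>2 * (r y)\<^sup>2"
      unfolding power_mult_distrib by simp
    also have "\<dots> \<le> 8 * lam\<^sup>2 * (Z y)\<^sup>2 + 2 * lam\<^sup>2 * kap\<^sup>2 * (r y)\<^sup>2"
      using a by (intro add_mono mult_right_mono mult_left_mono power_mono) auto
    finally show ?thesis .
  qed
  have iR: "integrable M (\<lambda>y. 8 * lam\<^sup>2 * (Z y)\<^sup>2 + 2 * lam\<^sup>2 * kap\<^sup>2 * (r y)\<^sup>2)"
    using iZ2 ir2 by auto
  have iu2: "integrable M (\<lambda>y. (u y)\<^sup>2)"
    by (rule Bochner_Integration.integrable_bound[OF iR]) (auto intro!: AE_I2 order_trans[OF u2le])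
  have "(\<integral>y. (u y)\<^sup>2 \<partial>M) \<le> (\<integral>y. 8 * lam\<^sup>2 * (Z y)\<^sup>2 + 2 * lam\<^sup>2 * kap\<^sup>2 * (r y)\<^sup>2 \<partial>M)"
    by (intro integral_mono iu2 iR u2le)
  also have "\<dots> = 8 * lam\<^sup>2 * (\<integral>y. (Z y)\<^sup>2 \<partial>M) + 2 * lam\<^sup>2 * kap\<^sup>2 * (\<integral>y. (r y)\<^sup>2 \<partial>M)"
    using iZ2 ir2 by simp
  also have "\<dots> \<le> 8 * lam\<^sup>2 * VZ + 2 * lam\<^sup>2 * kap\<^sup>2 * v"
    by (intro add_mono mult_left_mono ZV rV) auto
  finally have Eu2: "(\<integral>y. (u y)\<^sup>2 \<partial>M) \<le> 8 * lam\<^sup>2 * VZ + 2 * lam\<^sup>2 * kap\<^sup>2 * v" .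
  have pw: "(if 4 * lam * \<bar>Z y\<bar> \<le> 1
            then ennreal (exp (- lam * (2 * Z y + kap * r y) + a * (2 * Z y))) else 0)
        \<le> ennreal (1 + u y + (u y)\<^sup>2)" if y: "y \<in> space M" for y
  proof (cases "4 * lam * \<bar>Z y\<bar> \<le> 1")
    case True
    have "(- 2 * (lam - a)) * Z y \<le> (2 * (lam - a)) * \<bar>Z y\<bar>"
      using a mult_left_mono[of "- Z y" "\<bar>Z y\<bar>" "2 * (lam - a)"] by (simp add: algebra_simps)
    also have "\<dots> \<le> (2 * lam) * \<bar>Z y\<bar>" using a by (intro mult_right_mono) auto
    finally have 1: "- 2 * (lam - a) * Z y \<le> 1/2" using True by simp
    have "\<bar>lam * kap * r y\<bar> = lam * kap * \<bar>r y\<bar>" using a kap by (simp add: abs_mult)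
    then have 2: "- (lam * kap * r y) \<le> 1/2" using rb[OF y] by linarith
    have "u y \<le> 1" unfolding u_def using 1 2 by linarith
    moreover have "- lam * (2 * Z y + kap * r y) + a * (2 * Z y) = u y"
      by (simp add: u_def algebra_simps)
    ultimately show ?thesis using True exp_le_quadratic[of "u y"] by (auto intro!: ennreal_leI)
  qed simp
  have nn: "0 \<le> 1 + u y + (u y)\<^sup>2" for y
  proof -
    have "1 + u y + (u y)\<^sup>2 = (u y + 1/2)\<^sup>2 + 3/4" by (simp add: power2_eq_square algebra_simps)
    then show ?thesis by simp
  qed
  have "(\<integral>\<^sup>+y. (if 4 * lam * \<bar>Z y\<bar> \<le> 1
            then ennreal (exp (- lam * (2 * Z y + kap * r y) + a * (2 * Z y))) else 0) \<partial>M)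
      \<le> (\<integral>\<^sup>+y. ennreal (1 + u y + (u y)\<^sup>2) \<partial>M)"
    by (intro nn_integral_mono pw)
  also have "\<dots> = ennreal (\<integral>y. 1 + u y + (u y)\<^sup>2 \<partial>M)"
    using iu iu2 nn by (intro nn_integral_eq_integral) auto
  also have "(\<integral>y. 1 + u y + (u y)\<^sup>2 \<partial>M) = 1 + (\<integral>y. (u y)\<^sup>2 \<partial>M)"
    using iu iu2 u0 by (simp add: prob_space)
  also have "ennreal \<dots> \<le> ennreal (exp (8 * lam\<^sup>2 * VZ + 2 * lam\<^sup>2 * kap\<^sup>2 * v))"
    using Eu2 exp_ge_add_one_self[of "8 * lam\<^sup>2 * VZ + 2 * lam\<^sup>2 * kap\<^sup>2 * v"]
    by (intro ennreal_leI) linarith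
  finally show ?thesis .
qed

text \<open>Let \<open>Q\<close> be the full quadratic form, diagonal included. Integrating out the last observation produces
a factor \<open>exp (8 * lam\<^sup>2 * B * Q)\<close> in the others, by the assumption \<open>HV\<close>, and \<open>Q\<close> itself grows by twice
the increment and a diagonal term bounded by \<open>h\<close>. So the statement is stable under the step if a
multiple \<open>a\<close> of \<open>Q\<close> is allowed in the exponent: \<open>a\<close> becomes \<open>a + 8 * lam\<^sup>2 * B\<close>, and as long as it
stays below \<open>lam\<close> the net coefficient of the increment keeps its sign and does not exceed \<open>lam\<close> in size. Summing the
contributions \<open>a * h\<close> of the diagonal over the steps gives the term quadratic in \<open>m\<close>, which
corresponds to the variance of the whole form.\<close>
lemma chaos_exp_moment:
  fixes H :: "'a \<Rightarrow> 'a \<Rightarrow> real" and r :: "'a \<Rightarrow> real"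
  assumes "prob_space M"
    and Hm: "(\<lambda>p. H (fst p) (snd p)) \<in> borel_measurable (M \<Otimes>\<^sub>M M)"
    and rm [measurable]: "r \<in> borel_measurable M"
    and Hb: "\<And>x y. x \<in> space M \<Longrightarrow> y \<in> space M \<Longrightarrow> \<bar>H x y\<bar> \<le> cH"
    and Hs: "\<And>x y. H x y = H y x"
    and H0: "\<And>x. x \<in> space M \<Longrightarrow> (\<integral>y. H x y \<partial>M) = 0"
    and HV: "\<And>F X. finite F \<Longrightarrow> (\<And>i. i \<in> F \<Longrightarrow> X i \<in> space M) \<Longrightarrow>
        (\<integral>y. (\<Sum>i\<in>F. H (X i) y)\<^sup>2 \<partial>M) \<le> B * (\<Sum>i\<in>F. \<Sum>j\<in>(F::nat set). H (X i) (X j))"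
    and Hd: "\<And>x. x \<in> space M \<Longrightarrow> H x x \<le> h"
    and rc: "\<And>y. y \<in> space M \<Longrightarrow> \<bar>r y\<bar> \<le> cr"
    and r0: "(\<integral>y. r y \<partial>M) = 0" and rV: "(\<integral>y. (r y)\<^sup>2 \<partial>M) \<le> v"
    and rb: "2 * lam * kap * cr \<le> 1"
    and nn: "0 \<le> kap" "0 \<le> B" "0 \<le> h" "0 \<le> lam"
    and a: "0 \<le> a" "a + 8 * lam\<^sup>2 * B * real m \<le> lam"
  shows "(\<integral>\<^sup>+X. (if \<forall>j\<in>{1..m}. 4 * lam * \<bar>chaos_inc H X j\<bar> \<le> 1
            then ennreal (exp (- lam * (\<Sum>j=1..m. 2 * chaos_inc H X j + kap * r (X j))
                     + a * (\<Sum>i=1..m. \<Sum>j=1..m. H (X i) (X j)))) else 0) \<partial>(\<Pi>\<^sub>M i\<in>{1..m}. M))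
     \<le> ennreal (exp (real m * a * h + 4 * lam\<^sup>2 * B * (real m)\<^sup>2 * h
               + 2 * real m * lam\<^sup>2 * kap\<^sup>2 * v))"
  using a
proof (induction m arbitrary: a)
  case 0
  interpret product_sigma_finite "\<lambda>_::nat. M"
    using assms(1) by (simp add: product_sigma_finite_def prob_space_imp_sigma_finite)
  show ?case by (simp add: PiM_empty nn_integral_count_space_finite)
next
  case (Suc m)
  interpret M: prob_space M by fact
  interpret product_sigma_finite "\<lambda>_::nat. M"
    using assms(1) by (simp add: product_sigma_finite_def prob_space_imp_sigma_finite)
  have Hm' [measurable]: "(\<lambda>X. H (X i) (X j)) \<in> borel_measurable (\<Pi>\<^sub>M i\<in>I. M)"
    if "i \<in> I" "j \<in> I" for i j and I :: "nat set"
    using measurable_compose[OF measurable_Pair[OF measurable_component_singleton[OF that(1)] measurable_component_singleton[OF that(2)]] Hm]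
    by simp
  have rm' [measurable]: "(\<lambda>X. r (X i)) \<in> borel_measurable (\<Pi>\<^sub>M i\<in>I. M)"
    if "i \<in> I" for i and I :: "nat set"
    using measurable_compose[OF measurable_component_singleton[OF that] rm] .
  have Cm [measurable]: "(\<lambda>X. chaos_inc H X j) \<in> borel_measurable (\<Pi>\<^sub>M i\<in>{1..k}. M)"
    if "j \<in> {1..k}" for j k
    unfolding chaos_inc_def using that by (intro borel_measurable_sum Hm') auto
  define G where "G k a X = (if \<forall>j\<in>{1..k}. 4 * lam * \<bar>chaos_inc H X j\<bar> \<le> 1
            then ennreal (exp (- lam * (\<Sum>j=1..k. 2 * chaos_inc H X j + kap * r (X j))
                     + a * (\<Sum>i=1..k. \<Sum>j=1..k. H (X i) (X j)))) else 0)" for k a X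
  have Gm [measurable]: "G k a \<in> borel_measurable (\<Pi>\<^sub>M i\<in>{1..k}. M)" for k a
  proof -
    have [measurable]: "Measurable.pred (\<Pi>\<^sub>M i\<in>{1..k}. M) (\<lambda>X. \<forall>j\<in>{1..k}. 4 * lam * \<bar>chaos_inc H X j\<bar> \<le> 1)"
    proof (intro pred_intros_finite)
      fix j assume "j \<in> {1..k}"
      from Cm[OF this, measurable]
      show "Measurable.pred (\<Pi>\<^sub>M i\<in>{1..k}. M) (\<lambda>X. 4 * lam * \<bar>chaos_inc H X j\<bar> \<le> 1)" by measurable
    qed simp
    have [measurable]: "(\<lambda>X. exp (- lam * (\<Sum>j=1..k. 2 * chaos_inc H X j + kap * r (X j))
                     + a * (\<Sum>i=1..k. \<Sum>j=1..k. H (X i) (X j)))) \<in> borel_measurable (\<Pi>\<^sub>M i\<in>{1..k}. M)"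
      by (intro borel_measurable_exp measurable_compose[OF _ borel_measurable_exp] borel_measurable_add borel_measurable_times borel_measurable_const borel_measurable_sum Cm rm' Hm') auto
    show ?thesis unfolding G_def by measurable
  qed
  have ins: "{1..Suc m} = insert (Suc m) {1..m}" by auto
  \<comment> \<open>the budget for \<open>a\<close> leaves room for one more increase by \<open>8 * lam\<^sup>2 * B\<close>\<close>
  have aS: "0 \<le> a" "a \<le> lam" "a + 8 * lam\<^sup>2 * B + 8 * lam\<^sup>2 * B * real m \<le> lam"
  proof -
    show "0 \<le> a" by fact
    have "0 \<le> 8 * lam\<^sup>2 * B * real (Suc m)" using nn by simp
    then show "a \<le> lam" using Suc.prems by linarith
    show "a + 8 * lam\<^sup>2 * B + 8 * lam\<^sup>2 * B * real m \<le> lam"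
      using Suc.prems by (simp add: algebra_simps)
  qed
  let ?E = "ennreal (exp (a * h + 2 * lam\<^sup>2 * kap\<^sup>2 * v))"
  have inner: "(\<integral>\<^sup>+y. G (Suc m) a (x(Suc m := y)) \<partial>M) \<le> ?E * G m (a + 8 * lam\<^sup>2 * B) x"
    if x: "x \<in> space (\<Pi>\<^sub>M i\<in>{1..m}. M)" for x
  proof -
    have xs: "x i \<in> space M" if "i \<in> {1..m}" for i using x that by (auto simp: space_PiM)
    define Z where "Z y = (\<Sum>i\<in>{1..m}. H (x i) y)" for y
    define Q where "Q = (\<Sum>i=1..m. \<Sum>j=1..m. H (x i) (x j))"
    define S where "S = (\<Sum>j=1..m. 2 * chaos_inc H x j + kap * r (x j))"
    have Zm [measurable]: "Z \<in> borel_measurable M"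
      unfolding Z_def
    proof (intro borel_measurable_sum)
      fix i assume "i \<in> {1..m}"
      then show "H (x i) \<in> borel_measurable M"
        using measurable_compose[OF measurable_Pair1'[OF xs, of i M] Hm] by simp
    qed
    have ci: "chaos_inc H (x(Suc m := y)) j = (if j = Suc m then Z y else chaos_inc H x j)"
      if "j \<in> {1..Suc m}" for j y
      using that by (auto simp: chaos_inc_def Z_def atLeastLessThanSuc_atLeastAtMost intro!: sum.cong)
    have s1: "(\<Sum>j=1..Suc m. 2 * chaos_inc H (x(Suc m := y)) j + kap * r ((x(Suc m := y)) j))
        = S + (2 * Z y + kap * r y)" for y
    proof -
      have "(\<Sum>j=1..m. 2 * chaos_inc H (x(Suc m := y)) j + kap * r ((x(Suc m := y)) j)) = S"
        unfolding S_def by (intro sum.cong refl) (auto simp: ci)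
      then show ?thesis using ci[of "Suc m" y] by simp
    qed
    have s2: "(\<Sum>i=1..Suc m. \<Sum>j=1..Suc m. H ((x(Suc m := y)) i) ((x(Suc m := y)) j))
        = Q + 2 * Z y + H y y" for y
    proof -
      have "(\<Sum>i=1..m. \<Sum>j=1..m. H ((x(Suc m := y)) i) ((x(Suc m := y)) j)) = Q"
        unfolding Q_def by (intro sum.cong refl) auto
      moreover have "(\<Sum>i=1..m. H ((x(Suc m := y)) i) y) = Z y"
        unfolding Z_def by (intro sum.cong refl) auto
      moreover have "(\<Sum>i=1..m. H y ((x(Suc m := y)) i)) = Z y"
        unfolding Z_def by (intro sum.cong refl) (auto simp: Hs[of y])
      ultimately show ?thesis by (simp add: sum.distrib)
    qed
    define A where "A = (if \<forall>j\<in>{1..m}. 4 * lam * \<bar>chaos_inc H x j\<bar> \<le> 1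
            then ennreal (exp (- lam * S + a * Q)) else 0)"
    have pw: "G (Suc m) a (x(Suc m := y)) \<le> (A * ennreal (exp (a * h))) *
          (if 4 * lam * \<bar>Z y\<bar> \<le> 1
            then ennreal (exp (- lam * (2 * Z y + kap * r y) + a * (2 * Z y))) else 0)"
      if y: "y \<in> space M" for y
    proof (cases "(\<forall>j\<in>{1..m}. 4 * lam * \<bar>chaos_inc H x j\<bar> \<le> 1) \<and> 4 * lam * \<bar>Z y\<bar> \<le> 1")
      case True
      have "a * H y y \<le> a * h" using Hd[OF y] aS by (intro mult_left_mono) auto
      then have "- lam * (S + (2 * Z y + kap * r y)) + a * (Q + 2 * Z y + H y y)
           \<le> (- lam * S + a * Q) + a * h + (- lam * (2 * Z y + kap * r y) + a * (2 * Z y))"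
        by (simp add: algebra_simps)
      then have "ennreal (exp (- lam * (S + (2 * Z y + kap * r y)) + a * (Q + 2 * Z y + H y y)))
        \<le> ennreal (exp (- lam * S + a * Q) * exp (a * h) * exp (- lam * (2 * Z y + kap * r y) + a * (2 * Z y)))"
        by (intro ennreal_leI) (simp only: exp_add[symmetric] exp_le_cancel_iff)
      with True show ?thesis
        unfolding G_def s1 s2 A_def by (auto simp: ci ennreal_mult' simp del: sum.cl_ivl_Suc)
    next
      case False
      then have "\<not> (\<forall>j\<in>{1..Suc m}. 4 * lam * \<bar>chaos_inc H (x(Suc m := y)) j\<bar> \<le> 1)"
        unfolding ins by (auto simp: ci)
      then show ?thesis unfolding G_def by (subst if_not_P) auto
    qed
    have Zint: "integrable M (H (x i))" if "i \<in> {1..m}" for i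
      using xs[OF that] measurable_compose[OF measurable_Pair1'[OF xs[OF that], of M] Hm]
      by (intro M.integrable_const_bound[of _ cH]) (auto intro!: AE_I2 Hb)
    have "(\<integral>\<^sup>+y. (if 4 * lam * \<bar>Z y\<bar> \<le> 1
            then ennreal (exp (- lam * (2 * Z y + kap * r y) + a * (2 * Z y))) else 0) \<partial>M)
         \<le> ennreal (exp (8 * lam\<^sup>2 * (B * Q) + 2 * lam\<^sup>2 * kap\<^sup>2 * v))"
    proof (rule truncated_exp_moment[OF assms(1) Zm rm, where cZ = "real m * cH" and cr = cr])
      fix y assume y: "y \<in> space M"
      show "\<bar>Z y\<bar> \<le> real m * cH"
        unfolding Z_def using sum_norm_le[of "{1..m}" "\<lambda>i. H (x i) y" "\<lambda>_. cH"] Hb[OF xs y] by simp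
      show "2 * lam * kap * \<bar>r y\<bar> \<le> 1"
        using rb mult_left_mono[OF rc[OF y], of "2 * lam * kap"] nn by simp
      show "\<bar>r y\<bar> \<le> cr" by (rule rc[OF y])
    next
      show "(\<integral>y. Z y \<partial>M) = 0" unfolding Z_def using Zint H0 xs by simp
      show "(\<integral>y. (Z y)\<^sup>2 \<partial>M) \<le> B * Q" unfolding Z_def Q_def by (rule HV) (auto intro: xs)
    qed (use r0 rV aS nn in auto)
    note tm = this
    have "(\<integral>\<^sup>+y. G (Suc m) a (x(Suc m := y)) \<partial>M)
      \<le> (\<integral>\<^sup>+y. (A * ennreal (exp (a * h))) * (if 4 * lam * \<bar>Z y\<bar> \<le> 1
            then ennreal (exp (- lam * (2 * Z y + kap * r y) + a * (2 * Z y))) else 0) \<partial>M)"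
      by (intro nn_integral_mono pw)
    also have "\<dots> = (A * ennreal (exp (a * h))) * (\<integral>\<^sup>+y. (if 4 * lam * \<bar>Z y\<bar> \<le> 1
            then ennreal (exp (- lam * (2 * Z y + kap * r y) + a * (2 * Z y))) else 0) \<partial>M)"
      by (intro nn_integral_cmult) measurable
    also have "\<dots> \<le> (A * ennreal (exp (a * h))) * ennreal (exp (8 * lam\<^sup>2 * (B * Q) + 2 * lam\<^sup>2 * kap\<^sup>2 * v))"
      by (intro mult_left_mono tm) auto
    also have "\<dots> = ?E * G m (a + 8 * lam\<^sup>2 * B) x"
      unfolding A_def G_def S_def[symmetric] Q_def[symmetric]
      by (auto simp: ennreal_mult'[symmetric] exp_add[symmetric] algebra_simps)
    finally show ?thesis .
  qed
  have "(\<integral>\<^sup>+X. G (Suc m) a X \<partial>(\<Pi>\<^sub>M i\<in>{1..Suc m}. M))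
     = (\<integral>\<^sup>+x. (\<integral>\<^sup>+y. G (Suc m) a (x(Suc m := y)) \<partial>M) \<partial>(\<Pi>\<^sub>M i\<in>{1..m}. M))"
    unfolding ins using Gm[of "Suc m" a] unfolding ins by (intro product_nn_integral_insert) auto
  also have "\<dots> \<le> (\<integral>\<^sup>+x. ?E * G m (a + 8 * lam\<^sup>2 * B) x \<partial>(\<Pi>\<^sub>M i\<in>{1..m}. M))"
    by (intro nn_integral_mono inner)
  also have "\<dots> = ?E * (\<integral>\<^sup>+x. G m (a + 8 * lam\<^sup>2 * B) x \<partial>(\<Pi>\<^sub>M i\<in>{1..m}. M))"
    by (intro nn_integral_cmult) measurable
  also have "\<dots> \<le> ?E * ennreal (exp (real m * (a + 8 * lam\<^sup>2 * B) * h + 4 * lam\<^sup>2 * B * (real m)\<^sup>2 * h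
               + 2 * real m * lam\<^sup>2 * kap\<^sup>2 * v))"
    unfolding G_def using Suc.IH[of "a + 8 * lam\<^sup>2 * B"] aS nn by (intro mult_left_mono) auto
  also have "\<dots> = ennreal (exp (a * h + 2 * lam\<^sup>2 * kap\<^sup>2 * v + (real m * (a + 8 * lam\<^sup>2 * B) * h + 4 * lam\<^sup>2 * B * (real m)\<^sup>2 * h
               + 2 * real m * lam\<^sup>2 * kap\<^sup>2 * v)))"
    by (simp add: ennreal_mult'[symmetric] exp_add)
  also have "\<dots> \<le> ennreal (exp (real (Suc m) * a * h + 4 * lam\<^sup>2 * B * (real (Suc m))\<^sup>2 * h
               + 2 * real (Suc m) * lam\<^sup>2 * kap\<^sup>2 * v))"
  proof -
    have "0 \<le> 4 * (lam\<^sup>2 * B * h)" using nn by simp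
    then show ?thesis
      by (intro ennreal_leI) (simp add: algebra_simps power2_eq_square)
  qed
  finally show ?case unfolding G_def .
qed

text \<open>Chernoff's method with the parameter \<open>sqrt (x / A)\<close>, capped by a value \<open>lam\<close> for which the
moment bound and the truncation are valid; the cap is responsible for the second term in the lower
bound on \<open>t\<close>.\<close>
lemma chaos_lower_tail:
  fixes H :: "'a \<Rightarrow> 'a \<Rightarrow> real" and r :: "'a \<Rightarrow> real"
  assumes "prob_space M"
    and Hm: "(\<lambda>p. H (fst p) (snd p)) \<in> borel_measurable (M \<Otimes>\<^sub>M M)"
    and rm [measurable]: "r \<in> borel_measurable M"
    and Hb: "\<And>x y. x \<in> space M \<Longrightarrow> y \<in> space M \<Longrightarrow> \<bar>H x y\<bar> \<le> cH"
    and Hs: "\<And>x y. H x y = H y x"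
    and H0: "\<And>x. x \<in> space M \<Longrightarrow> (\<integral>y. H x y \<partial>M) = 0"
    and HV: "\<And>F X. finite F \<Longrightarrow> (\<And>i. i \<in> F \<Longrightarrow> X i \<in> space M) \<Longrightarrow>
        (\<integral>y. (\<Sum>i\<in>F. H (X i) y)\<^sup>2 \<partial>M) \<le> B * (\<Sum>i\<in>F. \<Sum>j\<in>(F::nat set). H (X i) (X j))"
    and Hd: "\<And>x. x \<in> space M \<Longrightarrow> H x x \<le> h"
    and rc: "\<And>y. y \<in> space M \<Longrightarrow> \<bar>r y\<bar> \<le> cr"
    and r0: "(\<integral>y. r y \<partial>M) = 0" and rV: "(\<integral>y. (r y)\<^sup>2 \<partial>M) \<le> v"
    and nn: "0 \<le> kap" "0 \<le> B" "0 \<le> h" "0 < lam" "0 \<le> x"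
    and lam: "8 * lam * B * real n \<le> 1" "2 * lam * kap * cr \<le> 1"
    and A: "4 * B * (real n)\<^sup>2 * h + 2 * real n * kap\<^sup>2 * v \<le> A" "0 < A"
    and t: "2 * sqrt (A * x) + 2 * x / lam \<le> t"
  shows "outer_measure_of (\<Pi>\<^sub>M i\<in>{1..n}. M) {X \<in> space (\<Pi>\<^sub>M i\<in>{1..n}. M).
      (\<forall>j\<in>{1..n}. 4 * lam * \<bar>chaos_inc H X j\<bar> \<le> 1) \<and>
      (\<Sum>j=1..n. 2 * chaos_inc H X j + kap * r (X j)) \<le> - t} \<le> ennreal (exp (- x))"
proof (cases "x = 0")
  case True
  interpret product_prob_space "\<lambda>_::nat. M" "{1..n}"
    using assms(1) by (simp add: product_prob_space_def product_sigma_finite_def prob_space_imp_sigma_finite product_prob_space_axioms_def)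
  interpret P: prob_space "\<Pi>\<^sub>M i\<in>{1..n}. M" by (rule prob_space_PiM) (rule assms(1))
  have "outer_measure_of (\<Pi>\<^sub>M i\<in>{1..n}. M) A \<le> 1" if "A \<subseteq> space (\<Pi>\<^sub>M i\<in>{1..n}. M)" for A
    using outer_measure_of_mono[OF that, of "\<Pi>\<^sub>M i\<in>{1..n}. M"] P.emeasure_space_1 by simp
  then show ?thesis using True by (simp add: Collect_mono_iff)
next
  case False
  then have x: "0 < x" using nn by simp
  interpret product_prob_space "\<lambda>_::nat. M" "{1..n}"
    using assms(1) by (simp add: product_prob_space_def product_sigma_finite_def prob_space_imp_sigma_finite product_prob_space_axioms_def)
  let ?P = "\<Pi>\<^sub>M i\<in>{1..n}. M"
  define S where "S X = (\<Sum>j=1..n. 2 * chaos_inc H X j + kap * r (X j))" for X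
  have Hm' [measurable]: "(\<lambda>X. H (X i) (X j)) \<in> borel_measurable ?P"
    if "i \<in> {1..n}" "j \<in> {1..n}" for i j
    using measurable_compose[OF measurable_Pair[OF measurable_component_singleton[OF that(1)] measurable_component_singleton[OF that(2)]] Hm]
    by simp
  have rm' [measurable]: "(\<lambda>X. r (X i)) \<in> borel_measurable ?P"
    if "i \<in> {1..n}" for i
    using measurable_compose[OF measurable_component_singleton[OF that] rm] .
  have Cm [measurable]: "(\<lambda>X. chaos_inc H X j) \<in> borel_measurable ?P"
    if "j \<in> {1..n}" for j
    unfolding chaos_inc_def using that by (intro borel_measurable_sum Hm') auto
  have Sm [measurable]: "S \<in> borel_measurable ?P"
    unfolding S_def by (intro borel_measurable_sum borel_measurable_add borel_measurable_times borel_measurable_const Cm rm')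
  define l where "l = min lam (sqrt (x / A))"
  have l: "0 < l" "l \<le> lam" "l \<le> sqrt (x / A)" using nn x A by (auto simp: l_def)
  have pm [measurable]: "Measurable.pred ?P (\<lambda>X. \<forall>j\<in>{1..n}. 4 * l * \<bar>chaos_inc H X j\<bar> \<le> 1)"
  proof (intro pred_intros_finite)
    fix j assume "j \<in> {1..n}"
    from Cm[OF this, measurable]
    show "Measurable.pred ?P (\<lambda>X. 4 * l * \<bar>chaos_inc H X j\<bar> \<le> 1)" by measurable
  qed simp
  let ?G = "\<lambda>X. if \<forall>j\<in>{1..n}. 4 * l * \<bar>chaos_inc H X j\<bar> \<le> 1
            then ennreal (exp (- l * S X)) else 0"
  have "(\<integral>\<^sup>+X. (if \<forall>j\<in>{1..n}. 4 * l * \<bar>chaos_inc H X j\<bar> \<le> 1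
            then ennreal (exp (- l * (\<Sum>j=1..n. 2 * chaos_inc H X j + kap * r (X j))
                     + 0 * (\<Sum>i=1..n. \<Sum>j=1..n. H (X i) (X j)))) else 0) \<partial>?P)
     \<le> ennreal (exp (real n * 0 * h + 4 * l\<^sup>2 * B * (real n)\<^sup>2 * h
               + 2 * real n * l\<^sup>2 * kap\<^sup>2 * v))"
  proof (rule chaos_exp_moment[OF assms(1) Hm rm Hb Hs H0 HV Hd rc r0 rV])
    have "l * 2 * kap * cr \<le> 1"
    proof (cases "0 \<le> cr")
      case True
      have "l * (2 * kap * cr) \<le> lam * (2 * kap * cr)"
        using True nn l by (intro mult_right_mono) auto
      then show ?thesis using lam by (simp add: algebra_simps)
    next
      case False
      then have "(l * 2 * kap) * cr \<le> 0" using nn l by (intro mult_nonneg_nonpos) auto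
      then show ?thesis by linarith
    qed
    then show "2 * l * kap * cr \<le> 1" by (simp add: algebra_simps)
    have "l * (8 * B * real n) \<le> lam * (8 * B * real n)" using nn l by (intro mult_right_mono) auto
    also have "\<dots> \<le> 1" using lam by (simp add: algebra_simps)
    finally have "l * (l * (8 * B * real n)) \<le> l * 1" using l by (intro mult_left_mono) auto
    then show "0 + 8 * l\<^sup>2 * B * real n \<le> l" by (simp add: power2_eq_square algebra_simps)
  qed (use nn l in auto)
  then have "(\<integral>\<^sup>+X. ?G X \<partial>?P) \<le> ennreal (exp (4 * l\<^sup>2 * B * (real n)\<^sup>2 * h + 2 * real n * l\<^sup>2 * kap\<^sup>2 * v))"
    by (simp only: S_def[symmetric] mult_zero_left mult_zero_right add_0_right add_0_left)
  also have "\<dots> \<le> ennreal (exp (l\<^sup>2 * A))"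
    using mult_left_mono[OF A(1), of "l\<^sup>2"] by (intro ennreal_leI) (simp add: algebra_simps)
  finally have EG: "(\<integral>\<^sup>+X. ?G X \<partial>?P) \<le> ennreal (exp (l\<^sup>2 * A))" .
  have lt: "l\<^sup>2 * A - l * t \<le> - x"
  proof -
    have s: "sqrt (x / A) * sqrt (A * x) = x" using x A
      by (simp add: real_sqrt_mult[symmetric])
    have "l * A \<le> sqrt (x / A) * A" using l A by (intro mult_right_mono) auto
    also have "\<dots> = sqrt (A * x)"
      using A x by (simp add: real_sqrt_divide real_sqrt_mult field_simps)
    finally have "l * A \<le> sqrt (A * x)" .
    then have "l * (l * A) \<le> l * sqrt (A * x)" using l by (intro mult_left_mono) auto
    moreover have "l * (2 * sqrt (A * x) + 2 * x / lam) \<le> l * t" using l t by (intro mult_left_mono) auto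
    moreover have "x \<le> l * sqrt (A * x) + l * (2 * x / lam)"
    proof (cases "lam \<le> sqrt (x / A)")
      case True
      then have "l = lam" by (simp add: l_def)
      then show ?thesis using nn x A by auto
    next
      case False
      then have "l = sqrt (x / A)" by (simp add: l_def)
      moreover have "0 \<le> l * (2 * x / lam)" using l x nn by simp
      ultimately show ?thesis using s by simp
    qed
    ultimately show ?thesis by (simp add: power2_eq_square algebra_simps)
  qed
  let ?W = "{X \<in> space ?P. (\<forall>j\<in>{1..n}. 4 * l * \<bar>chaos_inc H X j\<bar> \<le> 1) \<and> S X \<le> - t}"
  have Wm: "?W \<in> sets ?P" by measurable
  have "outer_measure_of ?P {X \<in> space ?P. (\<forall>j\<in>{1..n}. 4 * lam * \<bar>chaos_inc H X j\<bar> \<le> 1) \<and> S X \<le> - t}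
      \<le> outer_measure_of ?P ?W"
  proof (rule outer_measure_of_mono)
    have "4 * l * \<bar>z\<bar> \<le> 1" if "4 * lam * \<bar>z\<bar> \<le> 1" for z :: real
      using that mult_right_mono[OF l(2), of "4 * \<bar>z\<bar>"] by (simp add: algebra_simps)
    then show "{X \<in> space ?P. (\<forall>j\<in>{1..n}. 4 * lam * \<bar>chaos_inc H X j\<bar> \<le> 1) \<and> S X \<le> - t} \<subseteq> ?W" by blast
  qed
  also have "\<dots> = emeasure ?P ?W" using Wm by (rule outer_measure_of_eq)
  also have "\<dots> = (\<integral>\<^sup>+X. indicator ?W X \<partial>?P)" by (rule nn_integral_indicator[symmetric]) measurable
  also have "\<dots> \<le> (\<integral>\<^sup>+X. ennreal (exp (- (l * t))) * ?G X \<partial>?P)"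
  proof (rule nn_integral_mono)
    fix X assume "X \<in> space ?P"
    show "indicator ?W X \<le> ennreal (exp (- (l * t))) * ?G X"
    proof (cases "X \<in> ?W")
      case True
      then have "l * S X \<le> l * (- t)" using l by (intro mult_left_mono) auto
      then have "0 \<le> - (l * t) + - l * S X" by simp
      then have "ennreal 1 \<le> ennreal (exp (- (l * t)) * exp (- l * S X))"
        by (intro ennreal_leI) (simp only: exp_add[symmetric] one_le_exp_iff)
      then show ?thesis using True by (simp add: ennreal_mult')
    qed simp
  qed
  also have "\<dots> = ennreal (exp (- (l * t))) * (\<integral>\<^sup>+X. ?G X \<partial>?P)"
    by (rule nn_integral_cmult) measurable
  also have "\<dots> \<le> ennreal (exp (- (l * t))) * ennreal (exp (l\<^sup>2 * A))"
    by (intro mult_left_mono EG) auto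
  also have "\<dots> = ennreal (exp (- (l * t) + l\<^sup>2 * A))" by (simp add: ennreal_mult'[symmetric] mult_exp_exp)
  also have "\<dots> \<le> ennreal (exp (- x))" using lt by (intro ennreal_leI) simp
  finally show ?thesis unfolding S_def .
qed

text \<open>Given one observation, the indicators that the others are close to it are independent with
probability at most \<open>p\<close>, so the exponential moment of their number is at most
\<open>(1 + (exp 1 - 1) * p) ^ n \<le> exp (2 * n * p)\<close>; then Markov's inequality and a union bound.\<close>
lemma neighbour_count_tail:
  fixes M :: "real measure"
  assumes "prob_space M" and sM [measurable_cong]: "sets M = sets borel"
    and p: "\<And>y. emeasure M {z. \<bar>z - y\<bar> \<le> \<rho>} \<le> ennreal p" and p0: "0 \<le> p"
  shows "outer_measure_of (\<Pi>\<^sub>M i\<in>{1..n}. M) {X \<in> space (\<Pi>\<^sub>M i\<in>{1..n}. M).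
      \<exists>l\<in>{1..n}. 2 * real n * p + x \<le> real (card {i \<in> {1..n} - {l}. \<bar>X i - X l\<bar> \<le> \<rho>})}
      \<le> ennreal (real n * exp (- x))"
proof -
  interpret M: prob_space M by fact
  interpret product_prob_space "\<lambda>_::nat. M" "{1..n}"
    using assms(1) by (simp add: product_prob_space_def product_sigma_finite_def prob_space_imp_sigma_finite product_prob_space_axioms_def)
  let ?P = "\<Pi>\<^sub>M i\<in>{1..n}. M"
  let ?t = "2 * real n * p + x"
  define E where "E l X = (\<Prod>i\<in>{1..n} - {l}. if \<bar>X i - X l\<bar> \<le> \<rho> then ennreal (exp 1) else 1)" for l and X :: "nat \<Rightarrow> real"
  have Ecard: "E l X = ennreal (exp (real (card {i \<in> {1..n} - {l}. \<bar>X i - X l\<bar> \<le> \<rho>})))" for l X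
  proof -
    have "E l X = (\<Prod>i\<in>{i \<in> {1..n} - {l}. \<bar>X i - X l\<bar> \<le> \<rho>}. ennreal (exp 1))"
      unfolding E_def by (simp add: prod.inter_filter[symmetric])
    also have "\<dots> = ennreal (exp 1 ^ card {i \<in> {1..n} - {l}. \<bar>X i - X l\<bar> \<le> \<rho>})"
      by (simp add: ennreal_power)
    finally show ?thesis by (simp add: exp_of_nat_mult[symmetric])
  qed
  have Em [measurable]: "E l \<in> borel_measurable ?P" if "l \<in> {1..n}" for l
    unfolding E_def using that by measurable
  have EE: "(\<integral>\<^sup>+X. E l X \<partial>?P) \<le> ennreal (exp (2 * real n * p))" if l: "l \<in> {1..n}" for l
  proof -
    let ?J = "{1..n} - {l}"
    have ins: "{1..n} = insert l ?J" using l by auto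
    have one: "(\<integral>\<^sup>+z. (if \<bar>z - y\<bar> \<le> \<rho> then ennreal (exp 1) else 1) \<partial>M) \<le> ennreal (exp (2 * p))" for y
    proof -
      have e3: "ennreal (exp 1) \<le> 1 + ennreal 2"
      proof -
        have "ennreal (exp 1) \<le> ennreal (1 + 2)" using exp_le by (intro ennreal_leI) simp
        also have "\<dots> = 1 + ennreal 2" by (subst ennreal_plus) auto
        finally show ?thesis .
      qed
      have "(\<integral>\<^sup>+z. (if \<bar>z - y\<bar> \<le> \<rho> then ennreal (exp 1) else 1) \<partial>M)
        \<le> (\<integral>\<^sup>+z. 1 + ennreal 2 * indicator {z. \<bar>z - y\<bar> \<le> \<rho>} z \<partial>M)"
        using e3 by (intro nn_integral_mono) (auto)
      also have "\<dots> = 1 + ennreal 2 * emeasure M {z. \<bar>z - y\<bar> \<le> \<rho>}"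
        by (subst nn_integral_add) (auto simp: nn_integral_cmult M.emeasure_space_1)
      also have "\<dots> \<le> 1 + ennreal 2 * ennreal p" by (intro add_mono mult_left_mono p) auto
      also have "\<dots> = ennreal (1 + 2 * p)" using p0 ennreal_mult'[of 2 p] by (simp add: ennreal_plus)
      also have "\<dots> \<le> ennreal (exp (2 * p))" using exp_ge_add_one_self[of "2 * p"] by (intro ennreal_leI) simp
      finally show ?thesis .
    qed
    have "(\<integral>\<^sup>+X. E l X \<partial>?P) = (\<integral>\<^sup>+y. (\<integral>\<^sup>+x. E l (x(l := y)) \<partial>(\<Pi>\<^sub>M i\<in>?J. M)) \<partial>M)"
      using product_nn_integral_insert_rev[of ?J l "E l", unfolded ins[symmetric], OF _ _ Em[OF l]] by simp
    also have "\<dots> = (\<integral>\<^sup>+y. (\<integral>\<^sup>+x. (\<Prod>i\<in>?J. if \<bar>x i - y\<bar> \<le> \<rho> then ennreal (exp 1) else 1) \<partial>(\<Pi>\<^sub>M i\<in>?J. M)) \<partial>M)"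
      unfolding E_def by (intro nn_integral_cong prod.cong) auto
    also have "\<dots> = (\<integral>\<^sup>+y. (\<Prod>i\<in>?J. \<integral>\<^sup>+z. (if \<bar>z - y\<bar> \<le> \<rho> then ennreal (exp 1) else 1) \<partial>M) \<partial>M)"
      by (subst product_nn_integral_prod) auto
    also have "\<dots> \<le> (\<integral>\<^sup>+y. (\<Prod>i\<in>?J. ennreal (exp (2 * p))) \<partial>M)"
      by (intro nn_integral_mono prod_mono_ennreal one)
    also have "\<dots> = ennreal (exp (2 * p) ^ card ?J)" by (simp add: ennreal_power M.emeasure_space_1)
    also have "exp (2 * p) ^ card ?J = exp (real (card ?J) * (2 * p))" by (simp add: exp_of_nat_mult)
    also have "ennreal \<dots> \<le> ennreal (exp (2 * real n * p))"
      using p0 l by (intro ennreal_leI) (auto simp: algebra_simps mult_left_mono)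
    finally show ?thesis .
  qed
  have one: "emeasure ?P {X \<in> space ?P. ?t \<le> real (card {i \<in> {1..n} - {l}. \<bar>X i - X l\<bar> \<le> \<rho>})} \<le> ennreal (exp (- x))"
    if l: "l \<in> {1..n}" for l
  proof -
    note [measurable] = Em[OF l]
    have eq: "{X \<in> space ?P. ?t \<le> real (card {i \<in> {1..n} - {l}. \<bar>X i - X l\<bar> \<le> \<rho>})}
      = {X \<in> space ?P. 1 \<le> ennreal (exp (- ?t)) * E l X}"
      unfolding Ecard by (auto simp: ennreal_mult'[symmetric] exp_add[symmetric] simp flip: ennreal_1)
    have "emeasure ?P {X \<in> space ?P. 1 \<le> ennreal (exp (- ?t)) * E l X}
       \<le> ennreal (exp (- ?t)) * (\<integral>\<^sup>+X. E l X * indicator (space ?P) X \<partial>?P)"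
      by (rule nn_integral_Markov_inequality) measurable
    also have "(\<integral>\<^sup>+X. E l X * indicator (space ?P) X \<partial>?P) = (\<integral>\<^sup>+X. E l X \<partial>?P)"
      by (intro nn_integral_cong) auto
    also have "ennreal (exp (- ?t)) * (\<integral>\<^sup>+X. E l X \<partial>?P) \<le> ennreal (exp (- ?t)) * ennreal (exp (2 * real n * p))"
      by (intro mult_left_mono EE l) auto
    also have "\<dots> = ennreal (exp (- x))" by (simp add: ennreal_mult'[symmetric] exp_add[symmetric])
    finally show ?thesis unfolding eq .
  qed
  have ms: "{X \<in> space ?P. ?t \<le> real (card {i \<in> {1..n} - {l}. \<bar>X i - X l\<bar> \<le> \<rho>})} \<in> sets ?P" if l: "l \<in> {1..n}" for l
  proof -
    note [measurable] = Em[OF l]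
    have eq: "{X \<in> space ?P. ?t \<le> real (card {i \<in> {1..n} - {l}. \<bar>X i - X l\<bar> \<le> \<rho>})}
      = {X \<in> space ?P. 1 \<le> ennreal (exp (- ?t)) * E l X}"
      unfolding Ecard by (auto simp: ennreal_mult'[symmetric] exp_add[symmetric] simp flip: ennreal_1)
    show ?thesis unfolding eq by measurable
  qed
  have "outer_measure_of ?P {X \<in> space ?P. \<exists>l\<in>{1..n}. ?t \<le> real (card {i \<in> {1..n} - {l}. \<bar>X i - X l\<bar> \<le> \<rho>})}
    = outer_measure_of ?P (\<Union>l\<in>{1..n}. {X \<in> space ?P. ?t \<le> real (card {i \<in> {1..n} - {l}. \<bar>X i - X l\<bar> \<le> \<rho>})})"
    by (intro arg_cong2[where f = outer_measure_of]) auto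
  also have "\<dots> = emeasure ?P (\<Union>l\<in>{1..n}. {X \<in> space ?P. ?t \<le> real (card {i \<in> {1..n} - {l}. \<bar>X i - X l\<bar> \<le> \<rho>})})"
    using ms by (intro outer_measure_of_eq sets.finite_UN) auto
  also have "\<dots> \<le> (\<Sum>l\<in>{1..n}. emeasure ?P {X \<in> space ?P. ?t \<le> real (card {i \<in> {1..n} - {l}. \<bar>X i - X l\<bar> \<le> \<rho>})})"
    using ms by (intro emeasure_subadditive_finite) auto
  also have "\<dots> \<le> (\<Sum>l\<in>{1..n}. ennreal (exp (- x)))" by (intro sum_mono one)
  also have "\<dots> = ennreal (real n * exp (- x))" by (simp add: ennreal_mult' ennreal_of_nat_eq_real_of_nat)
  finally show ?thesis .
qed

section \<open>Square integrable functions\<close>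

lemma L2_times_integrable:
  assumes "g \<in> L2" "h \<in> L2"
  shows "integrable lborel (\<lambda>x. g x * h x)"
proof (rule Bochner_Integration.integrable_bound)
  show "integrable lborel (\<lambda>x. (g x)\<^sup>2 + (h x)\<^sup>2)" using assms by (auto simp: L2_def)
  show "(\<lambda>x. g x * h x) \<in> borel_measurable lborel" using assms by (auto simp: L2_def)
  have "\<bar>u * v\<bar> \<le> u\<^sup>2 + v\<^sup>2" for u v :: real
  proof -
    have "2 * \<bar>u\<bar> * \<bar>v\<bar> \<le> u\<^sup>2 + v\<^sup>2" using sum_squares_bound[of "\<bar>u\<bar>" "\<bar>v\<bar>"] by simp
    moreover have "0 \<le> \<bar>u\<bar> * \<bar>v\<bar>" by simp
    ultimately show ?thesis unfolding abs_mult by linarith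
  qed
  then show "AE x in lborel. norm (g x * h x) \<le> norm ((g x)\<^sup>2 + (h x)\<^sup>2)" by (intro AE_I2) simp
qed

lemma L2_scale: "g \<in> L2 \<Longrightarrow> (\<lambda>x. c * g x) \<in> L2"
  by (auto simp: L2_def power_mult_distrib)

lemma L2_add:
  assumes "g \<in> L2" "h \<in> L2"
  shows "(\<lambda>x. g x + h x) \<in> L2"
  using assms L2_times_integrable[OF assms]
  by (auto simp: L2_def power2_sum mult.assoc)

lemma L2_diff:
  assumes "g \<in> L2" "h \<in> L2"
  shows "(\<lambda>x. g x - h x) \<in> L2"
  using L2_add[OF assms(1) L2_scale[OF assms(2), of "-1"]] by simp

lemma L2_sum:
  assumes "\<And>i. i \<in> F \<Longrightarrow> u i \<in> L2"
  shows "(\<lambda>x. \<Sum>i\<in>F. u i x) \<in> L2"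
  using assms
proof (induction F rule: infinite_finite_induct)
  case (insert i F)
  then show ?case using L2_add[of "u i" "\<lambda>x. \<Sum>i\<in>F. u i x"] by simp
qed (auto simp: L2_def)

lemma L2_norm_sq: "(L2_norm g)\<^sup>2 = L2_inner g g"
  by (simp add: L2_norm_def L2_inner_def power2_eq_square)

lemma L2_inner_commute: "L2_inner g h = L2_inner h g"
  by (simp add: L2_inner_def mult.commute)

lemma L2_inner_diff:
  "g \<in> L2 \<Longrightarrow> h \<in> L2 \<Longrightarrow> u \<in> L2 \<Longrightarrow> L2_inner (\<lambda>x. g x - h x) u = L2_inner g u - L2_inner h u"
  using L2_times_integrable[of g u] L2_times_integrable[of h u]
  by (simp add: L2_inner_def algebra_simps)

lemma L2_inner_scale: "L2_inner (\<lambda>x. c * g x) u = c * L2_inner g u"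
  by (simp add: L2_inner_def mult.assoc)

lemma L2_inner_sum:
  assumes "\<And>i. i \<in> F \<Longrightarrow> u i \<in> L2" "v \<in> L2"
  shows "L2_inner (\<lambda>x. \<Sum>i\<in>F. u i x) v = (\<Sum>i\<in>F. L2_inner (u i) v)"
  using assms L2_times_integrable[of _ v]
  by (simp add: L2_inner_def sum_distrib_right)

lemma L2_norm_diff_sq:
  assumes "g \<in> L2" "h \<in> L2"
  shows "(L2_norm (\<lambda>x. g x - h x))\<^sup>2 = L2_inner g g - 2 * L2_inner g h + L2_inner h h"
proof -
  let ?d = "\<lambda>x. g x - h x"
  have d: "?d \<in> L2" by (rule L2_diff[OF assms])
  have "L2_inner ?d ?d = L2_inner ?d g - L2_inner ?d h"
    using L2_inner_diff[OF assms d] L2_inner_commute[of g ?d] L2_inner_commute[of h ?d] by simp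
  also have "\<dots> = (L2_inner g g - L2_inner h g) - (L2_inner g h - L2_inner h h)"
    using assms by (simp add: L2_inner_diff)
  finally show ?thesis using L2_inner_commute[of h g] by (simp add: L2_norm_sq)
qed

lemma L2_norm_nonneg: "0 \<le> L2_norm g" by (simp add: L2_norm_def)

lemma L2_cauchy_schwarz:
  assumes g: "g \<in> L2" and h: "h \<in> L2"
  shows "\<bar>L2_inner g h\<bar> \<le> L2_norm g * L2_norm h"
proof -
  have q: "0 \<le> L2_inner g g - 2 * t * L2_inner g h + t\<^sup>2 * L2_inner h h" for t
  proof -
    have "L2_inner g (\<lambda>x. t * h x) = t * L2_inner g h"
      by (simp only: L2_inner_commute[of g] L2_inner_scale)
    moreover have "L2_inner (\<lambda>x. t * h x) (\<lambda>x. t * h x) = t\<^sup>2 * L2_inner h h"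
    proof -
      have "t * h x * (t * h x) = t\<^sup>2 * (h x * h x)" for x by (simp add: power2_eq_square)
      then show ?thesis by (simp only: L2_inner_def integral_mult_right_zero)
    qed
    ultimately show ?thesis
      using L2_norm_diff_sq[OF g L2_scale[OF h, of t]] zero_le_power2[of "L2_norm (\<lambda>x. g x - t * h x)"] by simp
  qed
  have "(L2_inner g h)\<^sup>2 \<le> L2_inner g g * L2_inner h h"
  proof (cases "L2_inner h h = 0")
    case True
    have "L2_inner g h = 0"
    proof (rule ccontr)
      assume "L2_inner g h \<noteq> 0"
      then show False using q[of "(L2_inner g g + 1) / (2 * L2_inner g h)"] True by simp
    qed
    then show ?thesis using True by simp
  next
    case False
    then have "0 < L2_inner h h" using L2_norm_sq[of h] zero_le_power2[of "L2_norm h"] by linarith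
    then show ?thesis using q[of "L2_inner g h / L2_inner h h"]
      by (simp add: power2_eq_square field_simps)
  qed
  then have "(L2_inner g h)\<^sup>2 \<le> (L2_norm g * L2_norm h)\<^sup>2" by (simp add: L2_norm_sq power_mult_distrib)
  then show ?thesis using L2_norm_nonneg[of g] L2_norm_nonneg[of h]
    by (simp only: abs_le_square_iff[symmetric]) (simp add: abs_mult)
qed

lemma bounded_integrable_L2:
  assumes [measurable]: "g \<in> borel_measurable borel" and "integrable lborel g" and "\<And>x. \<bar>g x\<bar> \<le> G"
  shows "g \<in> L2"
proof -
  have "integrable lborel (\<lambda>x. (g x)\<^sup>2)"
  proof (rule Bochner_Integration.integrable_bound)
    show "integrable lborel (\<lambda>x. G * \<bar>g x\<bar>)" using assms(2) by auto
    have "\<bar>(g x)\<^sup>2\<bar> \<le> \<bar>G * \<bar>g x\<bar>\<bar>" for x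
    proof -
      have "\<bar>g x\<bar> * \<bar>g x\<bar> \<le> \<bar>G\<bar> * \<bar>g x\<bar>"
        using assms(3)[of x] by (intro mult_right_mono) auto
      then show ?thesis by (simp add: power2_eq_square abs_mult)
    qed
    then show "AE x in lborel. norm ((g x)\<^sup>2) \<le> norm (G * \<bar>g x\<bar>)" by (intro AE_I2) simp
  qed simp
  then show ?thesis by (simp add: L2_def)
qed

text \<open>The chosen projection \<open>p\<close> and the candidate \<open>h\<close> may differ on a null set. Testing both orthogonality
relations against both \<open>p\<close> and \<open>h\<close> gives \<open>\<langle>p, p\<rangle> = \<langle>g, p\<rangle> = \<langle>h, p\<rangle> = \<langle>g, h\<rangle> = \<langle>h, h\<rangle>\<close>, and the
distance depends on nothing else.\<close>
lemma L2_proj_dist: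
  assumes g: "g \<in> L2" and S: "S \<subseteq> L2" and h: "h \<in> S" and orth: "\<And>u. u \<in> S \<Longrightarrow> L2_inner (\<lambda>x. g x - h x) u = 0"
  shows "(L2_norm (\<lambda>x. g x - L2_proj S g x))\<^sup>2 = L2_inner g g - L2_inner h h"
proof -
  define p where "p = L2_proj S g"
  have "p \<in> S \<and> (\<forall>h\<in>S. L2_inner (\<lambda>x. g x - p x) h = 0)"
    unfolding p_def L2_proj_def by (rule someI[of _ h]) (use h orth in auto)
  then have p: "p \<in> S" and po: "\<And>u. u \<in> S \<Longrightarrow> L2_inner (\<lambda>x. g x - p x) u = 0" by auto
  have L: "p \<in> L2" "h \<in> L2" using p h S by auto
  have "L2_inner g p = L2_inner p p" "L2_inner g h = L2_inner p h"
    using po[OF p] po[OF h] L g by (simp_all add: L2_inner_diff)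
  moreover have "L2_inner g p = L2_inner h p" "L2_inner g h = L2_inner h h"
    using orth[OF p] orth[OF h] L g by (simp_all add: L2_inner_diff)
  ultimately show ?thesis
    using L2_norm_diff_sq[OF g L(1)] L2_inner_commute[of h p] unfolding p_def by simp
qed

section \<open>The reproducing kernel of a scaling space\<close>

text \<open>The properties of a scaling function that matter at one resolution. The bounds \<open>a\<close>, \<open>M\<close> and \<open>Lip\<close>
refer to \<open>\<phi>\<close> and not to its dilates, so that constants built from them are uniform in \<open>D\<close>.\<close>
locale scaling_kernel =
  fixes \<phi> :: "real \<Rightarrow> real" and D :: nat and a M Lip :: real
  assumes supp: "\<phi> x \<noteq> 0 \<Longrightarrow> \<bar>x\<bar> \<le> a"
    and bnd: "\<bar>\<phi> x\<bar> \<le> M"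
    and lip: "\<bar>\<phi> x - \<phi> y\<bar> \<le> Lip * \<bar>x - y\<bar>"
    and eL2: "dilate \<phi> D k \<in> L2"
    and ortho: "L2_inner (dilate \<phi> D j) (dilate \<phi> D k) = (if j = k then 1 else 0)"
    and D: "1 \<le> D" and a: "0 \<le> a"
begin

abbreviation e :: "int \<Rightarrow> real \<Rightarrow> real" where "e \<equiv> dilate \<phi> D"

text \<open>Contains every \<open>k\<close> with \<open>e k x \<noteq> 0\<close>. Being finite, it turns the series defining the reproducing
kernel and the projection into finite sums at each point.\<close>
definition near :: "real \<Rightarrow> int set" where "near x = {k. \<bar>real D * x - of_int k\<bar> \<le> a}"

definition ker :: "real \<Rightarrow> real \<Rightarrow> real" where "ker x y = (\<Sum>k\<in>near x. e k x * e k y)"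

text \<open>The sup norm of the kernel is at most \<open>amp * D\<close>, and its integral in one variable at most
\<open>4 * a * amp\<close>, uniformly in \<open>D\<close>.\<close>
definition amp :: real where "amp = M\<^sup>2 * (2 * a + 1)"

lemma e_nz: "e k x \<noteq> 0 \<Longrightarrow> k \<in> near x"
  using supp[of "real D * x - of_int k"] by (auto simp: dilate_def near_def)

lemma near_subset: "near x \<subseteq> {\<lceil>real D * x - a\<rceil>..\<lfloor>real D * x + a\<rfloor>}"
  by (auto simp: near_def abs_le_iff ceiling_le_iff le_floor_iff)

lemma finite_near [simp]: "finite (near x)"
  using near_subset finite_subset by blast

lemma card_near: "real (card (near x)) \<le> 2 * a + 1"
proof -
  have "card (near x) \<le> card {\<lceil>real D * x - a\<rceil>..\<lfloor>real D * x + a\<rfloor>}"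
    by (rule card_mono[OF _ near_subset]) simp
  also have "\<dots> = nat (\<lfloor>real D * x + a\<rfloor> + 1 - \<lceil>real D * x - a\<rceil>)" by simp
  finally have "real (card (near x)) \<le> real (nat (\<lfloor>real D * x + a\<rfloor> + 1 - \<lceil>real D * x - a\<rceil>))"
    by (rule of_nat_mono)
  also have "\<dots> \<le> 2 * a + 1"
  proof (cases "0 \<le> \<lfloor>real D * x + a\<rfloor> + 1 - \<lceil>real D * x - a\<rceil>")
    case True
    have "real_of_int (\<lfloor>real D * x + a\<rfloor> + 1 - \<lceil>real D * x - a\<rceil>) \<le> 2 * a + 1"
      using of_int_floor_le[of "real D * x + a"] le_of_int_ceiling[of "real D * x - a"] by simp linarith
    then show ?thesis using True by (simp only: of_nat_nat)
  qed (use a in simp)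
  finally show ?thesis .
qed

lemma ker_eq: "finite F \<Longrightarrow> near x \<subseteq> F \<Longrightarrow> ker x y = (\<Sum>k\<in>F. e k x * e k y)"
  unfolding ker_def by (rule sum.mono_neutral_left) (auto dest: e_nz)

lemma ker_sym: "ker x y = ker y x"
  using ker_eq[of "near x \<union> near y" x y] ker_eq[of "near x \<union> near y" y x] by (simp add: mult.commute)

lemma M_nonneg: "0 \<le> M" using bnd[of 0] by linarith

lemma amp_nonneg: "0 \<le> amp" using a by (simp add: amp_def)

lemma e_bound: "\<bar>e k x\<bar> \<le> sqrt (real D) * M"
  using bnd by (simp add: dilate_def abs_mult mult_left_mono)

lemma ker_bound: "\<bar>ker x y\<bar> \<le> amp * real D * indicator {y. \<bar>y - x\<bar> \<le> 2 * a / real D} y"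
proof (cases "\<bar>y - x\<bar> \<le> 2 * a / real D")
  case True
  have "\<bar>ker x y\<bar> \<le> (\<Sum>k\<in>near x. (sqrt (real D) * M) * (sqrt (real D) * M))"
    unfolding ker_def
    by (intro order_trans[OF sum_abs] sum_mono) (auto simp: abs_mult M_nonneg intro!: mult_mono e_bound)
  also have "\<dots> = real (card (near x)) * (real D * M\<^sup>2)"
    by (simp add: power2_eq_square algebra_simps flip: real_sqrt_mult)
  also have "\<dots> \<le> (2 * a + 1) * (real D * M\<^sup>2)" by (intro mult_right_mono card_near) auto
  finally show ?thesis using True by (simp add: amp_def algebra_simps)
next
  case False
  have "ker x y = 0" unfolding ker_def
  proof (rule sum.neutral, intro ballI, rule ccontr)
    fix k assume "e k x * e k y \<noteq> 0"
    then have "k \<in> near x" "k \<in> near y" using e_nz by auto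
    then have "\<bar>real D * y - real D * x\<bar> \<le> 2 * a" unfolding near_def mem_Collect_eq by arith
    then have "real D * \<bar>y - x\<bar> \<le> 2 * a" by (simp add: abs_mult flip: right_diff_distrib)
    then show False using False D by (simp add: field_simps)
  qed
  then show ?thesis using False by simp
qed

lemma ker_le: "\<bar>ker x y\<bar> \<le> amp * real D"
  using order_trans[OF ker_bound, of x y "amp * real D"] amp_nonneg by (simp split: split_indicator)

lemma Lip_nonneg: "0 \<le> Lip" using lip[of 0 1] by simp

text \<open>At most \<open>2 * (2 * a + 1)\<close> indices contribute to the difference; each term has Lipschitz constant of
order \<open>D\<^sup>2\<close>, one factor \<open>D\<close> from the normalization and one from the dilation.\<close>
lemma ker_lip: "\<bar>ker x y - ker x' y'\<bar> \<le> 2 * (2 * a + 1) * M * Lip * (real D)\<^sup>2 * (\<bar>x - x'\<bar> + \<bar>y - y'\<bar>)"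
proof -
  let ?F = "near x \<union> near x'"
  have ed: "\<bar>e k u - e k v\<bar> \<le> sqrt (real D) * (Lip * (real D * \<bar>u - v\<bar>))" for k u v
  proof -
    have "\<bar>e k u - e k v\<bar> = sqrt (real D) * \<bar>\<phi> (real D * u - of_int k) - \<phi> (real D * v - of_int k)\<bar>"
      by (simp add: dilate_def abs_mult flip: right_diff_distrib)
    also have "\<dots> \<le> sqrt (real D) * (Lip * \<bar>(real D * u - of_int k) - (real D * v - of_int k)\<bar>)"
      by (intro mult_left_mono lip) auto
    also have "\<dots> = sqrt (real D) * (Lip * (real D * \<bar>u - v\<bar>))"
      by (simp add: abs_mult flip: right_diff_distrib)
    finally show ?thesis .
  qed
  have t: "\<bar>e k x * e k y - e k x' * e k y'\<bar> \<le> M * Lip * (real D)\<^sup>2 * (\<bar>x - x'\<bar> + \<bar>y - y'\<bar>)" for k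
  proof -
    have "\<bar>e k x * e k y - e k x' * e k y'\<bar> = \<bar>e k x * (e k y - e k y') + (e k x - e k x') * e k y'\<bar>"
      by (simp add: algebra_simps)
    also have "\<dots> \<le> \<bar>e k x\<bar> * \<bar>e k y - e k y'\<bar> + \<bar>e k x - e k x'\<bar> * \<bar>e k y'\<bar>"
      by (metis abs_mult abs_triangle_ineq)
    also have "\<dots> \<le> (sqrt (real D) * M) * (sqrt (real D) * (Lip * (real D * \<bar>y - y'\<bar>)))
        + (sqrt (real D) * (Lip * (real D * \<bar>x - x'\<bar>))) * (sqrt (real D) * M)"
      using M_nonneg Lip_nonneg by (intro add_mono mult_mono e_bound ed) auto
    also have "\<dots> = (sqrt (real D) * sqrt (real D)) * (M * Lip * real D * (\<bar>x - x'\<bar> + \<bar>y - y'\<bar>))"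
      by algebra
    finally show ?thesis by (simp add: power2_eq_square algebra_simps)
  qed
  have "\<bar>ker x y - ker x' y'\<bar> = \<bar>\<Sum>k\<in>?F. e k x * e k y - e k x' * e k y'\<bar>"
    using ker_eq[of ?F x y] ker_eq[of ?F x' y'] by (simp add: sum_subtractf)
  also have "\<dots> \<le> (\<Sum>k\<in>?F. M * Lip * (real D)\<^sup>2 * (\<bar>x - x'\<bar> + \<bar>y - y'\<bar>))"
    by (intro order_trans[OF sum_abs] sum_mono t)
  also have "\<dots> = real (card ?F) * (M * Lip * (real D)\<^sup>2 * (\<bar>x - x'\<bar> + \<bar>y - y'\<bar>))" by simp
  also have "\<dots> \<le> (2 * (2 * a + 1)) * (M * Lip * (real D)\<^sup>2 * (\<bar>x - x'\<bar> + \<bar>y - y'\<bar>))"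
  proof (rule mult_right_mono)
    have "real (card ?F) \<le> real (card (near x)) + real (card (near x'))"
      using card_Un_le[of "near x" "near x'"] by linarith
    also have "\<dots> \<le> (2 * a + 1) + (2 * a + 1)" by (intro add_mono card_near)
    finally show "real (card ?F) \<le> 2 * (2 * a + 1)" by simp
  qed (use M_nonneg Lip_nonneg in auto)
  finally show ?thesis by (simp add: algebra_simps)
qed

lemma e_measurable [measurable]: "e k \<in> borel_measurable borel"
  using eL2[of k] by (simp add: L2_def)

lemma near_eventually: "eventually (\<lambda>N::nat. near x \<subseteq> {- int N..int N}) sequentially"
proof -
  obtain N where N: "near x \<subseteq> {- int N..int N}"
  proof
    show "near x \<subseteq> {- int (nat (\<bar>\<lceil>real D * x - a\<rceil>\<bar> + \<bar>\<lfloor>real D * x + a\<rfloor>\<bar>))..int (nat (\<bar>\<lceil>real D * x - a\<rceil>\<bar> + \<bar>\<lfloor>real D * x + a\<rfloor>\<bar>))}"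
      using near_subset[of x] by (auto simp: subset_iff)
  qed
  then show ?thesis by (intro eventually_sequentiallyI[of N]) force
qed

lemma ker_measurable [measurable]: "(\<lambda>p. ker (fst p) (snd p)) \<in> borel_measurable (borel \<Otimes>\<^sub>M borel)"
proof (rule borel_measurable_LIMSEQ_real)
  fix p :: "real \<times> real"
  have "eventually (\<lambda>N. (\<Sum>k\<in>{- int N..int N}. e k (fst p) * e k (snd p)) = ker (fst p) (snd p)) sequentially"
    using near_eventually[of "fst p"] by eventually_elim (rule ker_eq[symmetric], simp_all)
  then show "(\<lambda>N. \<Sum>k\<in>{- int N..int N}. e k (fst p) * e k (snd p)) \<longlonglongrightarrow> ker (fst p) (snd p)"
    by (rule tendsto_eventually)
qed measurable

lemma ker_L2: "ker x \<in> L2"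
  unfolding ker_def[abs_def] by (intro L2_sum L2_scale eL2)

lemma inner_ker:
  assumes "u \<in> L2"
  shows "L2_inner (ker x) u = (\<Sum>k\<in>near x. L2_inner u (e k) * e k x)"
proof -
  have "L2_inner (ker x) u = (\<Sum>k\<in>near x. L2_inner (\<lambda>y. e k x * e k y) u)"
    unfolding ker_def[abs_def] by (rule L2_inner_sum) (auto intro: L2_scale eL2 assms)
  also have "\<dots> = (\<Sum>k\<in>near x. L2_inner u (e k) * e k x)"
  proof (rule sum.cong[OF refl])
    fix k
    show "L2_inner (\<lambda>y. e k x * e k y) u = L2_inner u (e k) * e k x"
      unfolding L2_inner_scale L2_inner_commute[of u "e k"] by (rule mult.commute)
  qed
  finally show ?thesis .
qed

lemma inner_ker_ker: "L2_inner (ker x) (ker y) = ker x y"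
proof -
  have "L2_inner (ker y) (e k) = e k y" for k
  proof -
    have "L2_inner (ker y) (e k) = (\<Sum>j\<in>near y. L2_inner (e k) (e j) * e j y)"
      by (rule inner_ker[OF eL2])
    also have "\<dots> = (\<Sum>j\<in>near y. if k = j then e j y else 0)" by (intro sum.cong) (auto simp: ortho)
    also have "\<dots> = e k y" using e_nz[of k y] by (simp, blast)
    finally show ?thesis .
  qed
  then show ?thesis unfolding inner_ker[OF ker_L2] by (simp add: ker_def mult.commute)
qed

definition proj :: "(real \<Rightarrow> real) \<Rightarrow> real \<Rightarrow> real" where
  "proj g y = (\<Sum>k\<in>near y. L2_inner g (e k) * e k y)"

definition psum :: "(real \<Rightarrow> real) \<Rightarrow> nat \<Rightarrow> real \<Rightarrow> real" where
  "psum g N y = (\<Sum>k\<in>{- int N..int N}. L2_inner g (e k) * e k y)"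

lemma proj_inner_ker: "g \<in> L2 \<Longrightarrow> proj g x = L2_inner (ker x) g"
  by (simp add: inner_ker proj_def)

lemma psum_eventually: "eventually (\<lambda>N. psum g N y = proj g y) sequentially"
  using near_eventually[of y]
proof eventually_elim
  case (elim N)
  then show ?case unfolding psum_def proj_def
    by (intro sum.mono_neutral_right) (auto dest: e_nz)
qed

lemma psum_L2: "psum g N \<in> L2"
  unfolding psum_def[abs_def] by (intro L2_sum L2_scale eL2)

lemma proj_measurable [measurable]: "proj g \<in> borel_measurable borel"
proof (rule borel_measurable_LIMSEQ_real)
  show "(\<lambda>N. psum g N y) \<longlonglongrightarrow> proj g y" for y by (rule tendsto_eventually[OF psum_eventually])
  show "psum g N \<in> borel_measurable borel" for N using psum_L2[of g N] by (simp add: L2_def)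
qed

lemma span_inner:
  assumes "finite F" "finite G"
  shows "L2_inner (\<lambda>y. \<Sum>k\<in>F. c k * e k y) (\<lambda>y. \<Sum>k\<in>G. d k * e k y) = (\<Sum>k\<in>F \<inter> G. c k * d k)"
proof -
  have "L2_inner (\<lambda>y. \<Sum>k\<in>F. c k * e k y) (\<lambda>y. \<Sum>k\<in>G. d k * e k y)
    = (\<Sum>k\<in>F. c k * L2_inner (e k) (\<lambda>y. \<Sum>k\<in>G. d k * e k y))"
    by (subst L2_inner_sum) (auto intro!: L2_scale eL2 L2_sum simp: L2_inner_scale)
  also have "\<dots> = (\<Sum>k\<in>F. c k * (\<Sum>j\<in>G. d j * L2_inner (e j) (e k)))"
    by (intro sum.cong refl arg_cong2[where f = "(*)"], subst L2_inner_commute, subst L2_inner_sum)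
      (auto intro!: L2_scale eL2 L2_sum simp: L2_inner_scale)
  also have "\<dots> = (\<Sum>k\<in>F. if k \<in> G then c k * d k else 0)"
    using assms by (intro sum.cong refl) (auto simp: ortho if_distrib cong: if_cong)
  also have "\<dots> = (\<Sum>k\<in>F \<inter> G. c k * d k)" using assms by (simp add: sum.inter_restrict)
  finally show ?thesis .
qed

lemma psum_diff_norm:
  assumes "N \<le> N'"
  shows "(L2_norm (\<lambda>y. psum g N' y - psum g N y))\<^sup>2
      = (\<Sum>k\<in>{- int N'..int N'}. (L2_inner g (e k))\<^sup>2) - (\<Sum>k\<in>{- int N..int N}. (L2_inner g (e k))\<^sup>2)"
proof -
  have [simp]: "{- int N'..int N'} \<inter> {- int N..int N} = {- int N..int N}" using assms by auto
  show ?thesis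
    by (subst L2_norm_diff_sq[OF psum_L2 psum_L2], unfold psum_def[abs_def], simp add: span_inner del: Int_atLeastAtMost)
      (simp add: power2_eq_square)
qed

lemma bessel:
  assumes "g \<in> L2"
  shows "(\<Sum>k\<in>{- int N..int N}. (L2_inner g (e k))\<^sup>2) \<le> L2_inner g g"
proof -
  have 1: "L2_inner g (psum g N) = (\<Sum>k\<in>{- int N..int N}. (L2_inner g (e k))\<^sup>2)"
    by (subst L2_inner_commute, unfold psum_def[abs_def], subst L2_inner_sum)
      (auto intro!: L2_scale eL2 assms simp: L2_inner_scale power2_eq_square L2_inner_commute)
  have 2: "L2_inner (psum g N) (psum g N) = (\<Sum>k\<in>{- int N..int N}. (L2_inner g (e k))\<^sup>2)"
    unfolding psum_def[abs_def] by (simp add: span_inner power2_eq_square)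
  show ?thesis
    using L2_norm_diff_sq[OF assms psum_L2[of g N]] 1 2 zero_le_power2[of "L2_norm (\<lambda>x. g x - psum g N x)"] by linarith
qed

text \<open>By Bessel's inequality the coefficients are square summable, and at each point the partial sums are
eventually equal to \<open>proj g\<close>. Fatou's lemma therefore bounds the squared distance between \<open>proj g\<close>
and a partial sum by the tail of the series of squared coefficients.\<close>
lemma proj_approx:
  assumes g: "g \<in> L2"
  shows "proj g \<in> L2" "(\<lambda>N. L2_norm (\<lambda>y. proj g y - psum g N y)) \<longlonglongrightarrow> 0"
proof -
  define s where "s N = (\<Sum>k\<in>{- int N..int N}. (L2_inner g (e k))\<^sup>2)" for N
  have "incseq s" unfolding s_def by (intro incseq_SucI sum_mono2) auto
  moreover have "s N \<le> L2_inner g g" for N unfolding s_def by (rule bessel[OF g])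
  ultimately obtain S where S: "s \<longlonglongrightarrow> S" using incseq_convergent by blast
  have pm [measurable]: "psum g N \<in> borel_measurable borel" for N using psum_L2[of g N] by (simp add: L2_def)
  have fatou: "(\<integral>\<^sup>+y. ennreal ((proj g y - psum g N y)\<^sup>2) \<partial>lborel) \<le> ennreal (S - s N)" for N
  proof -
    have "(\<integral>\<^sup>+y. ennreal ((proj g y - psum g N y)\<^sup>2) \<partial>lborel)
      = (\<integral>\<^sup>+y. liminf (\<lambda>N'. ennreal ((psum g N' y - psum g N y)\<^sup>2)) \<partial>lborel)"
    proof (rule nn_integral_cong)
      fix y
      have "(\<lambda>N'. ennreal ((psum g N' y - psum g N y)\<^sup>2)) \<longlonglongrightarrow> ennreal ((proj g y - psum g N y)\<^sup>2)"
        by (intro tendsto_eventually) (use psum_eventually[of g y] in eventually_elim, simp)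
      then show "ennreal ((proj g y - psum g N y)\<^sup>2) = liminf (\<lambda>N'. ennreal ((psum g N' y - psum g N y)\<^sup>2))"
        by (intro lim_imp_Liminf[symmetric]) auto
    qed
    also have "\<dots> \<le> liminf (\<lambda>N'. \<integral>\<^sup>+y. ennreal ((psum g N' y - psum g N y)\<^sup>2) \<partial>lborel)"
      by (intro nn_integral_liminf) measurable
    also have "\<dots> = liminf (\<lambda>N'. ennreal (s N' - s N))"
    proof (intro Liminf_eq)
      show "eventually (\<lambda>N'. (\<integral>\<^sup>+y. ennreal ((psum g N' y - psum g N y)\<^sup>2) \<partial>lborel) = ennreal (s N' - s N)) sequentially"
      proof (rule eventually_sequentiallyI[of N])
        fix N' assume "N \<le> N'"
        have "(\<integral>\<^sup>+y. ennreal ((psum g N' y - psum g N y)\<^sup>2) \<partial>lborel) = ennreal (\<integral>y. (psum g N' y - psum g N y)\<^sup>2 \<partial>lborel)"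
          using L2_diff[OF psum_L2[of g N'] psum_L2[of g N]] by (intro nn_integral_eq_integral) (auto simp: L2_def)
        then show "(\<integral>\<^sup>+y. ennreal ((psum g N' y - psum g N y)\<^sup>2) \<partial>lborel) = ennreal (s N' - s N)"
          using psum_diff_norm[OF \<open>N \<le> N'\<close>, of g] by (simp add: L2_norm_def s_def)
      qed
    qed
    also have "\<dots> = ennreal (S - s N)"
      by (intro lim_imp_Liminf tendsto_intros S) auto
    finally show ?thesis .
  qed
  have dL: "(\<lambda>y. proj g y - psum g N y) \<in> L2" for N
    using fatou[of N] unfolding L2_def by (auto simp: integrable_iff_bounded intro: le_less_trans)
  from L2_add[OF dL[of 0] psum_L2[of g 0]] show "proj g \<in> L2" by simp
  have sq: "(L2_norm (\<lambda>y. proj g y - psum g N y))\<^sup>2 \<le> S - s N" for N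
  proof -
    have "s N \<le> S" using \<open>incseq s\<close> S by (rule incseq_le)
    moreover have "ennreal (\<integral>y. (proj g y - psum g N y)\<^sup>2 \<partial>lborel) \<le> ennreal (S - s N)"
      using fatou[of N] dL[of N] by (subst nn_integral_eq_integral[symmetric]) (auto simp: L2_def)
    ultimately show ?thesis by (simp add: L2_norm_def)
  qed
  have "(\<lambda>N. sqrt (S - s N)) \<longlonglongrightarrow> sqrt (S - S)" by (intro tendsto_intros S)
  then have "(\<lambda>N. sqrt (S - s N)) \<longlonglongrightarrow> 0" by simp
  then show "(\<lambda>N. L2_norm (\<lambda>y. proj g y - psum g N y)) \<longlonglongrightarrow> 0"
  proof (rule tendsto_sandwich[OF _ _ tendsto_const, rotated 2])
    show "\<forall>\<^sub>F N in sequentially. 0 \<le> L2_norm (\<lambda>y. proj g y - psum g N y)"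
      by (simp add: L2_norm_nonneg)
    show "\<forall>\<^sub>F N in sequentially. L2_norm (\<lambda>y. proj g y - psum g N y) \<le> sqrt (S - s N)"
      by (intro always_eventually allI real_le_rsqrt sq)
  qed
qed

lemma proj_in_space:
  assumes "g \<in> L2"
  shows "proj g \<in> wavelet_space \<phi> D"
  unfolding wavelet_space_def L2_closed_span_def
proof (intro CollectI conjI allI impI proj_approx(1)[OF assms])
  fix \<eta> :: real assume "0 < \<eta>"
  from order_tendstoD(2)[OF proj_approx(2)[OF assms] this]
  obtain N where "L2_norm (\<lambda>y. proj g y - psum g N y) < \<eta>" by (auto simp: eventually_sequentially)
  then show "\<exists>F a. finite F \<and> F \<subseteq> UNIV \<and> L2_norm (\<lambda>x. proj g x - (\<Sum>i\<in>F. a i * e i x)) < \<eta>"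
    unfolding psum_def by (intro exI[of _ "{- int N..int N}"] exI[of _ "\<lambda>k. L2_inner g (e k)"]) auto
qed

lemma proj_coeff:
  assumes g: "g \<in> L2"
  shows "L2_inner (proj g) (e k) = L2_inner g (e k)"
proof -
  have "(\<lambda>N. L2_inner (proj g) (e k) - L2_inner (psum g N) (e k)) \<longlonglongrightarrow> 0"
  proof (rule Lim_null_comparison[OF _ proj_approx(2)[OF g]], rule always_eventually, rule allI)
    fix N
    show "norm (L2_inner (proj g) (e k) - L2_inner (psum g N) (e k)) \<le> L2_norm (\<lambda>y. proj g y - psum g N y)"
    proof -
      have "(L2_norm (e k))\<^sup>2 = 1" by (simp add: L2_norm_sq ortho)
      then have "L2_norm (e k) = 1" using L2_norm_nonneg[of "e k"] by (simp add: power2_eq_1_iff)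
      then show ?thesis
        using L2_cauchy_schwarz[OF L2_diff[OF proj_approx(1)[OF g] psum_L2[of g N]] eL2[of k]]
        by (simp add: L2_inner_diff[OF proj_approx(1)[OF g] psum_L2 eL2])
    qed
  qed
  moreover have "eventually (\<lambda>N. L2_inner (proj g) (e k) - L2_inner (psum g N) (e k) = L2_inner (proj g) (e k) - L2_inner g (e k)) sequentially"
  proof (rule eventually_sequentiallyI[of "nat \<bar>k\<bar>"])
    fix N assume "nat \<bar>k\<bar> \<le> N"
    then have "k \<in> {- int N..int N}" by auto
    then have "L2_inner (psum g N) (e k) = L2_inner g (e k)"
      unfolding psum_def[abs_def]
      by (subst L2_inner_sum) (auto intro!: L2_scale eL2 simp: L2_inner_scale ortho if_distrib cong: if_cong)
    then show "L2_inner (proj g) (e k) - L2_inner (psum g N) (e k) = L2_inner (proj g) (e k) - L2_inner g (e k)" by simp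
  qed
  ultimately have "(\<lambda>N::nat. L2_inner (proj g) (e k) - L2_inner g (e k)) \<longlonglongrightarrow> 0"
    by (rule Lim_transform_eventually)
  then show ?thesis by (simp add: LIMSEQ_const_iff)
qed

lemma proj_orthogonal:
  assumes g: "g \<in> L2" and u: "u \<in> wavelet_space \<phi> D"
  shows "L2_inner (\<lambda>x. g x - proj g x) u = 0"
proof -
  let ?r = "\<lambda>x. g x - proj g x"
  have r: "?r \<in> L2" using L2_diff[OF g proj_approx(1)[OF g]] .
  have uL: "u \<in> L2" using u by (simp add: wavelet_space_def L2_closed_span_def)
  have "\<bar>L2_inner ?r u\<bar> \<le> 0 + \<eta>'" if "0 < \<eta>'" for \<eta>'
  proof -
    define \<eta> where "\<eta> = \<eta>' / (L2_norm ?r + 1)"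
    have pos: "0 < L2_norm ?r + 1" using L2_norm_nonneg[of ?r] by linarith
    have "0 < \<eta>" using that pos by (simp add: \<eta>_def)
    then obtain F c where F: "finite F" "L2_norm (\<lambda>x. u x - (\<Sum>i\<in>F. c i * e i x)) < \<eta>"
      using u unfolding wavelet_space_def L2_closed_span_def by blast
    let ?v = "\<lambda>x. \<Sum>i\<in>F. c i * e i x"
    have v: "?v \<in> L2" by (intro L2_sum L2_scale eL2)
    have "L2_inner ?v ?r = (\<Sum>i\<in>F. L2_inner (\<lambda>x. c i * e i x) ?r)"
      by (rule L2_inner_sum) (auto intro: L2_scale eL2 r)
    also have "\<dots> = 0"
      by (simp add: L2_inner_scale L2_inner_commute[of "e _"] L2_inner_diff g proj_approx(1)[OF g] eL2 proj_coeff)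
    finally have "L2_inner ?r u = L2_inner (\<lambda>x. u x - ?v x) ?r"
      by (simp add: L2_inner_diff uL v r L2_inner_commute[of u])
    then have "\<bar>L2_inner ?r u\<bar> \<le> L2_norm (\<lambda>x. u x - ?v x) * L2_norm ?r"
      using L2_cauchy_schwarz[OF L2_diff[OF uL v] r] by simp
    also have "\<dots> \<le> \<eta> * (L2_norm ?r + 1)"
    proof (rule mult_mono)
      show "L2_norm (\<lambda>x. u x - ?v x) \<le> \<eta>" using F(2) by (rule less_imp_le)
    qed (use \<open>0 < \<eta>\<close> in \<open>simp_all add: L2_norm_nonneg\<close>)
    also have "\<dots> = \<eta>'" using pos by (simp add: \<eta>_def)
    finally show ?thesis by simp
  qed
  then have "\<bar>L2_inner ?r u\<bar> \<le> 0" by (rule field_le_epsilon)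
  then show ?thesis by simp
qed

lemma proj_dist:
  assumes "g \<in> L2"
  shows "(L2_norm (\<lambda>x. g x - L2_proj (wavelet_space \<phi> D) g x))\<^sup>2
     = L2_inner g g - L2_inner (proj g) (proj g)"
  by (rule L2_proj_dist[OF assms _ proj_in_space[OF assms] proj_orthogonal[OF assms]])
    (auto simp: wavelet_space_def L2_closed_span_def)

lemma inner_proj:
  assumes "g \<in> L2"
  shows "L2_inner g (proj g) = L2_inner (proj g) (proj g)"
  using proj_orthogonal[OF assms proj_in_space[OF assms]]
  by (simp add: L2_inner_diff assms proj_approx(1)[OF assms])

lemma ker_abs_integral: "(\<integral>y. \<bar>ker x y\<bar> \<partial>lborel) \<le> 4 * a * amp" "integrable lborel (\<lambda>y. ker x y)"
proof -
  have "{y. \<bar>y - x\<bar> \<le> c} = {x - c..x + c}" for c :: real by auto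
  note eq = this[of "2 * a / real D"]
  have ae: "0 \<le> 2 * a / real D" using a by simp
  have i: "integrable lborel (\<lambda>y. amp * real D * indicator {y. \<bar>y - x\<bar> \<le> 2 * a / real D} y)"
    unfolding eq using ae by (intro integrable_mult_right) (simp add: integrable_indicator_iff emeasure_lborel_Icc_eq)
  have m: "ker x \<in> borel_measurable borel" using ker_L2[of x] by (simp add: L2_def)
  show k: "integrable lborel (\<lambda>y. ker x y)"
    using m by (intro Bochner_Integration.integrable_bound[OF i]) (auto intro!: AE_I2 order_trans[OF ker_bound])
  have "(\<integral>y. \<bar>ker x y\<bar> \<partial>lborel) \<le> (\<integral>y. amp * real D * indicator {y. \<bar>y - x\<bar> \<le> 2 * a / real D} y \<partial>lborel)"
    using k by (intro integral_mono i integrable_abs ker_bound) 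
  also have "\<dots> = amp * real D * (4 * a / real D)"
    unfolding eq using ae by simp
  finally show "(\<integral>y. \<bar>ker x y\<bar> \<partial>lborel) \<le> 4 * a * amp" using D by (simp add: mult.commute mult.left_commute)
qed

text \<open>Uniform in \<open>D\<close>, because the \<open>L\<^sup>1\<close> norm of the kernel in one variable is.\<close>
lemma proj_bound:
  assumes g: "g \<in> L2" and G: "\<And>x. \<bar>g x\<bar> \<le> G"
  shows "\<bar>proj g x\<bar> \<le> 4 * a * amp * G"
proof -
  have G0: "0 \<le> G" using G[of 0] by linarith
  have "\<bar>proj g x\<bar> \<le> (\<integral>y. \<bar>ker x y * g y\<bar> \<partial>lborel)"
    unfolding proj_inner_ker[OF g] L2_inner_def by (rule integral_abs_bound)
  also have "\<dots> \<le> (\<integral>y. G * \<bar>ker x y\<bar> \<partial>lborel)"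
  proof (rule integral_mono)
    show "integrable lborel (\<lambda>y. \<bar>ker x y * g y\<bar>)"
      by (rule integrable_abs[OF L2_times_integrable[OF ker_L2 g]])
    show "integrable lborel (\<lambda>y. G * \<bar>ker x y\<bar>)"
      by (intro integrable_mult_right integrable_abs ker_abs_integral(2))
    show "\<bar>ker x y * g y\<bar> \<le> G * \<bar>ker x y\<bar>" for y
      using mult_left_mono[OF G[of y], of "\<bar>ker x y\<bar>"] by (simp add: abs_mult mult.commute)
  qed
  also have "\<dots> \<le> G * (4 * a * amp)" using G0 ker_abs_integral(1)[of x] by (simp add: mult_left_mono)
  finally show ?thesis by (simp add: algebra_simps)
qed

text \<open>The degenerate part, in the sense of Hoeffding, of the kernel under the density \<open>g\<close>: \<open>proj g\<close> is
the conditional mean in either variable and the last summand the full mean.\<close>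
definition ckernel :: "(real \<Rightarrow> real) \<Rightarrow> real \<Rightarrow> real \<Rightarrow> real" where
  "ckernel g x y = ker x y - proj g x - proj g y + L2_inner (proj g) (proj g)"

text \<open>This representation makes every quadratic form in \<open>ckernel\<close> the squared norm of a sum of functions,
which is what the variance hypothesis of \<open>chaos_exp_moment\<close> rests on.\<close>
lemma ckernel_gram:
  assumes "g \<in> L2"
  shows "ckernel g x y = L2_inner (\<lambda>z. ker x z - proj g z) (\<lambda>z. ker y z - proj g z)"
proof -
  note p = proj_approx(1)[OF assms]
  have "L2_inner (ker z) (proj g) = proj g z" for z
    using inner_ker[OF p, of z] by (simp add: proj_coeff[OF assms] proj_def)
  note kp = this
  let ?p = "proj g"
  have d: "(\<lambda>z. ker y z - ?p z) \<in> L2" by (rule L2_diff[OF ker_L2 p])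
  have c: "L2_inner u (\<lambda>z. ker y z - ?p z) = L2_inner u (ker y) - L2_inner u ?p" if "u \<in> L2" for u
    using L2_inner_diff[OF ker_L2 p that, of y] L2_inner_commute[of u "\<lambda>z. ker y z - ?p z"]
      L2_inner_commute[of u "ker y"] L2_inner_commute[of u ?p] by simp
  show ?thesis
    unfolding L2_inner_diff[OF ker_L2 p d] c[OF ker_L2] c[OF p] inner_ker_ker kp ckernel_def
    using kp[of y] L2_inner_commute[of ?p "ker y"] by simp
qed

end

section \<open>Outer probabilities, densities and standardization\<close>

lemma outer_measure_of_Un:
  assumes "A \<subseteq> space M" "B \<subseteq> space M"
  shows "outer_measure_of M (A \<union> B) \<le> outer_measure_of M A + outer_measure_of M B"
proof -
  obtain A' where A': "A' \<in> sets M" "A \<subseteq> A'" "outer_measure_of M A = emeasure M A'"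
    using outer_measure_of_attain[OF assms(1)] by auto
  obtain B' where B': "B' \<in> sets M" "B \<subseteq> B'" "outer_measure_of M B = emeasure M B'"
    using outer_measure_of_attain[OF assms(2)] by auto
  have "outer_measure_of M (A \<union> B) \<le> outer_measure_of M (A' \<union> B')"
    using A' B' by (intro outer_measure_of_mono) auto
  also have "\<dots> = emeasure M (A' \<union> B')" using A' B' by simp
  also have "\<dots> \<le> emeasure M A' + emeasure M B'" using A' B' by (intro emeasure_subadditive)
  finally show ?thesis using A' B' by simp
qed

lemma outer_measure_of_UN:
  assumes "finite I" "\<And>i. i \<in> I \<Longrightarrow> A i \<subseteq> space M"
  shows "outer_measure_of M (\<Union>i\<in>I. A i) \<le> (\<Sum>i\<in>I. outer_measure_of M (A i))"
  using assms
proof (induction I)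
  case (insert i I)
  have "outer_measure_of M (\<Union>i\<in>insert i I. A i) \<le> outer_measure_of M (A i) + outer_measure_of M (\<Union>i\<in>I. A i)"
    using outer_measure_of_Un[of "A i" M "\<Union>i\<in>I. A i"] insert.prems by auto
  also have "\<dots> \<le> outer_measure_of M (A i) + (\<Sum>i\<in>I. outer_measure_of M (A i))"
    using insert by (intro add_left_mono insert.IH) auto
  finally show ?case using insert by simp
qed simp

lemma some_coordinate_prob:
  assumes P: "prob_space P" and A: "A \<in> sets P"
  shows "outer_measure_of (\<Pi>\<^sub>M i\<in>{1..n::nat}. P) {X \<in> space (\<Pi>\<^sub>M i\<in>{1..n}. P). \<exists>i\<in>{1..n}. X i \<in> A}
      \<le> of_nat n * emeasure P A"
proof -
  interpret product_prob_space "\<lambda>_::nat. P" "{1..n}"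
    using P by (simp add: product_prob_space_def product_sigma_finite_def prob_space_imp_sigma_finite product_prob_space_axioms_def)
  let ?P = "\<Pi>\<^sub>M i\<in>{1..n}. P"
  have one: "outer_measure_of ?P {X \<in> space ?P. X i \<in> A} = emeasure P A" if i: "i \<in> {1..n}" for i
  proof -
    have "emeasure P A = emeasure (distr ?P P (\<lambda>X. X i)) A" using PiM_component[OF i] by simp
    also have "\<dots> = emeasure ?P ((\<lambda>X. X i) -` A \<inter> space ?P)"
      using i A by (intro emeasure_distr) auto
    also have "(\<lambda>X. X i) -` A \<inter> space ?P = {X \<in> space ?P. X i \<in> A}" by auto
    finally have eq: "emeasure P A = emeasure ?P {X \<in> space ?P. X i \<in> A}" .
    have "(\<lambda>X. X i) -` A \<inter> space ?P \<in> sets ?P"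
      using i A by (intro measurable_sets[OF measurable_component_singleton]) auto
    then have "{X \<in> space ?P. X i \<in> A} \<in> sets ?P"
      by (simp add: vimage_def Int_def conj_commute)
    then show ?thesis using eq by (simp add: outer_measure_of_eq)
  qed
  have "{X \<in> space ?P. \<exists>i\<in>{1..n}. X i \<in> A} = (\<Union>i\<in>{1..n}. {X \<in> space ?P. X i \<in> A})" by auto
  then have "outer_measure_of ?P {X \<in> space ?P. \<exists>i\<in>{1..n}. X i \<in> A}
     \<le> (\<Sum>i\<in>{1..n}. outer_measure_of ?P {X \<in> space ?P. X i \<in> A})"
    using outer_measure_of_UN[of "{1..n}" "\<lambda>i. {X \<in> space ?P. X i \<in> A}" ?P] by auto
  also have "\<dots> = (\<Sum>i\<in>{1..n}. emeasure P A)" by (intro sum.cong refl one)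
  finally show ?thesis by simp
qed

lemma bounded_density_facts:
  assumes "bounded_density f"
  shows "f \<in> borel_measurable borel" "\<And>x. 0 \<le> f x" "\<And>x. f x \<le> sup_norm f" "integrable lborel f"
    "(\<integral>x. f x \<partial>lborel) = 1" "f \<in> L2" "0 \<le> sup_norm f"
proof -
  show m [measurable]: "f \<in> borel_measurable borel" and nn: "\<And>x. 0 \<le> f x" using assms by (auto simp: bounded_density_def)
  obtain A where "\<forall>y\<in>range f. norm y \<le> A"
    using assms unfolding bounded_density_def bounded_iff by blast
  then have "\<bar>f x\<bar> \<le> A" for x by simp
  then have "bdd_above (range (\<lambda>x. \<bar>f x\<bar>))" by (intro bdd_aboveI2)
  then have "\<bar>f x\<bar> \<le> sup_norm f" for x unfolding sup_norm_def by (intro cSUP_upper) auto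
  then show b: "f x \<le> sup_norm f" for x using nn[of x] by (metis abs_of_nonneg)
  then show "0 \<le> sup_norm f" using nn[of 0] b[of 0] by linarith
  have i: "(\<integral>\<^sup>+x. ennreal (f x) \<partial>lborel) = 1" using assms by (simp add: bounded_density_def)
  then show int: "integrable lborel f" using nn by (intro integrableI_nonneg) auto
  then have "ennreal (\<integral>x. f x \<partial>lborel) = 1" using i nn by (simp add: nn_integral_eq_integral)
  then show "(\<integral>x. f x \<partial>lborel) = 1" by (simp add: ennreal_eq_1)
  show "f \<in> L2" by (rule bounded_integrable_L2[OF m int, of "sup_norm f"]) (use nn b in simp)
qed

lemma prob_space_density_law: "bounded_density f \<Longrightarrow> prob_space (density_law f)"
  by (intro prob_spaceI) (simp add: density_law_def bounded_density_def emeasure_density)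

lemma sets_density_law: "sets (density_law f) = sets borel"
  by (simp add: density_law_def)

lemma ball_prob_density_law:
  assumes f: "bounded_density f" and "0 \<le> \<rho>"
  shows "emeasure (density_law f) {z. \<bar>z - y\<bar> \<le> \<rho>} \<le> ennreal (2 * \<rho> * sup_norm f)"
proof -
  note F = bounded_density_facts[OF f]
  have [measurable]: "f \<in> borel_measurable borel" by (rule F)
  have eq: "{z. \<bar>z - y\<bar> \<le> \<rho>} = {y - \<rho>..y + \<rho>}" by auto
  have "emeasure (density_law f) {z. \<bar>z - y\<bar> \<le> \<rho>} = (\<integral>\<^sup>+z. ennreal (f z) * indicator {y - \<rho>..y + \<rho>} z \<partial>lborel)"
    unfolding eq density_law_def by (rule emeasure_density) auto
  also have "\<dots> \<le> (\<integral>\<^sup>+z. ennreal (sup_norm f) * indicator {y - \<rho>..y + \<rho>} z \<partial>lborel)"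
    by (intro nn_integral_mono mult_right_mono ennreal_leI F(3)) auto
  also have "\<dots> = ennreal (sup_norm f) * ennreal (2 * \<rho>)" using assms(2) by (simp add: nn_integral_cmult)
  also have "\<dots> = ennreal (2 * \<rho> * sup_norm f)" using F(7) assms(2) by (simp add: ennreal_mult'[symmetric] mult.commute)
  finally show ?thesis .
qed

text \<open>In the last statement the factor \<open>\<sigma>\<close> is exactly what the substitution \<open>x = \<mu> + \<sigma> y\<close> leaves over, so
the weighted separation from the family becomes an unweighted distance to \<open>f\<^sub>0\<close>.\<close>
lemma standardized_density:
  fixes f f0 :: "real \<Rightarrow> real" and \<mu> \<sigma> :: real
  assumes f: "bounded_density f" and s: "0 < \<sigma>"
  defines "g \<equiv> (\<lambda>y. \<sigma> * f (\<sigma> * y + \<mu>))"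
  shows "g \<in> borel_measurable borel" "integrable lborel g" "\<And>y. 0 \<le> g y" "\<And>y. g y \<le> \<sigma> * sup_norm f"
    "(\<integral>y. g y \<partial>lborel) = 1" "g \<in> L2"
    "\<And>F. F \<in> borel_measurable borel \<Longrightarrow>
      (\<integral>x. F ((x - \<mu>) / \<sigma>) \<partial>density_law f) = (\<integral>y. F y * g y \<partial>lborel)"
    "f0 \<in> borel_measurable borel \<Longrightarrow>
      \<sigma> * (L2_norm (\<lambda>x. f x - loc_scale f0 (\<mu>, \<sigma>) x))\<^sup>2 = (L2_norm (\<lambda>y. g y - f0 y))\<^sup>2"
proof -
  note F = bounded_density_facts[OF f]
  have fm [measurable]: "f \<in> borel_measurable borel" by (rule F)
  show gm: "g \<in> borel_measurable borel" unfolding g_def by measurable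
  have aff: "(\<integral>x. u x \<partial>lborel) = \<sigma> * (\<integral>y. u (\<mu> + \<sigma> * y) \<partial>lborel)" for u :: "real \<Rightarrow> real"
    using lborel_integral_real_affine[of \<sigma> u \<mu>] s by simp
  show gi: "integrable lborel g"
    using lborel_integrable_real_affine[OF F(4), of \<sigma> \<mu>] s unfolding g_def by (simp add: add.commute)
  show g0: "0 \<le> g y" for y unfolding g_def using F(2) s by simp
  show gb: "g y \<le> \<sigma> * sup_norm f" for y unfolding g_def using F(3) s by simp
  show "(\<integral>y. g y \<partial>lborel) = 1"
    using aff[of f] F(5) by (simp add: g_def add.commute)
  show "g \<in> L2" by (rule bounded_integrable_L2[OF gm gi, of "\<sigma> * sup_norm f"]) (use g0 gb in simp)
  show "(\<integral>x. F ((x - \<mu>) / \<sigma>) \<partial>density_law f) = (\<integral>y. F y * g y \<partial>lborel)"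
    if [measurable]: "F \<in> borel_measurable borel" for F
  proof -
    have "(\<integral>x. F ((x - \<mu>) / \<sigma>) \<partial>density_law f) = (\<integral>x. f x * F ((x - \<mu>) / \<sigma>) \<partial>lborel)"
      unfolding density_law_def by (subst integral_density) (use F(2) in auto)
    also have "\<dots> = \<sigma> * (\<integral>y. f (\<mu> + \<sigma> * y) * F ((\<mu> + \<sigma> * y - \<mu>) / \<sigma>) \<partial>lborel)"
      by (rule aff)
    also have "\<dots> = (\<integral>y. F y * g y \<partial>lborel)"
      using s by (simp add: g_def add.commute mult_ac flip: integral_mult_right_zero)
    finally show ?thesis .
  qed
  show "\<sigma> * (L2_norm (\<lambda>x. f x - loc_scale f0 (\<mu>, \<sigma>) x))\<^sup>2 = (L2_norm (\<lambda>y. g y - f0 y))\<^sup>2"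
    if [measurable]: "f0 \<in> borel_measurable borel" for f0
  proof -
    have "\<sigma> * (L2_norm (\<lambda>x. f x - loc_scale f0 (\<mu>, \<sigma>) x))\<^sup>2
        = \<sigma> * (\<integral>x. (f x - 1 / \<sigma> * f0 ((x - \<mu>) / \<sigma>))\<^sup>2 \<partial>lborel)"
      by (simp add: L2_norm_def loc_scale_def)
    also have "\<dots> = \<sigma> * (\<sigma> * (\<integral>y. (f (\<mu> + \<sigma> * y) - 1 / \<sigma> * f0 ((\<mu> + \<sigma> * y - \<mu>) / \<sigma>))\<^sup>2 \<partial>lborel))"
      by (subst aff) (rule refl)
    also have "\<dots> = (\<integral>y. \<sigma>\<^sup>2 * (f (\<mu> + \<sigma> * y) - 1 / \<sigma> * f0 ((\<mu> + \<sigma> * y - \<mu>) / \<sigma>))\<^sup>2 \<partial>lborel)"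
      by (simp add: power2_eq_square)
    also have "\<dots> = (\<integral>y. (g y - f0 y)\<^sup>2 \<partial>lborel)"
    proof (rule Bochner_Integration.integral_cong[OF refl])
      fix y
      have "\<sigma> * (f (\<mu> + \<sigma> * y) - 1 / \<sigma> * f0 ((\<mu> + \<sigma> * y - \<mu>) / \<sigma>)) = g y - f0 y"
        using s by (simp add: g_def right_diff_distrib add.commute)
      then show "\<sigma>\<^sup>2 * (f (\<mu> + \<sigma> * y) - 1 / \<sigma> * f0 ((\<mu> + \<sigma> * y - \<mu>) / \<sigma>))\<^sup>2 = (g y - f0 y)\<^sup>2"
        by (simp only: power_mult_distrib[symmetric])
    qed
    finally show ?thesis by (simp add: L2_norm_def)
  qed
qed

lemma interval_net:
  fixes l u x :: real
  assumes "x \<in> {l..u}" "1 \<le> N"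
  shows "\<exists>i\<in>{0..N}. l + real i * ((u - l) / real N) \<in> {l..u} \<and> \<bar>x - (l + real i * ((u - l) / real N))\<bar> \<le> (u - l) / real N"
proof (cases "u = l")
  case True
  then show ?thesis using assms by (intro bexI[of _ 0]) auto
next
  case False
  define d where "d = (u - l) / real N"
  have d: "0 < d" and Nd: "real N * d = u - l" using False assms by (auto simp: d_def)
  define i where "i = nat \<lfloor>(x - l) / d\<rfloor>"
  have z: "0 \<le> (x - l) / d" using assms d by simp
  then have ri: "real i = of_int \<lfloor>(x - l) / d\<rfloor>" by (simp add: i_def)
  have 1: "real i \<le> (x - l) / d" "(x - l) / d < real i + 1" unfolding ri by linarith+
  then have 2: "real i * d \<le> x - l" "x - l < (real i + 1) * d" using d by (simp_all add: field_simps)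
  have "real i * d \<le> real N * d" using 2 Nd assms by simp
  then have "i \<le> N" using d by simp
  moreover have "0 \<le> real i * d" using d by simp
  ultimately show ?thesis
    using 2 assms unfolding d_def[symmetric] by (intro bexI[of _ i]) (auto simp: distrib_right)
qed

lemma standardization_lipschitz:
  fixes x \<mu> \<mu>' \<sigma> \<sigma>' :: real
  assumes "0 < \<sigma>\<^sub>l" "\<sigma>\<^sub>l \<le> \<sigma>" "\<sigma>\<^sub>l \<le> \<sigma>'" "\<bar>x\<bar> \<le> R" "\<bar>\<mu>'\<bar> \<le> m" "\<bar>\<mu> - \<mu>'\<bar> \<le> d1" "\<bar>\<sigma> - \<sigma>'\<bar> \<le> d2"
  shows "\<bar>(x - \<mu>) / \<sigma> - (x - \<mu>') / \<sigma>'\<bar> \<le> d1 / \<sigma>\<^sub>l + (R + m) * d2 / \<sigma>\<^sub>l\<^sup>2"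
proof -
  have p: "0 < \<sigma>" "0 < \<sigma>'" using assms by auto
  have "(x - \<mu>) / \<sigma> - (x - \<mu>') / \<sigma>' = (\<mu>' - \<mu>) / \<sigma> + (x - \<mu>') * (\<sigma>' - \<sigma>) / (\<sigma> * \<sigma>')"
    using p by (simp add: field_simps)
  also have "\<bar>\<dots>\<bar> \<le> \<bar>(\<mu>' - \<mu>) / \<sigma>\<bar> + \<bar>(x - \<mu>') * (\<sigma>' - \<sigma>) / (\<sigma> * \<sigma>')\<bar>" by (rule abs_triangle_ineq)
  also have "\<dots> = \<bar>\<mu> - \<mu>'\<bar> / \<sigma> + \<bar>x - \<mu>'\<bar> * \<bar>\<sigma> - \<sigma>'\<bar> / (\<sigma> * \<sigma>')"
    using p by (simp add: abs_mult abs_minus_commute)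
  also have "\<dots> \<le> d1 / \<sigma>\<^sub>l + (R + m) * d2 / (\<sigma>\<^sub>l * \<sigma>\<^sub>l)"
  proof (intro add_mono frac_le mult_mono)
    show "\<bar>x - \<mu>'\<bar> \<le> R + m" using assms by linarith
    then show "0 \<le> R + m" using abs_ge_zero by (rule order_trans[rotated])
    show "0 \<le> d1" using assms abs_ge_zero order_trans by blast
    have "0 \<le> d2" using assms abs_ge_zero order_trans by blast
    then show "0 \<le> (R + m) * d2" using \<open>0 \<le> R + m\<close> by simp
  qed (use assms p in auto)
  finally show ?thesis by (simp add: power2_eq_square)
qed

lemma abs_sum_le_card:
  fixes u :: "'b \<Rightarrow> real"
  assumes "\<And>i. i \<in> I \<Longrightarrow> \<bar>u i\<bar> \<le> c"
  shows "\<bar>\<Sum>i\<in>I. u i\<bar> \<le> real (card I) * c"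
proof -
  have "\<bar>\<Sum>i\<in>I. u i\<bar> \<le> (\<Sum>i\<in>I. c)" by (intro order_trans[OF sum_abs] sum_mono assms)
  then show ?thesis by simp
qed


section \<open>The statistic at one parameter\<close>

context scaling_kernel
begin

lemma T_hat_wavelet:
  "T_hat \<phi> f0 n (2, D) Y =
     1 / (real n * (real n - 1)) * (\<Sum>i=1..n. \<Sum>j\<in>{1..n} - {i}. ker (Y i) (Y j))
     + (L2_norm f0)\<^sup>2 - 2 / real n * (\<Sum>i=1..n. f0 (Y i))"
proof -
  let ?F = "\<Union>i\<in>{1..n}. near (Y i)"
  have fin: "finite ?F" by simp
  have "(\<Sum>\<^sub>\<infinity>k\<in>UNIV. \<Sum>i=1..n. \<Sum>j\<in>{1..n} - {i}. e k (Y i) * e k (Y j))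
      = (\<Sum>\<^sub>\<infinity>k\<in>?F. \<Sum>i=1..n. \<Sum>j\<in>{1..n} - {i}. e k (Y i) * e k (Y j))"
  proof (rule infsum_cong_neutral)
    fix k assume "k \<in> UNIV - ?F"
    then have "e k (Y i) = 0" if "i \<in> {1..n}" for i using e_nz that by blast
    then show "(\<Sum>i=1..n. \<Sum>j\<in>{1..n} - {i}. e k (Y i) * e k (Y j)) = 0"
      by (intro sum.neutral ballI) simp
  qed auto
  also have "\<dots> = (\<Sum>k\<in>?F. \<Sum>i=1..n. \<Sum>j\<in>{1..n} - {i}. e k (Y i) * e k (Y j))"
    using fin by (rule infsum_finite)
  also have "\<dots> = (\<Sum>i=1..n. \<Sum>k\<in>?F. \<Sum>j\<in>{1..n} - {i}. e k (Y i) * e k (Y j))"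
    by (rule sum.swap)
  also have "\<dots> = (\<Sum>i=1..n. \<Sum>j\<in>{1..n} - {i}. \<Sum>k\<in>?F. e k (Y i) * e k (Y j))"
    by (intro sum.cong refl sum.swap)
  also have "\<dots> = (\<Sum>i=1..n. \<Sum>j\<in>{1..n} - {i}. ker (Y i) (Y j))"
    by (intro sum.cong refl ker_eq[symmetric] fin) auto
  finally show ?thesis by (simp add: T_hat_def model_system_def)
qed

end

lemma sum_off_diagonal:
  fixes H :: "'a \<Rightarrow> 'a \<Rightarrow> real"
  assumes "\<And>x y. H x y = H y x"
  shows "(\<Sum>i=1..n. \<Sum>j\<in>{1..n} - {i}. H (X i) (X j)) = 2 * (\<Sum>j=1..n. chaos_inc H X j)"
proof (induction n)
  case (Suc n)
  have "(\<Sum>i=1..Suc n. \<Sum>j\<in>{1..Suc n} - {i}. H (X i) (X j))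
      = (\<Sum>i=1..n. \<Sum>j\<in>{1..Suc n} - {i}. H (X i) (X j)) + (\<Sum>j=1..n. H (X (Suc n)) (X j))"
  proof -
    have "{1..Suc n} - {Suc n} = {1..n}" by auto
    then show ?thesis by simp
  qed
  also have "(\<Sum>i=1..n. \<Sum>j\<in>{1..Suc n} - {i}. H (X i) (X j))
      = (\<Sum>i=1..n. (\<Sum>j\<in>{1..n} - {i}. H (X i) (X j)) + H (X i) (X (Suc n)))"
  proof (rule sum.cong[OF refl])
    fix i assume i: "i \<in> {1..n}"
    then have "{1..Suc n} - {i} = insert (Suc n) ({1..n} - {i})" by auto
    then show "(\<Sum>j\<in>{1..Suc n} - {i}. H (X i) (X j)) = (\<Sum>j\<in>{1..n} - {i}. H (X i) (X j)) + H (X i) (X (Suc n))"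
      by simp
  qed
  also have "\<dots> = 2 * (\<Sum>j=1..n. chaos_inc H X j) + (\<Sum>i=1..n. H (X i) (X (Suc n)))"
    using Suc by (simp add: sum.distrib)
  also have "(\<Sum>j=1..n. H (X (Suc n)) (X j)) = (\<Sum>i=1..n. H (X i) (X (Suc n)))"
    by (intro sum.cong refl assms)
  finally show ?case
    by (simp add: chaos_inc_def atLeastLessThanSuc_atLeastAtMost)
qed simp

text \<open>Replacing the density by its supremum is the step at which the norm of \<open>L\<^sup>2\<close> with respect to
Lebesgue measure, hence the Gram structure, enters the variance bounds.\<close>
lemma weighted_variance_le:
  fixes w g :: "real \<Rightarrow> real"
  assumes w: "w \<in> L2" and wb: "\<And>x. \<bar>w x\<bar> \<le> cw"
    and g: "g \<in> borel_measurable borel" "integrable lborel g" "\<And>x. 0 \<le> g x" "\<And>x. g x \<le> G"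
    and g1: "(\<integral>x. g x \<partial>lborel) = 1" and c: "c = (\<integral>x. w x * g x \<partial>lborel)"
  shows "(\<integral>x. (w x - c)\<^sup>2 * g x \<partial>lborel) \<le> G * L2_inner w w"
proof -
  note [measurable] = g(1)
  have wm [measurable]: "w \<in> borel_measurable borel" using w by (simp add: L2_def)
  have i1: "integrable lborel (\<lambda>x. w x * g x)"
    by (rule Bochner_Integration.integrable_bound[of _ "\<lambda>x. cw * g x"])
      (use g wb in \<open>auto intro!: AE_I2 mult_mono simp: abs_mult intro: order_trans[OF wb abs_ge_self]\<close>)
  have i2: "integrable lborel (\<lambda>x. (w x)\<^sup>2 * g x)"
  proof (rule Bochner_Integration.integrable_bound[of _ "\<lambda>x. cw\<^sup>2 * g x"])
    have "(w x)\<^sup>2 \<le> cw\<^sup>2" for x using wb[of x] by (simp add: abs_le_square_iff[symmetric])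
    then show "AE x in lborel. norm ((w x)\<^sup>2 * g x) \<le> norm (cw\<^sup>2 * g x)"
      using g(3) by (intro AE_I2) (simp add: abs_mult mult_right_mono)
  qed (use g in auto)
  have "(\<integral>x. (w x - c)\<^sup>2 * g x \<partial>lborel) = (\<integral>x. (w x)\<^sup>2 * g x - 2 * c * (w x * g x) + c\<^sup>2 * g x \<partial>lborel)"
    by (intro Bochner_Integration.integral_cong refl) (simp add: power2_diff algebra_simps)
  also have "\<dots> = (\<integral>x. (w x)\<^sup>2 * g x \<partial>lborel) - 2 * c * c + c\<^sup>2"
    using i1 i2 g g1 by (simp add: c[symmetric])
  also have "\<dots> \<le> (\<integral>x. (w x)\<^sup>2 * g x \<partial>lborel)" by (simp add: power2_eq_square)
  also have "\<dots> \<le> (\<integral>x. G * (w x * w x) \<partial>lborel)"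
  proof (rule integral_mono[OF i2])
    show "integrable lborel (\<lambda>x. G * (w x * w x))"
      by (intro integrable_mult_right L2_times_integrable w)
    show "(w x)\<^sup>2 * g x \<le> G * (w x * w x)" for x
      using mult_left_mono[OF g(4)[of x], of "(w x)\<^sup>2"] by (simp add: power2_eq_square algebra_simps)
  qed
  also have "\<dots> = G * L2_inner w w" by (simp add: L2_inner_def)
  finally show ?thesis .
qed

context scaling_kernel
begin

text \<open>Expanding \<open>ckernel\<close> shows that \<open>n (n - 1)\<close> times the centred statistic is the quadratic form of
\<open>ckernel\<close> plus \<open>2 (n - 1)\<close> times the sum of the centred values of \<open>proj g - f0\<close>, which is the form
treated in \<open>chaos_lower_tail\<close>. The map \<open>T\<close>, later a standardization, makes it possible to vary
\<open>g\<close> while the sample keeps its law.\<close>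
lemma T_hat_lower_tail:
  fixes P :: "real measure" and T g f0 :: "real \<Rightarrow> real" and n :: nat and G B0 lam x A t :: real
  defines "E1 \<equiv> 4 * a * amp * G"
  defines "Hmax \<equiv> amp * real D + 3 * E1"
  assumes P: "prob_space P" and sP [measurable_cong]: "sets P = sets borel"
    and T [measurable]: "T \<in> borel_measurable borel"
    and change_var: "\<And>F. F \<in> borel_measurable borel \<Longrightarrow> (\<integral>x. F (T x) \<partial>P) = (\<integral>y. F y * g y \<partial>lborel)"
    and g: "g \<in> borel_measurable borel" "integrable lborel g" "\<And>x. 0 \<le> g x" "\<And>x. g x \<le> G"
    and g1: "(\<integral>x. g x \<partial>lborel) = 1"
    and f0: "f0 \<in> L2" "\<And>x. \<bar>f0 x\<bar> \<le> B0"
    and n: "2 \<le> n" and lam: "0 < lam" and x: "0 \<le> x"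
    and l1: "8 * lam * G * real n \<le> 1" and l2: "8 * lam * (real n - 1) * (E1 + B0) \<le> 1"
    and A: "4 * G * (real n)\<^sup>2 * Hmax + 8 * real n * (real n - 1)\<^sup>2 * (G * (L2_norm (\<lambda>x. proj g x - f0 x))\<^sup>2) \<le> A" "0 < A"
    and t: "2 * sqrt (A * x) + 2 * x / lam \<le> real n * (real n - 1) * t"
  shows "outer_measure_of (\<Pi>\<^sub>M i\<in>{1..n}. P) {X \<in> space (\<Pi>\<^sub>M i\<in>{1..n}. P).
      (\<forall>j\<in>{1..n}. 4 * lam * \<bar>chaos_inc (\<lambda>u v. ckernel g (T u) (T v)) X j\<bar> \<le> 1) \<and>
      T_hat \<phi> f0 n (2, D) (\<lambda>i. T (X i))
        \<le> L2_inner (proj g) (proj g) + L2_inner f0 f0 - 2 * L2_inner g f0 - t} \<le> ennreal (exp (- x))"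
proof -
  interpret P: prob_space P by fact
  have G0: "0 \<le> G" using g(3)[of 0] g(4)[of 0] by linarith
  have gb: "\<bar>g x\<bar> \<le> G" for x using g(3,4)[of x] by simp
  have gL: "g \<in> L2" by (rule bounded_integrable_L2[OF g(1,2) gb])
  let ?h = "proj g" and ?s = "L2_inner (proj g) (proj g)"
  have hL: "?h \<in> L2" by (rule proj_approx(1)[OF gL])
  have hb: "\<bar>?h x\<bar> \<le> E1" for x unfolding E1_def by (rule proj_bound[OF gL gb])
  have E10: "0 \<le> E1" using hb[of 0] by linarith
  have B00: "0 \<le> B0" using f0(2)[of 0] by linarith
  have hg: "(\<integral>y. ?h y * g y \<partial>lborel) = ?s"
    using inner_proj[OF gL] by (simp add: L2_inner_def mult.commute)
  have ihg: "integrable lborel (\<lambda>y. ?h y * g y)" by (rule L2_times_integrable[OF hL gL])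
  have s0: "0 \<le> ?s" using L2_norm_sq[of ?h] zero_le_power2[of "L2_norm ?h"] by linarith
  have sb: "?s \<le> E1"
  proof -
    have "?s \<le> (\<integral>y. E1 * g y \<partial>lborel)" unfolding hg[symmetric]
    proof (rule integral_mono[OF ihg])
      show "integrable lborel (\<lambda>y. E1 * g y)" using g(2) by simp
      show "?h y * g y \<le> E1 * g y" for y using hb[of y] g(3)[of y] by (intro mult_right_mono) auto
    qed
    then show ?thesis using g1 by simp
  qed
  let ?H = "\<lambda>u v. ckernel g (T u) (T v)"
  have Hsym: "ckernel g u v = ckernel g v u" for u v by (simp add: ckernel_def ker_sym[of u])
  have Hb: "\<bar>ckernel g u v\<bar> \<le> Hmax" for u v
    unfolding ckernel_def Hmax_def using ker_le[of u v] hb[of u] hb[of v] s0 sb by linarith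
  have kg: "(\<integral>y. ker u y * g y \<partial>lborel) = ?h u" for u
    using proj_inner_ker[OF gL] by (simp add: L2_inner_def)
  have ikg: "integrable lborel (\<lambda>y. ker u y * g y)" for u by (rule L2_times_integrable[OF ker_L2 gL])
  have kerm [measurable]: "ker u \<in> borel_measurable borel" for u using ker_L2[of u] by (simp add: L2_def)
  define w where "w y = ?h y - f0 y" for y
  define r where "r y = w y - (\<integral>y. w y * g y \<partial>lborel)" for y
  have wL: "w \<in> L2" unfolding w_def by (rule L2_diff[OF hL f0(1)])
  have wb: "\<bar>w y\<bar> \<le> E1 + B0" for y unfolding w_def using hb[of y] f0(2)[of y] by linarith
  have iwg: "integrable lborel (\<lambda>y. w y * g y)" by (rule L2_times_integrable[OF wL gL])
  have wm [measurable]: "w \<in> borel_measurable borel" using wL by (simp add: L2_def)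
  have wgb: "\<bar>\<integral>y. w y * g y \<partial>lborel\<bar> \<le> E1 + B0"
  proof -
    have "\<bar>\<integral>y. w y * g y \<partial>lborel\<bar> \<le> (\<integral>y. \<bar>w y * g y\<bar> \<partial>lborel)" by (rule integral_abs_bound)
    also have "\<dots> \<le> (\<integral>y. (E1 + B0) * g y \<partial>lborel)"
    proof (rule integral_mono)
      show "integrable lborel (\<lambda>y. \<bar>w y * g y\<bar>)" using iwg by (rule integrable_abs)
      show "integrable lborel (\<lambda>y. (E1 + B0) * g y)" using g(2) by simp
      show "\<bar>w y * g y\<bar> \<le> (E1 + B0) * g y" for y
        using wb[of y] g(3)[of y] by (simp add: abs_mult mult_right_mono)
    qed
    finally show ?thesis using g1 by simp
  qed
  have rb: "\<bar>r y\<bar> \<le> 2 * (E1 + B0)" for y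
  proof -
    have "\<bar>r y\<bar> \<le> (E1 + B0) + (E1 + B0)"
      unfolding r_def by (intro order_trans[OF abs_triangle_ineq4] add_mono wb wgb)
    then show ?thesis by simp
  qed
  have rm [measurable]: "r \<in> borel_measurable borel" unfolding r_def by measurable
  have mean_eq: "(\<integral>y. w y * g y \<partial>lborel) = ?s - L2_inner g f0"
    unfolding w_def using hg ihg L2_times_integrable[OF f0(1) gL] L2_inner_commute[of g f0]
    by (simp add: left_diff_distrib L2_inner_def)
  have key: "outer_measure_of (\<Pi>\<^sub>M i\<in>{1..n}. P) {X \<in> space (\<Pi>\<^sub>M i\<in>{1..n}. P).
      (\<forall>j\<in>{1..n}. 4 * lam * \<bar>chaos_inc ?H X j\<bar> \<le> 1) \<and>
      (\<Sum>j=1..n. 2 * chaos_inc ?H X j + 2 * (real n - 1) * r (T (X j))) \<le> - (real n * (real n - 1) * t)} \<le> ennreal (exp (- x))"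
  proof (rule chaos_lower_tail[OF P, where cH = Hmax and cr = "2 * (E1 + B0)" and B = G and h = Hmax
        and v = "G * (L2_norm w)\<^sup>2" and lam = lam and A = A and r = "\<lambda>x. r (T x)"])
    show "(\<lambda>p. ckernel g (T (fst p)) (T (snd p))) \<in> borel_measurable (P \<Otimes>\<^sub>M P)"
    proof -
      have [measurable]: "(\<lambda>p. ker (T (fst p)) (T (snd p))) \<in> borel_measurable (P \<Otimes>\<^sub>M P)"
        using measurable_compose[OF _ ker_measurable, of "\<lambda>p. (T (fst p), T (snd p))" "P \<Otimes>\<^sub>M P"] by simp
      show ?thesis unfolding ckernel_def by measurable
    qed
    show "(\<lambda>x. r (T x)) \<in> borel_measurable P" by measurable
    show "\<bar>ckernel g (T u) (T v)\<bar> \<le> Hmax" for u v by (rule Hb)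
    show "ckernel g (T u) (T v) = ckernel g (T v) (T u)" for u v by (rule Hsym)
    show "(\<integral>y. ckernel g (T u) (T y) \<partial>P) = 0" for u
    proof -
      have m: "ckernel g (T u) \<in> borel_measurable borel" unfolding ckernel_def by measurable
      have "(\<integral>y. ckernel g (T u) (T y) \<partial>P) = (\<integral>y. ckernel g (T u) y * g y \<partial>lborel)"
        by (rule change_var[OF m])
      also have "\<dots> = (\<integral>y. ker (T u) y * g y - ?h (T u) * g y - ?h y * g y + ?s * g y \<partial>lborel)"
        by (simp add: ckernel_def algebra_simps)
      also have "\<dots> = 0" using ikg ihg g(2) g1 hg kg by simp
      finally show ?thesis .
    qed
    show "(\<integral>y. (\<Sum>i\<in>F. ckernel g (T (X i)) (T y))\<^sup>2 \<partial>P)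
        \<le> G * (\<Sum>i\<in>F. \<Sum>j\<in>F. ckernel g (T (X i)) (T (X j)))"
      if F: "finite F" for F and X :: "nat \<Rightarrow> real"
    proof -
      define S where "S z = (\<Sum>i\<in>F. ker (T (X i)) z - ?h z)" for z
      have dL: "(\<lambda>z. ker (T (X i)) z - ?h z) \<in> L2" for i by (rule L2_diff[OF ker_L2 hL])
      have SL: "S \<in> L2" unfolding S_def[abs_def] by (intro L2_sum dL)
      have Sb: "\<bar>S z\<bar> \<le> real (card F) * (amp * real D + E1)" for z
      proof -
        have "\<bar>S z\<bar> \<le> (\<Sum>i\<in>F. amp * real D + E1)" unfolding S_def
        proof (intro order_trans[OF sum_abs] sum_mono)
          fix i
          show "\<bar>ker (T (X i)) z - ?h z\<bar> \<le> amp * real D + E1" using ker_le[of "T (X i)" z] hb[of z] by linarith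
        qed
        then show ?thesis by simp
      qed
      \<comment> \<open>the sum of \<open>ckernel\<close> differs from \<open>S\<close> by its mean under \<open>g\<close>\<close>
      have c: "(\<Sum>i\<in>F. ?h (T (X i)) - ?s) = (\<integral>z. S z * g z \<partial>lborel)"
        unfolding S_def sum_distrib_right left_diff_distrib using ikg ihg hg kg by simp
      have m: "(\<lambda>y. (\<Sum>i\<in>F. ckernel g (T (X i)) y)\<^sup>2) \<in> borel_measurable borel"
        unfolding ckernel_def by measurable
      have "(\<integral>y. (\<Sum>i\<in>F. ckernel g (T (X i)) (T y))\<^sup>2 \<partial>P) = (\<integral>y. (\<Sum>i\<in>F. ckernel g (T (X i)) y)\<^sup>2 * g y \<partial>lborel)"
        by (rule change_var[OF m])
      also have "\<dots> = (\<integral>y. (S y - (\<Sum>i\<in>F. ?h (T (X i)) - ?s))\<^sup>2 * g y \<partial>lborel)"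
        by (simp add: S_def ckernel_def sum_subtractf[symmetric] algebra_simps)
      also have "\<dots> \<le> G * L2_inner S S"
        by (rule weighted_variance_le[OF SL Sb g g1 c])
      also have "L2_inner S S = (\<Sum>i\<in>F. \<Sum>j\<in>F. ckernel g (T (X i)) (T (X j)))"
      proof -
        have "L2_inner S S = (\<Sum>i\<in>F. L2_inner (\<lambda>z. ker (T (X i)) z - ?h z) S)"
          unfolding S_def[abs_def] by (rule L2_inner_sum[OF dL]) (intro L2_sum dL)
        also have "\<dots> = (\<Sum>i\<in>F. \<Sum>j\<in>F. L2_inner (\<lambda>z. ker (T (X j)) z - ?h z) (\<lambda>z. ker (T (X i)) z - ?h z))"
        proof (rule sum.cong[OF refl])
          fix i
          show "L2_inner (\<lambda>z. ker (T (X i)) z - ?h z) S = (\<Sum>j\<in>F. L2_inner (\<lambda>z. ker (T (X j)) z - ?h z) (\<lambda>z. ker (T (X i)) z - ?h z))"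
            unfolding L2_inner_commute[of _ S] unfolding S_def[abs_def] by (rule L2_inner_sum[OF dL dL])
        qed
        finally show ?thesis by (simp only: ckernel_gram[OF gL, symmetric] Hsym)
      qed
      finally show ?thesis .
    qed
    show "ckernel g (T u) (T u) \<le> Hmax" for u using Hb[of "T u" "T u"] by simp
    show "\<bar>r (T y)\<bar> \<le> 2 * (E1 + B0)" for y by (rule rb)
    show "(\<integral>y. r (T y) \<partial>P) = 0"
    proof -
      have "(\<integral>y. r (T y) \<partial>P) = (\<integral>y. w y * g y - (\<integral>y. w y * g y \<partial>lborel) * g y \<partial>lborel)"
        by (subst change_var[OF rm]) (simp add: r_def left_diff_distrib)
      then show ?thesis using iwg g(2) g1 by simp
    qed
    show "(\<integral>y. (r (T y))\<^sup>2 \<partial>P) \<le> G * (L2_norm w)\<^sup>2"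
    proof -
      have m: "(\<lambda>y. (r y)\<^sup>2) \<in> borel_measurable borel" by measurable
      have "(\<integral>y. (r (T y))\<^sup>2 \<partial>P) = (\<integral>y. (r y)\<^sup>2 * g y \<partial>lborel)" by (rule change_var[OF m])
      also have "\<dots> \<le> G * L2_inner w w" unfolding r_def by (rule weighted_variance_le[OF wL wb g g1 refl])
      finally show ?thesis by (simp add: L2_norm_sq)
    qed
    show "2 * lam * (2 * (real n - 1)) * (2 * (E1 + B0)) \<le> 1" using l2 by (simp add: algebra_simps)
    show "4 * G * (real n)\<^sup>2 * Hmax + 2 * real n * (2 * (real n - 1))\<^sup>2 * (G * (L2_norm w)\<^sup>2) \<le> A"
    proof -
      have "2 * real n * (2 * (real n - 1))\<^sup>2 = 8 * real n * (real n - 1)\<^sup>2"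
        unfolding power_mult_distrib by simp
      then show ?thesis using A(1) by (simp only: w_def[symmetric, abs_def])
    qed
    show "0 \<le> Hmax" using E10 amp_nonneg by (simp add: Hmax_def)
  qed (use n lam x l1 A t G0 in auto)
  have "{X \<in> space (\<Pi>\<^sub>M i\<in>{1..n}. P).
      (\<forall>j\<in>{1..n}. 4 * lam * \<bar>chaos_inc ?H X j\<bar> \<le> 1) \<and>
      T_hat \<phi> f0 n (2, D) (\<lambda>i. T (X i))
        \<le> ?s + L2_inner f0 f0 - 2 * L2_inner g f0 - t}
    \<subseteq> {X \<in> space (\<Pi>\<^sub>M i\<in>{1..n}. P).
      (\<forall>j\<in>{1..n}. 4 * lam * \<bar>chaos_inc ?H X j\<bar> \<le> 1) \<and>
      (\<Sum>j=1..n. 2 * chaos_inc ?H X j + 2 * (real n - 1) * r (T (X j))) \<le> - (real n * (real n - 1) * t)}"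
  proof (intro Collect_mono impI conjI; elim conjE)
    fix X
    assume le: "T_hat \<phi> f0 n (2, D) (\<lambda>i. T (X i)) \<le> ?s + L2_inner f0 f0 - 2 * L2_inner g f0 - t"
    let ?N = "real n * (real n - 1)"
    have N: "0 < ?N" using n by simp
    define K2 where "K2 = (\<Sum>i=1..n. \<Sum>j\<in>{1..n} - {i}. ker (T (X i)) (T (X j)))"
    define Sh where "Sh = (\<Sum>i=1..n. ?h (T (X i)))"
    define Sf where "Sf = (\<Sum>i=1..n. f0 (T (X i)))"
    have cardm: "real (card ({1..n} - {i})) = real n - 1" if "i \<in> {1..n}" for i
      using that n by (simp add: of_nat_diff)
    have "2 * (\<Sum>j=1..n. chaos_inc ?H X j) = (\<Sum>i=1..n. \<Sum>j\<in>{1..n} - {i}. ckernel g (T (X i)) (T (X j)))"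
      using sum_off_diagonal[of ?H X n] Hsym by simp
    also have "\<dots> = (\<Sum>i=1..n. (\<Sum>j\<in>{1..n} - {i}. ker (T (X i)) (T (X j))) - (real n - 1) * ?h (T (X i))
        - (Sh - ?h (T (X i))) + (real n - 1) * ?s)"
    proof (rule sum.cong[OF refl])
      fix i assume i: "i \<in> {1..n}"
      have "(\<Sum>j\<in>{1..n} - {i}. ?h (T (X j))) = Sh - ?h (T (X i))"
        unfolding Sh_def using i by (simp add: sum_diff1)
      then show "(\<Sum>j\<in>{1..n} - {i}. ckernel g (T (X i)) (T (X j)))
         = (\<Sum>j\<in>{1..n} - {i}. ker (T (X i)) (T (X j))) - (real n - 1) * ?h (T (X i)) - (Sh - ?h (T (X i))) + (real n - 1) * ?s"
        unfolding ckernel_def using cardm[OF i] by (simp add: sum.distrib sum_subtractf)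
    qed
    also have "\<dots> = K2 - 2 * (real n - 1) * Sh + ?N * ?s"
    proof -
      have "(\<Sum>i=Suc 0..n. ?h (T (X i))) = Sh" by (simp add: Sh_def)
      then show ?thesis
        unfolding K2_def by (simp add: sum.distrib sum_subtractf sum_distrib_left[symmetric] algebra_simps)
    qed
    finally have c: "2 * (\<Sum>j=1..n. chaos_inc ?H X j) = K2 - 2 * (real n - 1) * Sh + ?N * ?s" .
    have rr: "(\<Sum>j=1..n. r (T (X j))) = Sh - Sf - real n * (?s - L2_inner g f0)"
      unfolding r_def mean_eq by (simp add: w_def sum_subtractf Sh_def Sf_def)
    have "(\<Sum>j=1..n. 2 * chaos_inc ?H X j + 2 * (real n - 1) * r (T (X j)))
       = 2 * (\<Sum>j=1..n. chaos_inc ?H X j) + 2 * (real n - 1) * (\<Sum>j=1..n. r (T (X j)))"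
      by (simp add: sum.distrib sum_distrib_left)
    also have "\<dots> = K2 - 2 * (real n - 1) * Sf - ?N * ?s + 2 * ?N * L2_inner g f0"
      unfolding c rr by (simp add: algebra_simps)
    also have "\<dots> = ?N * (T_hat \<phi> f0 n (2, D) (\<lambda>i. T (X i)) - (?s + L2_inner f0 f0 - 2 * L2_inner g f0))"
    proof -
      have "?N * T_hat \<phi> f0 n (2, D) (\<lambda>i. T (X i)) = K2 + ?N * L2_inner f0 f0 - 2 * (real n - 1) * Sf"
        unfolding T_hat_wavelet K2_def[symmetric] Sf_def[symmetric] L2_norm_sq
        using n by (simp add: field_simps)
      then show ?thesis by (simp add: algebra_simps)
    qed
    also have "\<dots> \<le> ?N * (- t)" using le N by (intro mult_left_mono) auto
    finally show "(\<Sum>j=1..n. 2 * chaos_inc ?H X j + 2 * (real n - 1) * r (T (X j))) \<le> - (?N * t)" by simp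
  qed auto
  from outer_measure_of_mono[OF this, of "\<Pi>\<^sub>M i\<in>{1..n}. P"] key show ?thesis by (rule order_trans)
qed

text \<open>Only neighbours of observation \<open>j\<close> meet the kernel itself, which is of order \<open>D\<close>; all other pairs
contribute the bounded centring terms.\<close>
lemma chaos_inc_ckernel_bound:
  assumes gL: "g \<in> L2" and hb: "\<And>x. \<bar>proj g x\<bar> \<le> E1" and sb: "L2_inner (proj g) (proj g) \<le> E1"
    and T: "\<And>u v. \<bar>T u - T v\<bar> \<le> 2 * a / real D \<Longrightarrow> \<bar>u - v\<bar> \<le> \<rho>" and j: "j \<in> {1..n}"
  shows "\<bar>chaos_inc (\<lambda>u v. ckernel g (T u) (T v)) X j\<bar>
     \<le> amp * real D * real (card {i \<in> {1..n} - {j}. \<bar>X i - X j\<bar> \<le> \<rho>}) + 3 * real n * E1"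
proof -
  have s0: "0 \<le> L2_inner (proj g) (proj g)" using L2_norm_sq[of "proj g"] zero_le_power2[of "L2_norm (proj g)"] by linarith
  have E0: "0 \<le> E1" using hb[of 0] by linarith
  have AD: "0 \<le> amp * real D" using amp_nonneg by simp
  let ?C = "{i \<in> {1..n} - {j}. \<bar>X i - X j\<bar> \<le> \<rho>}"
  have "\<bar>chaos_inc (\<lambda>u v. ckernel g (T u) (T v)) X j\<bar>
     \<le> (\<Sum>i\<in>{1..<j}. (if \<bar>X i - X j\<bar> \<le> \<rho> then amp * real D else 0) + 3 * E1)"
    unfolding chaos_inc_def
  proof (intro order_trans[OF sum_abs] sum_mono)
    fix i
    have "\<bar>ker (T (X i)) (T (X j))\<bar> \<le> (if \<bar>X i - X j\<bar> \<le> \<rho> then amp * real D else 0)"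
    proof (cases "\<bar>X i - X j\<bar> \<le> \<rho>")
      case True
      then show ?thesis using ker_le by simp
    next
      case False
      then have "\<not> \<bar>T (X i) - T (X j)\<bar> \<le> 2 * a / real D" using T by blast
      then show ?thesis using False ker_bound[of "T (X j)" "T (X i)"] ker_sym[of "T (X i)" "T (X j)"] by simp
    qed
    then show "\<bar>ckernel g (T (X i)) (T (X j))\<bar> \<le> (if \<bar>X i - X j\<bar> \<le> \<rho> then amp * real D else 0) + 3 * E1"
      unfolding ckernel_def using hb[of "T (X i)"] hb[of "T (X j)"] s0 sb by linarith
  qed
  also have "\<dots> = amp * real D * real (card {i\<in>{1..<j}. \<bar>X i - X j\<bar> \<le> \<rho>}) + real (j - 1) * (3 * E1)"
    by (simp add: sum.distrib sum.inter_filter[symmetric])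
  also have "\<dots> \<le> amp * real D * real (card ?C) + real n * (3 * E1)"
  proof (intro add_mono mult_left_mono mult_right_mono AD)
    show "real (card {i\<in>{1..<j}. \<bar>X i - X j\<bar> \<le> \<rho>}) \<le> real (card ?C)"
      using j by (intro of_nat_mono card_mono) auto
  qed (use j E0 in auto)
  finally show ?thesis by simp
qed

end

context scaling_kernel
begin

text \<open>The factor \<open>D\<^sup>2\<close> is crude but harmless: the mesh of the grid on which the statistic is controlled will be
a power of \<open>n\<^sup>2 D\<close>.\<close>
lemma T_hat_perturbation:
  assumes n: "2 \<le> n" and d: "\<And>i. i \<in> {1..n} \<Longrightarrow> \<bar>Y i - Y' i\<bar> \<le> d"
    and f0: "\<And>i. i \<in> {1..n} \<Longrightarrow> \<bar>f0 (Y i) - f0 (Y' i)\<bar> \<le> L * d"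
  shows "\<bar>T_hat \<phi> f0 n (2, D) Y - T_hat \<phi> f0 n (2, D) Y'\<bar>
    \<le> (4 * (2 * a + 1) * M * Lip * (real D)\<^sup>2 + 2 * L) * d"
proof -
  let ?N = "real n * (real n - 1)" and ?c = "2 * (2 * a + 1) * M * Lip * (real D)\<^sup>2"
  have N: "0 < ?N" using n by simp
  have c0: "0 \<le> ?c" using a M_nonneg Lip_nonneg by simp
  have k: "\<bar>ker (Y i) (Y j) - ker (Y' i) (Y' j)\<bar> \<le> ?c * (2 * d)" if "i \<in> {1..n}" "j \<in> {1..n}" for i j
  proof -
    have "\<bar>Y i - Y' i\<bar> + \<bar>Y j - Y' j\<bar> \<le> 2 * d" using d[OF that(1)] d[OF that(2)] by linarith
    then show ?thesis by (intro order_trans[OF ker_lip] mult_left_mono c0)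
  qed
  have "\<bar>\<Sum>i=1..n. \<Sum>j\<in>{1..n} - {i}. ker (Y i) (Y j) - ker (Y' i) (Y' j)\<bar> \<le> real (card {1..n}) * ((real n - 1) * (?c * (2 * d)))"
  proof (rule abs_sum_le_card)
    fix i assume i: "i \<in> {1..n}"
    have "\<bar>\<Sum>j\<in>{1..n} - {i}. ker (Y i) (Y j) - ker (Y' i) (Y' j)\<bar> \<le> real (card ({1..n} - {i})) * (?c * (2 * d))"
      using i by (intro abs_sum_le_card k) auto
    moreover have "real (card ({1..n} - {i})) = real n - 1" using i n by (simp add: of_nat_diff)
    ultimately show "\<bar>\<Sum>j\<in>{1..n} - {i}. ker (Y i) (Y j) - ker (Y' i) (Y' j)\<bar> \<le> (real n - 1) * (?c * (2 * d))" by simp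
  qed
  then have U: "\<bar>1 / ?N * (\<Sum>i=1..n. \<Sum>j\<in>{1..n} - {i}. ker (Y i) (Y j) - ker (Y' i) (Y' j))\<bar> \<le> ?c * (2 * d)"
  proof -
    assume *: "\<bar>\<Sum>i=1..n. \<Sum>j\<in>{1..n} - {i}. ker (Y i) (Y j) - ker (Y' i) (Y' j)\<bar> \<le> real (card {1..n}) * ((real n - 1) * (?c * (2 * d)))" (is "\<bar>?S\<bar> \<le> _")
    have "\<bar>1 / ?N * ?S\<bar> = \<bar>?S\<bar> / ?N"       using abs_divide[of ?S ?N] by (simp only: abs_of_pos[OF N] times_divide_eq_left mult_1)
    also have "\<dots> \<le> (?c * (2 * d) * ?N) / ?N"
      using * N by (intro divide_right_mono) (auto simp: mult_ac)
    also have "\<dots> = ?c * (2 * d)" using N by (intro nonzero_mult_div_cancel_right less_imp_neq[symmetric])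
    finally show ?thesis .
  qed
  have "\<bar>\<Sum>i=1..n. f0 (Y i) - f0 (Y' i)\<bar> \<le> real (card {1..n}) * (L * d)"
    by (intro abs_sum_le_card f0)
  then have V: "\<bar>2 / real n * (\<Sum>i=1..n. f0 (Y i) - f0 (Y' i))\<bar> \<le> 2 * (L * d)"
    using n by (simp add: abs_mult field_simps)
  have "T_hat \<phi> f0 n (2, D) Y - T_hat \<phi> f0 n (2, D) Y'
     = 1 / ?N * (\<Sum>i=1..n. \<Sum>j\<in>{1..n} - {i}. ker (Y i) (Y j) - ker (Y' i) (Y' j))
       - 2 / real n * (\<Sum>i=1..n. f0 (Y i) - f0 (Y' i))"
    unfolding T_hat_wavelet sum_subtractf by (simp add: right_diff_distrib)
  then have "\<bar>T_hat \<phi> f0 n (2, D) Y - T_hat \<phi> f0 n (2, D) Y'\<bar> \<le> ?c * (2 * d) + 2 * (L * d)"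
    using U V by linarith
  then show ?thesis by (simp add: algebra_simps)
qed

text \<open>The variance of the linear part is governed by the distance from \<open>proj g\<close> to \<open>f0\<close>, which is at most
twice that from \<open>g\<close> to \<open>f0\<close> when the bias \<open>b\<close> does not exceed \<open>\<Delta>\<close>. The resulting deviation, of order
\<open>sqrt (\<Delta> * x / n)\<close>, is split by the inequality of arithmetic and geometric means into \<open>\<eta> * \<Delta>\<close>, which
is subtracted from the mean, and a term of order \<open>x / n\<close>. The threshold for the counts is the one
supplied by \<open>neighbour_count_tail\<close>. It does not depend on \<open>\<mu>\<close> and \<open>\<sigma>\<close>, so the event about the
counts is common to all parameters.\<close>
lemma standardized_T_hat_lower_tail:
  fixes f f0 :: "real \<Rightarrow> real" and n :: nat and \<mu> \<sigma> \<sigma>\<^sub>u \<eta> x :: real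
  defines "g \<equiv> (\<lambda>y. \<sigma> * f (\<sigma> * y + \<mu>))"
  defines "G \<equiv> \<sigma>\<^sub>u * sup_norm f"
  defines "E1 \<equiv> 4 * a * amp * G"
  defines "\<Delta> \<equiv> (L2_norm (\<lambda>y. g y - f0 y))\<^sup>2"
  defines "b \<equiv> (L2_norm (\<lambda>y. g y - L2_proj (wavelet_space \<phi> D) g y))\<^sup>2"
  defines "c1 \<equiv> 4 * G * (amp + 3 * E1) + 1"
  defines "c2 \<equiv> 8 * G + 20 * E1 + 8 * sup_norm f0 + 4 * amp + 1"
  assumes f: "bounded_density f" and f0: "bounded_density f0"
    and s: "0 < \<sigma>" "\<sigma> \<le> \<sigma>\<^sub>u" and n: "2 \<le> n" and x: "0 \<le> x" and eta: "0 < \<eta>" and b\<Delta>: "b \<le> \<Delta>"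
  shows "outer_measure_of (sample_law n f) {X \<in> space (sample_law n f).
      (\<forall>j\<in>{1..n}. real (card {i \<in> {1..n} - {j}. \<bar>X i - X j\<bar> \<le> 2 * a * \<sigma>\<^sub>u / real D})
          \<le> 8 * a * real n * G / real D + x) \<and>
      T_hat \<phi> f0 n (2, D) (\<lambda>i. (X i - \<mu>) / \<sigma>)
        \<le> (1 - \<eta>) * \<Delta> - b - (4 * sqrt (c1 * real D * x) / real n + 128 * G * x / (\<eta> * real n)
             + 4 * c2 * (x / real n + real D * x\<^sup>2 / (real n)\<^sup>2))} \<le> ennreal (exp (- x))"
proof -
  note F = bounded_density_facts[OF f] and F0 = bounded_density_facts[OF f0]
  note sd = standardized_density[OF f s(1), where \<mu> = \<mu>]
  have g: "g \<in> borel_measurable borel" "integrable lborel g" "\<And>y. 0 \<le> g y" "\<And>y. g y \<le> \<sigma> * sup_norm f"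
    "(\<integral>y. g y \<partial>lborel) = 1" "g \<in> L2"
    unfolding g_def by (rule sd(1) sd(2) sd(3) sd(4) sd(5) sd(6))+
  have g7: "(\<integral>x. F ((x - \<mu>) / \<sigma>) \<partial>density_law f) = (\<integral>y. F y * g y \<partial>lborel)"
    if "F \<in> borel_measurable borel" for F
    unfolding g_def by (rule sd(7)[OF that])
  have G0: "0 \<le> G" using F(7) s by (simp add: G_def)
  have gG: "g y \<le> G" for y using g(4)[of y] mult_right_mono[OF s(2) F(7)] unfolding G_def by linarith
  have gb: "\<bar>g y\<bar> \<le> G" for y using g(3)[of y] gG[of y] by simp
  have E10: "0 \<le> E1" using a amp_nonneg G0 by (simp add: E1_def)
  have D0: "0 < real D" "1 \<le> real D" using D by simp_all
  have n0: "0 < real n" using n by simp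
  have c10: "0 < c1" unfolding c1_def using G0 E10 amp_nonneg by (simp add: add_nonneg_pos)
  have c20: "0 < c2" unfolding c2_def using G0 E10 amp_nonneg F0(7) by simp
  have \<Delta>0: "0 \<le> \<Delta>" by (simp add: \<Delta>_def)
  let ?T = "\<lambda>x. (x - \<mu>) / \<sigma>"
  let ?h = "proj g"
  have hL: "?h \<in> L2" by (rule proj_approx(1)[OF g(6)])
  have hb: "\<bar>?h y\<bar> \<le> E1" for y unfolding E1_def by (rule proj_bound[OF g(6) gb])
  have b_eq: "b = L2_inner g g - L2_inner ?h ?h" unfolding b_def by (rule proj_dist[OF g(6)])
  have \<Delta>_eq: "\<Delta> = L2_inner g g - 2 * L2_inner g f0 + L2_inner f0 f0"
    unfolding \<Delta>_def by (rule L2_norm_diff_sq[OF g(6) F0(6)])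
  have b_eq2: "b = L2_inner (\<lambda>y. g y - ?h y) (\<lambda>y. g y - ?h y)"
    unfolding b_eq L2_norm_sq[symmetric] L2_norm_diff_sq[OF g(6) hL]
    using inner_proj[OF g(6)] by (simp add: L2_norm_sq)
  have W: "(L2_norm (\<lambda>y. ?h y - f0 y))\<^sup>2 \<le> 4 * \<Delta>"
  proof -
    let ?u = "\<lambda>y. g y - f0 y" and ?v = "\<lambda>y. g y - ?h y"
    have u: "?u \<in> L2" and v: "?v \<in> L2" using L2_diff g(6) F0(6) hL by auto
    have "(L2_norm (\<lambda>y. ?u y - ?v y))\<^sup>2 = \<Delta> - 2 * L2_inner ?u ?v + b"
      unfolding L2_norm_diff_sq[OF u v] \<Delta>_def b_eq2 L2_norm_sq ..
    moreover have "\<bar>L2_inner ?u ?v\<bar> \<le> L2_norm ?u * L2_norm ?v" by (rule L2_cauchy_schwarz[OF u v])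
    moreover have "L2_norm ?u * L2_norm ?v \<le> \<Delta>"
    proof -
      have "L2_norm ?v \<le> L2_norm ?u"
        using b\<Delta> unfolding b_eq2 \<Delta>_def L2_norm_sq[symmetric] by (rule power2_le_imp_le[OF _ L2_norm_nonneg])
      then show ?thesis unfolding \<Delta>_def power2_eq_square by (intro mult_left_mono L2_norm_nonneg)
    qed
    ultimately have "(L2_norm (\<lambda>y. ?u y - ?v y))\<^sup>2 \<le> 4 * \<Delta>" using b\<Delta> by linarith
    then show ?thesis by simp
  qed
  \<comment> \<open>an exponent for which the increments, of order \<open>n + D * x\<close> on the counting event, and the
    linear terms stay within the truncation; \<open>c2\<close> collects the constants of these constraints\<close>
  define lam where "lam = 1 / (c2 * (real n + real D * x))"
  have nDx: "0 < real n + real D * x" using n0 x D0 by (intro add_pos_nonneg) auto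
  have lam: "0 < lam" and lam_eq: "lam * (c2 * (real n + real D * x)) = 1"
    unfolding lam_def using nDx c20 by simp_all
  have lam_le: "lam * y \<le> 1" if "y \<le> c2 * (real n + real D * x)" for y
    using mult_left_mono[OF that, of lam] lam lam_eq by simp
  have c2_n: "c * real n \<le> c2 * (real n + real D * x)" if "c \<le> c2" for c
  proof -
    have "c * real n \<le> c2 * real n" using that by (intro mult_right_mono) auto
    also have "\<dots> \<le> c2 * (real n + real D * x)" using c20 x by (intro mult_left_mono) auto
    finally show ?thesis .
  qed
  define A where "A = c1 * (real n)\<^sup>2 * real D + 32 * G * (real n)^3 * \<Delta> "
  have A0: "0 < A" unfolding A_def using c10 n0 D0 G0 \<Delta>0 by (intro add_pos_nonneg) auto
  define t where "t = 4 * sqrt (c1 * real D * x) / real n + (\<eta> * \<Delta> + 128 * G * x / (\<eta> * real n))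
             + 4 * c2 * (x / real n + real D * x\<^sup>2 / (real n)\<^sup>2)"
  let ?S = "{X \<in> space (\<Pi>\<^sub>M i\<in>{1..n}. density_law f).
      (\<forall>j\<in>{1..n}. 4 * lam * \<bar>chaos_inc (\<lambda>u v. ckernel g (?T u) (?T v)) X j\<bar> \<le> 1) \<and>
      T_hat \<phi> f0 n (2, D) (\<lambda>i. ?T (X i))
        \<le> L2_inner ?h ?h + L2_inner f0 f0 - 2 * L2_inner g f0 - t}"
  have main: "outer_measure_of (\<Pi>\<^sub>M i\<in>{1..n}. density_law f) ?S \<le> ennreal (exp (- x))"
  proof (rule T_hat_lower_tail[where G = G and ?B0.0 = "sup_norm f0" and A = A,
        OF prob_space_density_law[OF f] sets_density_law _ g7 g(1-3) gG g(5) F0(6) _ n lam x])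
    show "?T \<in> borel_measurable borel" by measurable
    show "\<bar>f0 y\<bar> \<le> sup_norm f0" for y using F0(2,3)[of y] by simp
    show "8 * lam * G * real n \<le> 1"
      using lam_le[OF c2_n[of "8 * G"]] E10 amp_nonneg F0(7) unfolding c2_def by (simp add: mult_ac)
    have "(8 * (E1 + sup_norm f0)) * (real n - 1) \<le> (8 * (E1 + sup_norm f0)) * real n"
      using E10 F0(7) by (intro mult_left_mono) auto
    also have "\<dots> \<le> c2 * (real n + real D * x)"
      using E10 amp_nonneg F0(7) G0 by (intro c2_n) (simp add: c2_def)
    finally have "lam * ((8 * (E1 + sup_norm f0)) * (real n - 1)) \<le> 1" by (rule lam_le)
    then show "8 * lam * (real n - 1) * (4 * a * amp * G + sup_norm f0) \<le> 1"
      unfolding E1_def[symmetric] by (simp only: mult_ac)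
    show "4 * G * (real n)\<^sup>2 * (amp * real D + 3 * (4 * a * amp * G))
      + 8 * real n * (real n - 1)\<^sup>2 * (G * (L2_norm (\<lambda>x. ?h x - f0 x))\<^sup>2) \<le> A"
      unfolding E1_def[symmetric] A_def
    proof (rule add_mono)
      have "amp * real D + 3 * E1 \<le> (amp + 3 * E1) * real D"
        using E10 D0 mult_left_mono[of 1 "real D" "3 * E1"] by (simp add: distrib_right)
      then have "4 * G * (real n)\<^sup>2 * (amp * real D + 3 * E1) \<le> 4 * G * (real n)\<^sup>2 * ((amp + 3 * E1) * real D)"
        using G0 by (intro mult_left_mono) auto
      also have "\<dots> = (4 * G * (amp + 3 * E1)) * ((real n)\<^sup>2 * real D)" by (simp add: mult_ac)
      also have "\<dots> \<le> c1 * ((real n)\<^sup>2 * real D)"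
        unfolding c1_def by (intro mult_right_mono) auto
      finally show "4 * G * (real n)\<^sup>2 * (amp * real D + 3 * E1) \<le> c1 * (real n)\<^sup>2 * real D" by (simp add: mult_ac)
      have "(real n - 1)\<^sup>2 \<le> (real n)\<^sup>2" using n by (intro power_mono) auto
      then have "8 * real n * (real n - 1)\<^sup>2 * (G * (L2_norm (\<lambda>x. ?h x - f0 x))\<^sup>2)
        \<le> 8 * real n * (real n)\<^sup>2 * (G * (4 * \<Delta>))"
        using W G0 by (intro mult_mono) auto
      then show "8 * real n * (real n - 1)\<^sup>2 * (G * (L2_norm (\<lambda>x. ?h x - f0 x))\<^sup>2) \<le> 32 * G * (real n)^3 * \<Delta>"
        by (simp add: power2_eq_square power3_eq_cube mult_ac)
    qed
    show "0 < A" by (rule A0)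
    show "2 * sqrt (A * x) + 2 * x / lam \<le> real n * (real n - 1) * t"
    proof -
      have s1: "sqrt (A * x) \<le> sqrt (c1 * (real n)\<^sup>2 * real D * x) + sqrt (32 * G * (real n)^3 * \<Delta> * x)"
        unfolding A_def distrib_right using c10 D0 x G0 \<Delta>0 by (intro sqrt_add_le_add_sqrt) auto
      have s2: "sqrt (c1 * (real n)\<^sup>2 * real D * x) = real n * sqrt (c1 * real D * x)"
        using real_sqrt_mult[of "(real n)\<^sup>2" "c1 * real D * x"] by (simp add: mult_ac)
      \<comment> \<open>\<open>128 = 4 * 32\<close> makes the geometric mean below equal, up to the factor \<open>n\<^sup>2 / 2\<close>, to the square root to be bounded\<close>
      have "sqrt ((\<eta> * \<Delta>) * (128 * G * x / (\<eta> * real n))) \<le> (\<eta> * \<Delta> + 128 * G * x / (\<eta> * real n)) / 2"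
        using eta \<Delta>0 G0 x by (intro arith_geo_mean_sqrt) auto
      moreover have "32 * G * (real n)^3 * \<Delta> * x = ((real n)\<^sup>2 / 2)\<^sup>2 * ((\<eta> * \<Delta>) * (128 * G * x / (\<eta> * real n)))"
        using eta n0 by (simp add: field_simps power2_eq_square power3_eq_cube)
      then have "sqrt (32 * G * (real n)^3 * \<Delta> * x) = ((real n)\<^sup>2 / 2) * sqrt ((\<eta> * \<Delta>) * (128 * G * x / (\<eta> * real n)))"
        by (simp only: real_sqrt_mult real_sqrt_abs) simp
      ultimately have s3: "sqrt (32 * G * (real n)^3 * \<Delta> * x) \<le> ((real n)\<^sup>2 / 2) * ((\<eta> * \<Delta> + 128 * G * x / (\<eta> * real n)) / 2)"
        by (simp only:) (intro mult_left_mono, auto)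
      have s4: "2 * x / lam = ((real n)\<^sup>2 / 2) * (4 * c2 * (x / real n + real D * x\<^sup>2 / (real n)\<^sup>2))"
        unfolding lam_def using n0 by (simp add: field_simps power2_eq_square)
      have s5: "2 * (real n * sqrt (c1 * real D * x)) = ((real n)\<^sup>2 / 2) * (4 * sqrt (c1 * real D * x) / real n)"
        using n0 by (simp add: field_simps power2_eq_square)
      have "2 * sqrt (A * x) + 2 * x / lam \<le> ((real n)\<^sup>2 / 2) * t"
      proof -
        define P1 where "P1 = 4 * sqrt (c1 * real D * x) / real n"
        define P2 where "P2 = \<eta> * \<Delta> + 128 * G * x / (\<eta> * real n)"
        define P3 where "P3 = 4 * c2 * (x / real n + real D * x\<^sup>2 / (real n)\<^sup>2)"
        define Q where "Q = (real n)\<^sup>2 / 2"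
        have "Q * t = Q * P1 + Q * P2 + Q * P3"
          unfolding t_def P1_def[symmetric] P2_def[symmetric] P3_def[symmetric] by (simp only: distrib_left)
        moreover have "2 * sqrt (32 * G * (real n)^3 * \<Delta> * x) \<le> Q * P2"
          using s3 unfolding Q_def[symmetric] P2_def[symmetric] by simp
        moreover have "2 * x / lam = Q * P3" unfolding s4 Q_def P3_def ..
        moreover have "2 * (real n * sqrt (c1 * real D * x)) = Q * P1" unfolding s5 Q_def P1_def ..
        ultimately have "2 * sqrt (A * x) + 2 * x / lam \<le> Q * t" using s1 s2 by linarith
        then show ?thesis by (simp only: Q_def)
      qed
      also have "\<dots> \<le> (real n * (real n - 1)) * t"
      proof (rule mult_right_mono)
        have "real n * (real n / 2) \<le> real n * (real n - 1)" using n by (intro mult_left_mono) auto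
        then show "(real n)\<^sup>2 / 2 \<le> real n * (real n - 1)" by (simp add: power2_eq_square)
        show "0 \<le> t" unfolding t_def using c10 D0 x G0 \<Delta>0 eta c20 n0 by (intro add_nonneg_nonneg) auto
      qed
      finally show ?thesis .
    qed
  qed
  have sub: "{X \<in> space (sample_law n f).
      (\<forall>j\<in>{1..n}. real (card {i \<in> {1..n} - {j}. \<bar>X i - X j\<bar> \<le> 2 * a * \<sigma>\<^sub>u / real D})
          \<le> 8 * a * real n * G / real D + x) \<and>
      T_hat \<phi> f0 n (2, D) (\<lambda>i. ?T (X i))
        \<le> (1 - \<eta>) * \<Delta> - b - (4 * sqrt (c1 * real D * x) / real n + 128 * G * x / (\<eta> * real n)
             + 4 * c2 * (x / real n + real D * x\<^sup>2 / (real n)\<^sup>2))} \<subseteq> ?S"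
    unfolding sample_law_def
  proof (intro Collect_mono impI conjI; elim conjE)
    fix X
    assume cnt: "\<forall>j\<in>{1..n}. real (card {i \<in> {1..n} - {j}. \<bar>X i - X j\<bar> \<le> 2 * a * \<sigma>\<^sub>u / real D})
          \<le> 8 * a * real n * G / real D + x"
    have sL: "L2_inner ?h ?h \<le> E1"
    proof -
      have "L2_inner ?h ?h = (\<integral>y. ?h y * g y \<partial>lborel)"
        using inner_proj[OF g(6)] by (simp add: L2_inner_def mult.commute)
      also have "\<dots> \<le> (\<integral>y. E1 * g y \<partial>lborel)"
      proof (rule integral_mono[OF L2_times_integrable[OF hL g(6)]])
        show "integrable lborel (\<lambda>y. E1 * g y)" using g(2) by simp
        show "?h y * g y \<le> E1 * g y" for y using hb[of y] g(3)[of y] by (intro mult_right_mono) auto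
      qed
      finally show ?thesis using g(5) by simp
    qed
    show "\<forall>j\<in>{1..n}. 4 * lam * \<bar>chaos_inc (\<lambda>u v. ckernel g (?T u) (?T v)) X j\<bar> \<le> 1"
    proof
      fix j assume j: "j \<in> {1..n}"
      have T: "\<bar>u - v\<bar> \<le> 2 * a * \<sigma>\<^sub>u / real D" if "\<bar>?T u - ?T v\<bar> \<le> 2 * a / real D" for u v
      proof -
        have "?T u - ?T v = (u - v) / \<sigma>" by (simp add: diff_divide_distrib)
        then have "\<bar>u - v\<bar> \<le> 2 * a / real D * \<sigma>" using that s by (simp add: pos_divide_le_eq)
        also have "\<dots> \<le> 2 * a / real D * \<sigma>\<^sub>u" using s a by (intro mult_left_mono) auto
        finally show ?thesis by simp
      qed
      have "\<bar>chaos_inc (\<lambda>u v. ckernel g (?T u) (?T v)) X j\<bar>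
        \<le> amp * real D * real (card {i \<in> {1..n} - {j}. \<bar>X i - X j\<bar> \<le> 2 * a * \<sigma>\<^sub>u / real D}) + 3 * real n * E1"
        by (rule chaos_inc_ckernel_bound[OF g(6) hb sL T j])
      also have "\<dots> \<le> amp * real D * (8 * a * real n * G / real D + x) + 3 * real n * E1"
        using cnt j amp_nonneg by (intro add_right_mono mult_left_mono) auto
      also have "\<dots> = 5 * E1 * real n + amp * (real D * x)"
        using D0 by (simp add: E1_def field_simps)
      finally have "4 * \<bar>chaos_inc (\<lambda>u v. ckernel g (?T u) (?T v)) X j\<bar> \<le> (20 * E1) * real n + (4 * amp) * (real D * x)" by simp
      also have "\<dots> \<le> c2 * real n + c2 * (real D * x)"
        using x E10 G0 F0(7) amp_nonneg by (intro add_mono mult_right_mono) (auto simp: c2_def)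
      finally have "4 * \<bar>chaos_inc (\<lambda>u v. ckernel g (?T u) (?T v)) X j\<bar> \<le> c2 * (real n + real D * x)"
        by (simp add: distrib_left)
      from lam_le[OF this] show "4 * lam * \<bar>chaos_inc (\<lambda>u v. ckernel g (?T u) (?T v)) X j\<bar> \<le> 1"
        by (simp add: mult_ac)
    qed
  next
    fix X
    assume "T_hat \<phi> f0 n (2, D) (\<lambda>i. ?T (X i))
        \<le> (1 - \<eta>) * \<Delta> - b - (4 * sqrt (c1 * real D * x) / real n + 128 * G * x / (\<eta> * real n)
             + 4 * c2 * (x / real n + real D * x\<^sup>2 / (real n)\<^sup>2))"
    moreover have "(1 - \<eta>) * \<Delta> - b = L2_inner ?h ?h + L2_inner f0 f0 - 2 * L2_inner g f0 - \<eta> * \<Delta>"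
      unfolding left_diff_distrib mult_1 by (simp add: b_eq \<Delta>_eq)
    ultimately show "T_hat \<phi> f0 n (2, D) (\<lambda>i. ?T (X i)) \<le> L2_inner ?h ?h + L2_inner f0 f0 - 2 * L2_inner g f0 - t"
      unfolding t_def by linarith
  qed auto
  show ?thesis
    using order_trans[OF outer_measure_of_mono[OF sub, of "\<Pi>\<^sub>M i\<in>{1..n}. density_law f"] main] unfolding sample_law_def .
qed

end

section \<open>Uniformity over the parameters\<close>

text \<open>Zeros of \<open>f\<close> have probability zero; they are excluded together with large values because the Lipschitz
condition on \<open>f\<^sub>0\<close> speaks only about points where \<open>f\<close> does not vanish.\<close>
lemma atypical_observation_prob:
  assumes f: "bounded_density f" and R: "0 < R"
    and m2: "(\<integral>\<^sup>+x. ennreal (\<bar>x\<bar>\<^sup>2) \<partial>density_law f) \<le> ennreal \<nu>"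
  shows "{y. R < \<bar>y\<bar> \<or> f y = 0} \<in> sets (density_law f)"
    "emeasure (density_law f) {y. R < \<bar>y\<bar> \<or> f y = 0} \<le> ennreal (\<nu> / R\<^sup>2)"
proof -
  let ?P = "density_law f"
  have [measurable]: "f \<in> borel_measurable borel" by (rule bounded_density_facts[OF f])
  have sp [measurable_cong]: "sets ?P = sets borel" by (rule sets_density_law)
  have spc: "space ?P = UNIV" by (simp add: density_law_def)
  have s1: "{y. R < \<bar>y\<bar>} \<in> sets ?P" unfolding sp by measurable
  have s2: "{y. f y = 0} \<in> sets ?P" unfolding sp by measurable
  have eq: "{y. R < \<bar>y\<bar> \<or> f y = 0} = {y. R < \<bar>y\<bar>} \<union> {y. f y = 0}" by auto
  show "{y. R < \<bar>y\<bar> \<or> f y = 0} \<in> sets ?P" unfolding eq using s1 s2 by (rule sets.Un)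
  have z: "emeasure ?P {y. f y = 0} = 0"
  proof -
    have "emeasure ?P {y. f y = 0} = (\<integral>\<^sup>+y. ennreal (f y) * indicator {y. f y = 0} y \<partial>lborel)"
      unfolding density_law_def by (rule emeasure_density) auto
    also have "\<dots> = (\<integral>\<^sup>+(y::real). 0 \<partial>lborel)" by (intro nn_integral_cong) (auto split: split_indicator)
    finally show ?thesis by simp
  qed
  have "emeasure ?P {y. R < \<bar>y\<bar>} \<le> emeasure ?P {y \<in> UNIV. 1 \<le> ennreal (1 / R\<^sup>2) * ennreal (\<bar>y\<bar>\<^sup>2)}"
  proof (rule emeasure_mono)
    show "{y. R < \<bar>y\<bar>} \<subseteq> {y \<in> UNIV. 1 \<le> ennreal (1 / R\<^sup>2) * ennreal (\<bar>y\<bar>\<^sup>2)}"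
    proof
      fix y assume "y \<in> {y. R < \<bar>y\<bar>}"
      then have "R\<^sup>2 \<le> \<bar>y\<bar>\<^sup>2" using R by (intro power_mono) auto
      then have "1 \<le> 1 / R\<^sup>2 * \<bar>y\<bar>\<^sup>2" using R by (simp add: field_simps)
      then have "ennreal 1 \<le> ennreal (1 / R\<^sup>2 * \<bar>y\<bar>\<^sup>2)" by (rule ennreal_leI)
      then show "y \<in> {y \<in> UNIV. 1 \<le> ennreal (1 / R\<^sup>2) * ennreal (\<bar>y\<bar>\<^sup>2)}" by (simp add: ennreal_mult'[symmetric])
    qed
    show "{y \<in> UNIV. 1 \<le> ennreal (1 / R\<^sup>2) * ennreal (\<bar>y\<bar>\<^sup>2)} \<in> sets ?P" unfolding sp by measurable
  qed
  also have "\<dots> \<le> ennreal (1 / R\<^sup>2) * (\<integral>\<^sup>+y. ennreal (\<bar>y\<bar>\<^sup>2) * indicator UNIV y \<partial>?P)"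
    by (rule nn_integral_Markov_inequality) (auto simp: sp)
  also have "\<dots> \<le> ennreal (1 / R\<^sup>2) * ennreal \<nu>" using m2 by (intro mult_left_mono) auto
  also have "\<dots> = ennreal (\<nu> / R\<^sup>2)" by (simp add: ennreal_mult'[symmetric])
  finally have c: "emeasure ?P {y. R < \<bar>y\<bar>} \<le> ennreal (\<nu> / R\<^sup>2)" .
  have "emeasure ?P {y. R < \<bar>y\<bar> \<or> f y = 0} \<le> emeasure ?P {y. R < \<bar>y\<bar>} + emeasure ?P {y. f y = 0}"
    unfolding eq using s1 s2 by (rule emeasure_subadditive)
  then show "emeasure ?P {y. R < \<bar>y\<bar> \<or> f y = 0} \<le> ennreal (\<nu> / R\<^sup>2)" using z c by simp
qed

text \<open>The level \<open>x\<close> is chosen so that \<open>exp (- x)\<close> compensates for the number of grid points, which is of order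
\<open>(n\<^sup>2 D)\<^sup>4\<close>; as \<open>x\<close> is then at most a multiple of \<open>log (n\<^sup>2 D)\<close>, the deviations are at most a multiple of
\<open>V_tilde\<close>. The constant \<open>\<eta> = \<epsilon> / (1 + \<epsilon>)\<close> is the largest proportion of \<open>\<Delta>\<close> that separation can spare.
The summand \<open>c3\<close> of \<open>C\<close> pays for the oscillation of the statistic between grid points and leaves a
strict excess \<open>1 / n\<close> over the critical value, which survives the infimum over \<open>K\<close>.\<close>
lemma uniform_power:
  fixes \<phi> :: "real \<Rightarrow> real" and a M Lip \<mu>\<^sub>l \<mu>\<^sub>u \<sigma>\<^sub>l \<sigma>\<^sub>u B0 L B \<nu> \<beta> \<epsilon> :: real
  defines "K \<equiv> {\<mu>\<^sub>l..\<mu>\<^sub>u} \<times> {\<sigma>\<^sub>l..\<sigma>\<^sub>u}"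
  assumes K: "0 < \<sigma>\<^sub>l" "\<sigma>\<^sub>l \<le> \<sigma>\<^sub>u" "\<mu>\<^sub>l \<le> \<mu>\<^sub>u" and L: "0 \<le> L" and nu: "0 < \<nu>"
    and beta: "0 < \<beta>" "\<beta> < 1" and eps: "0 < \<epsilon>"
    and nn: "0 \<le> a" "0 \<le> M" "0 \<le> Lip" "0 \<le> B" "0 \<le> B0"
  shows "\<exists>C>0. \<forall>D f f0 n q.
    scaling_kernel \<phi> D a M Lip \<longrightarrow> bounded_density f \<longrightarrow> sup_norm f = B \<longrightarrow>
    bounded_density f0 \<longrightarrow> sup_norm f0 = B0 \<longrightarrow> lipschitz_hyp f0 f K L \<longrightarrow>
    (\<integral>\<^sup>+x. ennreal (\<bar>x\<bar>\<^sup>2) \<partial>density_law f) \<le> ennreal \<nu> \<longrightarrow> 3 \<le> n \<longrightarrow> 0 \<le> q \<longrightarrow>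
    (\<forall>\<mu> \<sigma>. (\<mu>, \<sigma>) \<in> K \<longrightarrow>
      (1 + \<epsilon>) * ((L2_norm (\<lambda>x. \<sigma> * f (\<sigma> * x + \<mu>)
          - L2_proj (wavelet_space \<phi> D) (\<lambda>y. \<sigma> * f (\<sigma> * y + \<mu>)) x))\<^sup>2 + V_tilde C n D + q)
      \<le> \<sigma> * (L2_norm (\<lambda>x. f x - loc_scale f0 (\<mu>, \<sigma>) x))\<^sup>2) \<longrightarrow>
    sample_prob n f (\<lambda>X. T_tilde \<phi> f0 K n (2, D) X \<le> q) \<le> ennreal \<beta>"
proof -
  define am where "am = M\<^sup>2 * (2 * a + 1)"
  define G where "G = \<sigma>\<^sub>u * B"
  define E1 where "E1 = 4 * a * am * G"
  define c1 where "c1 = 4 * G * (am + 3 * E1) + 1"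
  define c2 where "c2 = 8 * G + 20 * E1 + 8 * B0 + 4 * am + 1"
  define \<eta> where "\<eta> = \<epsilon> / (1 + \<epsilon>)"
  define A0 where "A0 = 4 + ln (16 / \<beta>)"
  define m0 where "m0 = \<bar>\<mu>\<^sub>l\<bar> + \<bar>\<mu>\<^sub>u\<bar>"
  define kd where "kd = (\<mu>\<^sub>u - \<mu>\<^sub>l) / \<sigma>\<^sub>l + (2 * sqrt (\<nu> / \<beta>) + m0) * (\<sigma>\<^sub>u - \<sigma>\<^sub>l) / \<sigma>\<^sub>l\<^sup>2"
  define kl where "kl = 4 * (2 * a + 1) * M * Lip + 2 * L"
  define c3 where "c3 = kl * kd + 1"
  define C where "C = 4 * sqrt (c1 * A0) + 4 * c2 * A0\<^sup>2 + (128 * G * A0 / \<eta> + 4 * c2 * A0) + c3"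
  have s0: "0 < \<sigma>\<^sub>u" using K by linarith
  have am0: "0 \<le> am" using nn by (simp add: am_def)
  have G0: "0 \<le> G" using nn s0 by (simp add: G_def)
  have E10: "0 \<le> E1" using nn am0 G0 by (simp add: E1_def)
  have c10: "0 < c1" unfolding c1_def using G0 am0 E10 by (intro add_nonneg_pos) auto
  have c20: "0 < c2" unfolding c2_def using G0 am0 E10 nn by linarith
  have eta: "0 < \<eta>" using eps by (simp add: \<eta>_def)
  have lb: "0 \<le> ln (16 / \<beta>)" using beta by (intro ln_ge_zero) (simp add: field_simps)
  then have A00: "0 < A0" by (simp add: A0_def)
  have kd0: "0 \<le> kd" unfolding kd_def m0_def using K nu beta by (intro add_nonneg_nonneg divide_nonneg_nonneg mult_nonneg_nonneg) auto
  have kl0: "0 \<le> kl" unfolding kl_def using nn L by simp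
  have c30: "1 \<le> c3" using kd0 kl0 by (simp add: c3_def)
  have Cpos: "0 < C" unfolding C_def using c10 c20 A00 G0 eta c30 by (intro add_nonneg_pos add_nonneg_nonneg) auto
  show ?thesis
  proof (intro exI[of _ C] conjI allI impI Cpos)
    fix D f f0 n q
    assume SK: "scaling_kernel \<phi> D a M Lip" and f: "bounded_density f" and fB: "sup_norm f = B"
      and f0: "bounded_density f0" and f0B: "sup_norm f0 = B0" and lip: "lipschitz_hyp f0 f K L"
      and m2: "(\<integral>\<^sup>+x. ennreal (\<bar>x\<bar>\<^sup>2) \<partial>density_law f) \<le> ennreal \<nu>"
      and n: "3 \<le> (n::nat)" and q: "0 \<le> (q::real)"
      and sep: "\<forall>\<mu> \<sigma>. (\<mu>, \<sigma>) \<in> K \<longrightarrow>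
      (1 + \<epsilon>) * ((L2_norm (\<lambda>x. \<sigma> * f (\<sigma> * x + \<mu>)
          - L2_proj (wavelet_space \<phi> D) (\<lambda>y. \<sigma> * f (\<sigma> * y + \<mu>)) x))\<^sup>2 + V_tilde C n D + q)
      \<le> \<sigma> * (L2_norm (\<lambda>x. f x - loc_scale f0 (\<mu>, \<sigma>) x))\<^sup>2"
    interpret SK: scaling_kernel \<phi> D a M Lip by (rule SK)
    have amp: "SK.amp = am" by (simp add: SK.amp_def am_def)
    let ?P = "density_law f" and ?S = "sample_law n f"
    have f0m: "f0 \<in> borel_measurable borel" by (rule bounded_density_facts[OF f0])
    have D1: "1 \<le> real D" using SK.D by simp
    have n3: "3 \<le> real n" using n by simp
    define Q where "Q = real n ^ 2 * real D"
    define l where "l = ln Q"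
    define x where "x = 4 * l + ln (16 / \<beta>)"
    have nn9: "9 \<le> real n ^ 2" using power_mono[of 3 "real n" 2] n3 by simp
    have Q9: "9 \<le> Q" unfolding Q_def using mult_mono[OF nn9 D1] by simp
    have l1: "1 \<le> l" unfolding l_def using Q9 exp_le by (subst ln_ge_iff) auto
    have x0: "0 \<le> x" unfolding x_def using l1 lb by simp
    have xA: "x \<le> A0 * l"
      unfolding x_def A0_def using mult_left_mono[OF l1 lb] by (simp add: distrib_right)
    have expx: "exp (- x) = \<beta> / (16 * Q ^ 4)"
    proof -
      have "exp (- x) = exp (- (4 * l)) * exp (- ln (16 / \<beta>))" by (simp add: x_def exp_add[symmetric])
      also have "exp (- (4 * l)) = 1 / Q ^ 4"
        using Q9 exp_of_nat_mult[of 4 l] by (simp add: exp_minus l_def field_simps)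
      also have "exp (- ln (16 / \<beta>)) = \<beta> / 16" using beta by (simp add: exp_minus)
      finally show ?thesis by simp
    qed
    \<comment> \<open>mesh of order \<open>1 / (n\<^sup>4 D\<^sup>2)\<close>: it beats the factor \<open>D\<^sup>2\<close> of the perturbation bound and the factor
      \<open>n\<close> of the bound on the observations\<close>
    define N where "N = (n\<^sup>2 * D)\<^sup>2"
    have NQ: "real N = Q\<^sup>2" by (simp add: N_def Q_def)
    have N1: "1 \<le> N" using n SK.D by (simp add: N_def)
    define pt where "pt = (\<lambda>(i::nat, j::nat). (\<mu>\<^sub>l + real i * ((\<mu>\<^sub>u - \<mu>\<^sub>l) / real N), \<sigma>\<^sub>l + real j * ((\<sigma>\<^sub>u - \<sigma>\<^sub>l) / real N)))"
    define J where "J = {p \<in> {0..N} \<times> {0..N}. pt p \<in> K}"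
    have finJ: "finite J" by (simp add: J_def)
    have cardJ: "real (card J) \<le> 4 * Q ^ 4"
    proof -
      have "card J \<le> card ({0..N} \<times> {0..N})" unfolding J_def by (intro card_mono) auto
      then have "real (card J) \<le> real ((N + 1) * (N + 1))" by (simp only: of_nat_le_iff card_cartesian_product card_atLeastAtMost) simp
      also have "\<dots> \<le> (2 * real N) * (2 * real N)"
        unfolding of_nat_mult using N1 by (intro mult_mono) auto
      also have "\<dots> = 4 * Q ^ 4" unfolding NQ by (simp add: power2_eq_square power4_eq_xxxx)
      finally show ?thesis .
    qed
    \<comment> \<open>\<open>n * \<nu> / R\<^sup>2 \<le> \<beta> / 4\<close> for this value\<close>
    define R where "R = 2 * real n * sqrt (\<nu> / \<beta>)"
    have R0: "0 < R" using n3 nu beta by (simp add: R_def)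
    define b where "b \<mu> \<sigma> = (L2_norm (\<lambda>y. \<sigma> * f (\<sigma> * y + \<mu>)
          - L2_proj (wavelet_space \<phi> D) (\<lambda>y. \<sigma> * f (\<sigma> * y + \<mu>)) y))\<^sup>2" for \<mu> \<sigma>
    define \<Delta> where "\<Delta> \<mu> \<sigma> = (L2_norm (\<lambda>y. \<sigma> * f (\<sigma> * y + \<mu>) - f0 y))\<^sup>2" for \<mu> \<sigma>
    define rest where "rest = 4 * sqrt (c1 * real D * x) / real n + 128 * G * x / (\<eta> * real n)
             + 4 * c2 * (x / real n + real D * x\<^sup>2 / (real n)\<^sup>2)"
    let ?\<rho> = "2 * a * \<sigma>\<^sub>u / real D"
    define cnt where "cnt X j = real (card {i \<in> {1..n} - {j}. \<bar>X i - X j\<bar> \<le> ?\<rho>})" for X j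
    define thr where "thr = 8 * a * real n * G / real D + x"
    define Bc where "Bc = {X \<in> space ?S. \<exists>j\<in>{1..n}. thr \<le> cnt X j}"
    define BR where "BR = {X \<in> space ?S. \<exists>i\<in>{1..n}. X i \<in> {y. R < \<bar>y\<bar> \<or> f y = 0}}"
    define Bt where "Bt = (\<lambda>(\<mu>, \<sigma>). {X \<in> space ?S. (\<forall>j\<in>{1..n}. cnt X j \<le> thr) \<and>
      T_hat \<phi> f0 n (2, D) (\<lambda>i. (X i - \<mu>) / \<sigma>) \<le> (1 - \<eta>) * \<Delta> \<mu> \<sigma> - b \<mu> \<sigma> - rest})"
    have V0: "0 \<le> V_tilde C n D"
    proof -
      have "0 \<le> ln (real n ^ 2 * real D)" using l1 unfolding l_def Q_def by linarith
      then show ?thesis unfolding V_tilde_def using Cpos by simp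
    qed
    have sep': "(1 + \<epsilon>) * (b \<mu> \<sigma> + V_tilde C n D + q) \<le> \<Delta> \<mu> \<sigma>" if "(\<mu>, \<sigma>) \<in> K" for \<mu> \<sigma>
    proof -
      have "0 < \<sigma>" using that K by (auto simp: K_def)
      from sep[rule_format, OF that] standardized_density(8)[OF f this f0m, of \<mu>]
      show ?thesis unfolding b_def \<Delta>_def by simp
    qed
    have b0: "0 \<le> b \<mu> \<sigma>" for \<mu> \<sigma> by (simp add: b_def)
    have sepb: "b \<mu> \<sigma> \<le> \<Delta> \<mu> \<sigma>" if "(\<mu>, \<sigma>) \<in> K" for \<mu> \<sigma>
    proof -
      define W where "W = b \<mu> \<sigma> + V_tilde C n D + q"
      have "0 \<le> \<epsilon> * W" unfolding W_def using eps b0 V0 q by simp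
      moreover have "(1 + \<epsilon>) * W \<le> \<Delta> \<mu> \<sigma>" unfolding W_def by (rule sep'[OF that])
      ultimately have "W \<le> \<Delta> \<mu> \<sigma>" by (simp add: distrib_right)
      then show ?thesis using V0 q unfolding W_def by simp
    qed
    have gain: "b \<mu> \<sigma> + V_tilde C n D + q \<le> (1 - \<eta>) * \<Delta> \<mu> \<sigma>" if "(\<mu>, \<sigma>) \<in> K" for \<mu> \<sigma>
    proof -
      have "(1 - \<eta>) * ((1 + \<epsilon>) * (b \<mu> \<sigma> + V_tilde C n D + q)) \<le> (1 - \<eta>) * \<Delta> \<mu> \<sigma>"
        using eps by (intro mult_left_mono sep' that) (simp add: \<eta>_def field_simps)
      moreover have "(1 - \<eta>) * (1 + \<epsilon>) = 1" using eps by (simp add: \<eta>_def field_simps)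
      ultimately show ?thesis by (simp add: mult.assoc[symmetric])
    qed
    have Vrest: "rest + c3 / real n \<le> V_tilde C n D"
    proof -
      define v1 where "v1 = sqrt (real D) / real n * sqrt l"
      define v2 where "v2 = real D / real n ^ 2 * l\<^sup>2"
      define v3 where "v3 = l / real n"
      have v: "0 \<le> v1" "0 \<le> v2" "0 \<le> v3" unfolding v1_def v2_def v3_def using l1 by auto
      have V: "V_tilde C n D = C * (v1 + v2 + v3)"
        by (simp add: V_tilde_def v1_def v2_def v3_def l_def Q_def)
      have 1: "4 * sqrt (c1 * real D * x) / real n \<le> 4 * sqrt (c1 * A0) * v1"
      proof -
        have "c1 * real D * x \<le> c1 * real D * (A0 * l)" using c10 D1 by (intro mult_left_mono xA) auto
        then have "sqrt (c1 * real D * x) \<le> sqrt ((c1 * A0) * (real D * l))"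
          by (simp add: mult_ac)
        also have "\<dots> = sqrt (c1 * A0) * (sqrt (real D) * sqrt l)" by (simp add: real_sqrt_mult)
        finally have "4 * sqrt (c1 * real D * x) / real n \<le> 4 * (sqrt (c1 * A0) * (sqrt (real D) * sqrt l)) / real n"
          by (intro divide_right_mono mult_left_mono) auto
        then show ?thesis by (simp add: v1_def mult_ac)
      qed
      have 2: "128 * G * x / (\<eta> * real n) \<le> 128 * G * A0 / \<eta> * v3"
      proof -
        have "128 * G * x / (\<eta> * real n) \<le> 128 * G * (A0 * l) / (\<eta> * real n)"
          using G0 eta n3 by (intro divide_right_mono mult_left_mono xA) auto
        then show ?thesis by (simp add: v3_def mult_ac)
      qed
      have 3: "4 * c2 * (x / real n + real D * x\<^sup>2 / (real n)\<^sup>2) \<le> 4 * c2 * A0 * v3 + 4 * c2 * A0\<^sup>2 * v2"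
      proof -
        have "x / real n \<le> A0 * l / real n" by (intro divide_right_mono xA) auto
        moreover have "real D * x\<^sup>2 / (real n)\<^sup>2 \<le> real D * (A0 * l)\<^sup>2 / (real n)\<^sup>2"
          using x0 by (intro divide_right_mono mult_left_mono power_mono xA) auto
        ultimately have "4 * c2 * (x / real n + real D * x\<^sup>2 / (real n)\<^sup>2)
            \<le> 4 * c2 * (A0 * l / real n + real D * (A0 * l)\<^sup>2 / (real n)\<^sup>2)"
          using c20 by (intro mult_left_mono add_mono) auto
        also have "\<dots> = 4 * c2 * A0 * v3 + 4 * c2 * A0\<^sup>2 * v2"
          by (simp add: v2_def v3_def power_mult_distrib distrib_left mult_ac)
        finally show ?thesis .
      qed
      have 4: "c3 / real n \<le> c3 * v3" unfolding v3_def using l1 c30 n3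
        by (simp add: divide_right_mono)
      have 5: "0 \<le> 4 * sqrt (c1 * A0)" "0 \<le> 4 * c2 * A0\<^sup>2" "0 \<le> 128 * G * A0 / \<eta> + 4 * c2 * A0" "0 \<le> c3"
        using c10 c20 A00 G0 eta c30 by auto
      have "4 * sqrt (c1 * A0) * v1 + 4 * c2 * A0\<^sup>2 * v2 + (128 * G * A0 / \<eta> + 4 * c2 * A0 + c3) * v3 \<le> C * v1 + C * v2 + C * v3"
        using v 5 by (intro add_mono mult_right_mono) (auto simp: C_def)
      then show ?thesis using 1 2 3 4 unfolding rest_def V distrib_left[of C] distrib_right by linarith
    qed
    have sub: "{X \<in> space ?S. T_tilde \<phi> f0 K n (2, D) X \<le> q} \<subseteq> Bc \<union> BR \<union> (\<Union>p\<in>J. Bt (pt p))"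
    proof (rule subsetI, rule ccontr)
      fix X
      assume X: "X \<in> {X \<in> space ?S. T_tilde \<phi> f0 K n (2, D) X \<le> q}"
        and not: "X \<notin> Bc \<union> BR \<union> (\<Union>p\<in>J. Bt (pt p))"
      have Xs: "X \<in> space ?S" using X by simp
      have good: "cnt X j < thr" if "j \<in> {1..n}" for j
        using not Xs that unfolding Bc_def by (auto simp: not_le)
      have obs: "\<bar>X i\<bar> \<le> R" "f (X i) \<noteq> 0" if "i \<in> {1..n}" for i
        using not Xs that unfolding BR_def by (auto simp: not_less)
      have big: "q + 1 / real n \<le> T_hat \<phi> f0 n (2, D) (\<lambda>i. (X i - \<mu>) / \<sigma>)" if \<theta>: "(\<mu>, \<sigma>) \<in> K" for \<mu> \<sigma>
      proof -
        obtain i where i: "i \<in> {0..N}" "\<mu>\<^sub>l + real i * ((\<mu>\<^sub>u - \<mu>\<^sub>l) / real N) \<in> {\<mu>\<^sub>l..\<mu>\<^sub>u}"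
          "\<bar>\<mu> - (\<mu>\<^sub>l + real i * ((\<mu>\<^sub>u - \<mu>\<^sub>l) / real N))\<bar> \<le> (\<mu>\<^sub>u - \<mu>\<^sub>l) / real N"
          using interval_net[of \<mu> \<mu>\<^sub>l \<mu>\<^sub>u, OF _ N1] \<theta> unfolding K_def by blast
        obtain j where j: "j \<in> {0..N}" "\<sigma>\<^sub>l + real j * ((\<sigma>\<^sub>u - \<sigma>\<^sub>l) / real N) \<in> {\<sigma>\<^sub>l..\<sigma>\<^sub>u}"
          "\<bar>\<sigma> - (\<sigma>\<^sub>l + real j * ((\<sigma>\<^sub>u - \<sigma>\<^sub>l) / real N))\<bar> \<le> (\<sigma>\<^sub>u - \<sigma>\<^sub>l) / real N"
          using interval_net[of \<sigma> \<sigma>\<^sub>l \<sigma>\<^sub>u, OF _ N1] \<theta> unfolding K_def by blast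
        define \<mu>' where "\<mu>' = \<mu>\<^sub>l + real i * ((\<mu>\<^sub>u - \<mu>\<^sub>l) / real N)"
        define \<sigma>' where "\<sigma>' = \<sigma>\<^sub>l + real j * ((\<sigma>\<^sub>u - \<sigma>\<^sub>l) / real N)"
        note i = i[folded \<mu>'_def] and j = j[folded \<sigma>'_def]
        have ptij: "pt (i, j) = (\<mu>', \<sigma>')" by (simp add: pt_def \<mu>'_def \<sigma>'_def)
        have \<theta>': "(\<mu>', \<sigma>') \<in> K" using i j by (simp add: K_def)
        have "(i, j) \<in> J" using i j \<theta>' by (simp add: J_def ptij)
        then have "X \<notin> Bt (\<mu>', \<sigma>')" using not ptij by force
        then have T': "(1 - \<eta>) * \<Delta> \<mu>' \<sigma>' - b \<mu>' \<sigma>' - rest < T_hat \<phi> f0 n (2, D) (\<lambda>i. (X i - \<mu>') / \<sigma>')"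
        proof -
          have "\<forall>j\<in>{1..n}. cnt X j \<le> thr" using good less_imp_le by blast
          with \<open>X \<notin> Bt (\<mu>', \<sigma>')\<close> Xs
          have "\<not> T_hat \<phi> f0 n (2, D) (\<lambda>i. (X i - \<mu>') / \<sigma>') \<le> (1 - \<eta>) * \<Delta> \<mu>' \<sigma>' - b \<mu>' \<sigma>' - rest"
            unfolding Bt_def prod.case by blast
          then show ?thesis by (simp only: not_le)
        qed
        define d where "d = real n * kd / real N"
        have m0: "\<bar>\<mu>'\<bar> \<le> m0" using i(2) unfolding m0_def by auto
        have sl: "\<sigma>\<^sub>l \<le> \<sigma>" "\<sigma>\<^sub>l \<le> \<sigma>'" using \<theta> \<theta>' by (auto simp: K_def)
        have dd: "\<bar>(X i - \<mu>) / \<sigma> - (X i - \<mu>') / \<sigma>'\<bar> \<le> d" if ii: "i \<in> {1..n}" for i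
        proof -
          have "\<bar>(X i - \<mu>) / \<sigma> - (X i - \<mu>') / \<sigma>'\<bar>
             \<le> (\<mu>\<^sub>u - \<mu>\<^sub>l) / real N / \<sigma>\<^sub>l + (R + m0) * ((\<sigma>\<^sub>u - \<sigma>\<^sub>l) / real N) / \<sigma>\<^sub>l\<^sup>2"
            by (rule standardization_lipschitz[OF K(1) sl obs(1)[OF ii] m0 i(3) j(3)])
          also have "\<dots> \<le> real n * (\<mu>\<^sub>u - \<mu>\<^sub>l) / real N / \<sigma>\<^sub>l + (real n * (2 * sqrt (\<nu> / \<beta>) + m0)) * ((\<sigma>\<^sub>u - \<sigma>\<^sub>l) / real N) / \<sigma>\<^sub>l\<^sup>2"
          proof (intro add_mono divide_right_mono mult_right_mono)
            show "\<mu>\<^sub>u - \<mu>\<^sub>l \<le> real n * (\<mu>\<^sub>u - \<mu>\<^sub>l)" using mult_right_mono[of 1 "real n" "\<mu>\<^sub>u - \<mu>\<^sub>l"] n3 K by simp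
            have "1 * m0 \<le> real n * m0" using n3 by (intro mult_right_mono) (auto simp: m0_def)
            then show "R + m0 \<le> real n * (2 * sqrt (\<nu> / \<beta>) + m0)" unfolding R_def by (simp add: distrib_left)
          qed (use K in auto)
          also have "\<dots> = d" unfolding d_def kd_def by (simp add: distrib_left add_divide_distrib mult_ac)
          finally show ?thesis .
        qed
        have ff: "\<bar>f0 ((X i - \<mu>) / \<sigma>) - f0 ((X i - \<mu>') / \<sigma>')\<bar> \<le> L * d" if ii: "i \<in> {1..n}" for i
        proof -
          have "\<bar>f0 ((X i - \<mu>) / \<sigma>) - f0 ((X i - \<mu>') / \<sigma>')\<bar> \<le> L * \<bar>(X i - \<mu>) / \<sigma> - (X i - \<mu>') / \<sigma>'\<bar>"
            using lip obs(2)[OF ii] \<theta> \<theta>' unfolding lipschitz_hyp_def by fastforce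
          also have "\<dots> \<le> L * d" using L dd[OF ii] by (intro mult_left_mono)
          finally show ?thesis .
        qed
        have "\<bar>T_hat \<phi> f0 n (2, D) (\<lambda>i. (X i - \<mu>) / \<sigma>) - T_hat \<phi> f0 n (2, D) (\<lambda>i. (X i - \<mu>') / \<sigma>')\<bar>
          \<le> (4 * (2 * a + 1) * M * Lip * (real D)\<^sup>2 + 2 * L) * d"
          using n by (intro SK.T_hat_perturbation dd ff) auto
        also have "\<dots> \<le> (kl * (real D)\<^sup>2) * d"
        proof (rule mult_right_mono)
          have "2 * L * 1 \<le> 2 * L * (real D)\<^sup>2" using L D1 by (intro mult_left_mono) auto
          then show "4 * (2 * a + 1) * M * Lip * (real D)\<^sup>2 + 2 * L \<le> kl * (real D)\<^sup>2"
            unfolding kl_def distrib_right by linarith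
          show "0 \<le> d" using kd0 by (simp add: d_def)
        qed
        also have "\<dots> = kl * kd * (1 / real n ^ 3)"
          unfolding d_def NQ Q_def using n3 D1 by (simp add: power_mult_distrib field_simps power2_eq_square power3_eq_cube)
        also have "\<dots> \<le> kl * kd * (1 / real n)"
        proof (intro mult_left_mono divide_left_mono)
          show "real n \<le> real n ^ 3" using n3 by (intro self_le_power) auto
        qed (use kl0 kd0 n3 in auto)
        finally have "T_hat \<phi> f0 n (2, D) (\<lambda>i. (X i - \<mu>') / \<sigma>') - kl * kd * (1 / real n) \<le> T_hat \<phi> f0 n (2, D) (\<lambda>i. (X i - \<mu>) / \<sigma>)"
          by linarith
        moreover have "kl * kd * (1 / real n) + 1 / real n = c3 / real n"
          by (simp add: c3_def add_divide_distrib)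
        ultimately show ?thesis using T' gain[OF \<theta>'] Vrest by linarith
      qed
      have "K \<noteq> {}" using K by (auto simp: K_def)
      then have "q + 1 / real n \<le> T_tilde \<phi> f0 K n (2, D) X"
        unfolding T_tilde_def by (intro cINF_greatest) (auto intro: big)
      moreover have "0 < 1 / real n" using n3 by simp
      ultimately have "q < T_tilde \<phi> f0 K n (2, D) X" by linarith
      then show False using X by simp
    qed
    have pBc: "outer_measure_of ?S Bc \<le> ennreal (\<beta> / 4)"
    proof -
      have "outer_measure_of ?S Bc \<le> ennreal (real n * exp (- x))"
      proof -
        have "0 \<le> ?\<rho>" using nn s0 by simp
        have thr: "2 * real n * (2 * ?\<rho> * sup_norm f) + x = thr" by (simp add: thr_def fB G_def)
        have "0 \<le> 2 * ?\<rho> * sup_norm f" using s0 nn by (simp add: fB)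
        from neighbour_count_tail[OF prob_space_density_law[OF f] sets_density_law ball_prob_density_law[OF f \<open>0 \<le> ?\<rho>\<close>] this, of n x]
        show ?thesis unfolding thr Bc_def cnt_def sample_law_def .
      qed
      also have "\<dots> \<le> ennreal (\<beta> / 4)"
      proof (rule ennreal_leI)
        have "real n \<le> real n ^ 2 * 1" using n3 by (simp add: power2_eq_square)
        also have "\<dots> \<le> Q" unfolding Q_def using D1 by (intro mult_left_mono) auto
        also have "\<dots> \<le> Q ^ 4" using Q9 by (intro self_le_power) auto
        finally have "real n * exp (- x) \<le> Q ^ 4 * exp (- x)" by (intro mult_right_mono) auto
        also have "\<dots> = \<beta> / 16" unfolding expx using Q9 by simp
        finally show "real n * exp (- x) \<le> \<beta> / 4" using beta by simp
      qed
      finally show ?thesis .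
    qed
    have pBR: "outer_measure_of ?S BR \<le> ennreal (\<beta> / 4)"
    proof -
      note at = atypical_observation_prob[OF f R0 m2]
      have "outer_measure_of ?S BR \<le> of_nat n * emeasure ?P {y. R < \<bar>y\<bar> \<or> f y = 0}"
        unfolding BR_def sample_law_def by (rule some_coordinate_prob[OF prob_space_density_law[OF f] at(1)])
      also have "\<dots> \<le> of_nat n * ennreal (\<nu> / R\<^sup>2)" by (intro mult_left_mono at(2)) auto
      also have "\<dots> = ennreal (real n * (\<nu> / R\<^sup>2))"
        by (simp only: ennreal_mult'[OF of_nat_0_le_iff] ennreal_of_nat_eq_real_of_nat)
      also have "\<dots> \<le> ennreal (\<beta> / 4)"
      proof (rule ennreal_leI)
        have "R\<^sup>2 = 4 * real n ^ 2 * (\<nu> / \<beta>)" using nu beta by (simp add: R_def power_mult_distrib)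
        then have "real n * (\<nu> / R\<^sup>2) = real n * (\<nu> / (4 * real n ^ 2 * (\<nu> / \<beta>)))" by simp
        also have "\<dots> = \<beta> / (4 * real n)" using nu beta n3 by (simp add: field_simps power2_eq_square)
        also have "\<dots> \<le> \<beta> / 4" using n3 beta by (intro divide_left_mono) auto
        finally show "real n * (\<nu> / R\<^sup>2) \<le> \<beta> / 4" .
      qed
      finally show ?thesis .
    qed
    have pBt: "outer_measure_of ?S (\<Union>p\<in>J. Bt (pt p)) \<le> ennreal (\<beta> / 4)"
    proof -
      have one: "outer_measure_of ?S (Bt (pt p)) \<le> ennreal (exp (- x))" if "p \<in> J" for p
      proof -
        obtain \<mu> \<sigma> where p: "pt p = (\<mu>, \<sigma>)" by force
        have \<theta>: "(\<mu>, \<sigma>) \<in> K" using that p by (simp add: J_def)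
        have s: "0 < \<sigma>" "\<sigma> \<le> \<sigma>\<^sub>u" using \<theta> K by (auto simp: K_def)
        have n2: "2 \<le> n" using n by simp
        show ?thesis
          using SK.standardized_T_hat_lower_tail[OF f f0 s n2 x0 eta, of \<mu>] sepb[OF \<theta>]
          unfolding p Bt_def prod.case cnt_def thr_def \<Delta>_def b_def rest_def c1_def c2_def E1_def G_def amp fB f0B
          by blast
      qed
      have "outer_measure_of ?S (\<Union>p\<in>J. Bt (pt p)) \<le> (\<Sum>p\<in>J. outer_measure_of ?S (Bt (pt p)))"
        by (rule outer_measure_of_UN[OF finJ]) (auto simp: Bt_def split: prod.splits)
      also have "\<dots> \<le> (\<Sum>p\<in>J. ennreal (exp (- x)))" by (intro sum_mono one)
      also have "\<dots> = ennreal (real (card J) * exp (- x))" by (simp add: ennreal_mult' ennreal_of_nat_eq_real_of_nat)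
      also have "\<dots> \<le> ennreal (\<beta> / 4)"
      proof (rule ennreal_leI)
        have "real (card J) * exp (- x) \<le> 4 * Q ^ 4 * exp (- x)" by (intro mult_right_mono cardJ) auto
        also have "\<dots> = \<beta> / 4" unfolding expx using Q9 by simp
        finally show "real (card J) * exp (- x) \<le> \<beta> / 4" .
      qed
      finally show ?thesis .
    qed
    have spB: "Bc \<subseteq> space ?S" "BR \<subseteq> space ?S" "(\<Union>p\<in>J. Bt (pt p)) \<subseteq> space ?S"
      by (auto simp: Bc_def BR_def Bt_def split: prod.splits)
    have "sample_prob n f (\<lambda>X. T_tilde \<phi> f0 K n (2, D) X \<le> q)
        \<le> outer_measure_of ?S (Bc \<union> BR \<union> (\<Union>p\<in>J. Bt (pt p)))"
      unfolding sample_prob_def by (rule outer_measure_of_mono[OF sub])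
    also have "\<dots> \<le> outer_measure_of ?S Bc + outer_measure_of ?S BR + outer_measure_of ?S (\<Union>p\<in>J. Bt (pt p))"
      using spB by (intro order_trans[OF outer_measure_of_Un] add_right_mono outer_measure_of_Un) auto
    also have "\<dots> \<le> ennreal (\<beta> / 4) + ennreal (\<beta> / 4) + ennreal (\<beta> / 4)"
      by (intro add_mono pBc pBR pBt)
    also have "\<dots> = ennreal (\<beta> / 4 + \<beta> / 4 + \<beta> / 4)" using beta by (simp flip: ennreal_plus)
    also have "\<dots> \<le> ennreal \<beta>" using beta by (intro ennreal_leI) simp
    finally show "sample_prob n f (\<lambda>X. T_tilde \<phi> f0 K n (2, D) X \<le> q) \<le> ennreal \<beta>" .
  qed
qed

text \<open>A compactly supported Lipschitz function is bounded, by comparison with a point outside the support.\<close>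
lemma wavelet_pair_scaling_kernel:
  assumes "wavelet_pair \<phi> \<psi>"
  obtains a M Lip where "0 \<le> a" "0 \<le> M" "0 \<le> Lip" "\<And>J. scaling_kernel \<phi> (2 ^ J) a M Lip"
proof -
  from assms have "bounded {x. \<phi> x \<noteq> 0}"
    unfolding wavelet_pair_def using compact_imp_bounded bounded_subset closure_subset by metis
  then obtain a' where a': "\<And>x. \<phi> x \<noteq> 0 \<Longrightarrow> \<bar>x\<bar> \<le> a'" unfolding bounded_iff by auto
  define a where "a = max a' 0"
  have a: "\<bar>x\<bar> \<le> a" if "\<phi> x \<noteq> 0" for x using a'[OF that] by (simp add: a_def)
  from assms obtain Lip where Lip: "\<And>x y. \<bar>\<phi> x - \<phi> y\<bar> \<le> Lip * \<bar>x - y\<bar>" unfolding wavelet_pair_def by auto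
  have Lip0: "0 \<le> Lip" using Lip[of 0 1] by simp
  define M where "M = Lip * (2 * a + 1)"
  have a0: "0 \<le> a" by (simp add: a_def)
  have M0: "0 \<le> M" using Lip0 a0 by (simp add: M_def)
  have bnd: "\<bar>\<phi> x\<bar> \<le> M" for x
  proof (cases "\<phi> x = 0")
    case False
    have z: "\<phi> (a + 1) = 0" using a[of "a + 1"] a0 by auto
    have "\<bar>\<phi> x\<bar> \<le> Lip * \<bar>x - (a + 1)\<bar>" using Lip[of x "a + 1"] z by simp
    also have "\<dots> \<le> Lip * (2 * a + 1)" using a[OF False] Lip0 by (intro mult_left_mono) auto
    finally show ?thesis by (simp add: M_def)
  qed (use M0 in simp)
  show thesis
  proof (rule that[OF a0 M0 Lip0])
    fix J
    have onb: "L2_orthonormal_basis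
            (case_sum (\<lambda>k. dilate \<phi> (2 ^ J) k) (\<lambda>(j, k). dilate \<psi> (2 ^ j) k))
            ((UNIV :: int set) <+> ({J..} \<times> (UNIV :: int set))) L2"
      using assms by (simp add: wavelet_pair_def)
    have in_I: "Inl k \<in> (UNIV :: int set) <+> ({J..} \<times> (UNIV :: int set))" for k by (rule InlI) simp
    show "scaling_kernel \<phi> (2 ^ J) a M Lip"
    proof
      show "dilate \<phi> (2 ^ J) k \<in> L2" for k
        using onb in_I[of k] unfolding L2_orthonormal_basis_def by (metis sum.case(1))
      show "L2_inner (dilate \<phi> (2 ^ J) j) (dilate \<phi> (2 ^ J) k) = (if j = k then 1 else 0)" for j k
      proof -
        have "L2_inner (case_sum (\<lambda>k. dilate \<phi> (2 ^ J) k) (\<lambda>(j, k). dilate \<psi> (2 ^ j) k) (Inl j))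
          (case_sum (\<lambda>k. dilate \<phi> (2 ^ J) k) (\<lambda>(j, k). dilate \<psi> (2 ^ j) k) (Inl k)) = (if Inl j = (Inl k :: int + nat \<times> int) then 1 else 0)"
          using onb in_I[of j] in_I[of k] unfolding L2_orthonormal_basis_def by blast
        then show ?thesis by simp
      qed
    qed (use a bnd Lip a0 in auto)
  qed
qed

theorem theorem2:
  fixes \<phi> :: "real \<Rightarrow> real"
    and \<mu>\<^sub>l \<mu>\<^sub>u \<sigma>\<^sub>l \<sigma>\<^sub>u B\<^sub>0 L B \<nu> c \<beta> \<epsilon> :: real
    and K :: "(real \<times> real) set"
  defines "K \<equiv> {\<mu>\<^sub>l..\<mu>\<^sub>u} \<times> {\<sigma>\<^sub>l..\<sigma>\<^sub>u}"
  assumes "0 < \<sigma>\<^sub>l" and "0 < L" and "0 < \<nu>" and "0 < c"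
    and "0 < \<beta>" and "\<beta> < 1" and "0 < \<epsilon>" and "\<epsilon> < 2"
  shows "\<exists>C>0. \<forall>(\<psi> :: real \<Rightarrow> real) (f :: real \<Rightarrow> real) (f\<^sub>0 :: real \<Rightarrow> real) (n :: nat) (\<alpha> :: real)
           (\<D>\<^sub>1 :: nat set) (\<D>\<^sub>2 :: nat set) (q :: nat \<times> nat \<Rightarrow> real).
      wavelet_pair \<phi> \<psi> \<longrightarrow>
      bounded_density f \<longrightarrow> sup_norm f = B \<longrightarrow>
      bounded_density f\<^sub>0 \<longrightarrow> sup_norm f\<^sub>0 = B\<^sub>0 \<longrightarrow>
      lipschitz_hyp f\<^sub>0 f K L \<longrightarrow>
      moment_hyp f \<nu> c \<longrightarrow>
      0 < \<alpha> \<longrightarrow> \<alpha> < 1 \<longrightarrow>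
      \<D>\<^sub>1 \<subseteq> \<D>\<^sub>1_max \<longrightarrow> \<D>\<^sub>2 \<subseteq> \<D>\<^sub>2_max \<longrightarrow> \<D>\<^sub>2 \<noteq> {} \<longrightarrow>
      (\<forall>m\<in>models \<D>\<^sub>1 \<D>\<^sub>2. 0 < q m) \<longrightarrow>
      (SUP g\<in>loc_scale f\<^sub>0 ` K.
         sample_prob n g (\<lambda>X. test_stat \<phi> f\<^sub>0 K n (models \<D>\<^sub>1 \<D>\<^sub>2) q X > 0)) \<le> ennreal \<alpha> \<longrightarrow>
      3 \<le> n \<longrightarrow> 2 \<le> real n ^ 2 * min (\<mu>\<^sub>u - \<mu>\<^sub>l) (\<sigma>\<^sub>u - \<sigma>\<^sub>l) \<longrightarrow>
      (INF (\<mu>, \<sigma>)\<in>K. \<sigma> * (L2_norm (\<lambda>x. f x - loc_scale f\<^sub>0 (\<mu>, \<sigma>) x))\<^sup>2)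
        \<ge> (1 + \<epsilon>) *
           (INF D\<in>\<D>\<^sub>2.
              (SUP (\<mu>, \<sigma>)\<in>K.
                 (L2_norm (\<lambda>x. \<sigma> * f (\<sigma> * x + \<mu>)
                      - L2_proj (wavelet_space \<phi> D) (\<lambda>y. \<sigma> * f (\<sigma> * y + \<mu>)) x))\<^sup>2)
              + V_tilde C n D + q (2, D)) \<longrightarrow>
      sample_prob n f (\<lambda>X. test_stat \<phi> f\<^sub>0 K n (models \<D>\<^sub>1 \<D>\<^sub>2) q X \<le> 0) \<le> ennreal \<beta>"
proof -
  have trivial: "\<exists>C>0::real. \<forall>\<psi> f f\<^sub>0 (n::nat) \<alpha> \<D>\<^sub>1 \<D>\<^sub>2 q. Q C \<psi> f f\<^sub>0 n \<alpha> \<D>\<^sub>1 \<D>\<^sub>2 q"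
    if "\<And>\<psi> f f\<^sub>0 n \<alpha> \<D>\<^sub>1 \<D>\<^sub>2 q. Q 1 \<psi> f f\<^sub>0 n \<alpha> \<D>\<^sub>1 \<D>\<^sub>2 q"
    for Q :: "real \<Rightarrow> (real \<Rightarrow> real) \<Rightarrow> (real \<Rightarrow> real) \<Rightarrow> (real \<Rightarrow> real) \<Rightarrow> nat \<Rightarrow> real \<Rightarrow> nat set \<Rightarrow> nat set \<Rightarrow> (nat \<times> nat \<Rightarrow> real) \<Rightarrow> bool"
    using that by (intro exI[of _ 1]) auto
  show ?thesis
  proof (cases "(\<exists>\<psi>. wavelet_pair \<phi> \<psi>) \<and> 0 \<le> B \<and> 0 \<le> B\<^sub>0 \<and> \<mu>\<^sub>l \<le> \<mu>\<^sub>u \<and> \<sigma>\<^sub>l \<le> \<sigma>\<^sub>u")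
    \<comment> \<open>the hypotheses on \<open>\<psi>\<close>, \<open>f\<close>, \<open>f\<^sub>0\<close> or \<open>n\<close> then cannot be met, so any constant will do\<close>
    case False
    have nonneg: "0 \<le> sup_norm f" if "bounded_density f" for f using bounded_density_facts(7)[OF that] .
    have ordered: "\<mu>\<^sub>l \<le> \<mu>\<^sub>u \<and> \<sigma>\<^sub>l \<le> \<sigma>\<^sub>u" if "2 \<le> real n ^ 2 * min (\<mu>\<^sub>u - \<mu>\<^sub>l) (\<sigma>\<^sub>u - \<sigma>\<^sub>l)" for n :: nat
    proof -
      have "0 < real n ^ 2 * min (\<mu>\<^sub>u - \<mu>\<^sub>l) (\<sigma>\<^sub>u - \<sigma>\<^sub>l)" using that by linarith
      then have "0 < min (\<mu>\<^sub>u - \<mu>\<^sub>l) (\<sigma>\<^sub>u - \<sigma>\<^sub>l)" by (simp add: zero_less_mult_iff)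
      then show ?thesis by simp
    qed
    show ?thesis
      by (rule trivial) (use False nonneg ordered in blast)
  next
    case True
    then obtain \<psi>0 where \<psi>0: "wavelet_pair \<phi> \<psi>0" by blast
    obtain a M Lip where aML: "0 \<le> a" "0 \<le> M" "0 \<le> Lip" and SK: "\<And>J. scaling_kernel \<phi> (2 ^ J) a M Lip"
      using wavelet_pair_scaling_kernel[OF \<psi>0] by blast
    have ranges: "0 \<le> B" "0 \<le> B\<^sub>0" "\<mu>\<^sub>l \<le> \<mu>\<^sub>u" "\<sigma>\<^sub>l \<le> \<sigma>\<^sub>u" using True by auto
    \<comment> \<open>half of \<open>\<epsilon>\<close> is kept to make up for the infimum over \<open>\<D>\<^sub>2\<close> not being attained\<close>
    have e2: "0 < \<epsilon> / 2" using \<open>0 < \<epsilon>\<close> by simp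
    obtain C where C: "0 < C" and power: "\<And>D f f0 n q.
      scaling_kernel \<phi> D a M Lip \<Longrightarrow> bounded_density f \<Longrightarrow> sup_norm f = B \<Longrightarrow>
      bounded_density f0 \<Longrightarrow> sup_norm f0 = B\<^sub>0 \<Longrightarrow> lipschitz_hyp f0 f K L \<Longrightarrow>
      (\<integral>\<^sup>+x. ennreal (\<bar>x\<bar>\<^sup>2) \<partial>density_law f) \<le> ennreal \<nu> \<Longrightarrow> 3 \<le> n \<Longrightarrow> 0 \<le> q \<Longrightarrow>
      (\<And>\<mu> \<sigma>. (\<mu>, \<sigma>) \<in> K \<Longrightarrow>
        (1 + \<epsilon> / 2) * ((L2_norm (\<lambda>x. \<sigma> * f (\<sigma> * x + \<mu>)
            - L2_proj (wavelet_space \<phi> D) (\<lambda>y. \<sigma> * f (\<sigma> * y + \<mu>)) x))\<^sup>2 + V_tilde C n D + q)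
        \<le> \<sigma> * (L2_norm (\<lambda>x. f x - loc_scale f0 (\<mu>, \<sigma>) x))\<^sup>2) \<Longrightarrow>
      sample_prob n f (\<lambda>X. T_tilde \<phi> f0 K n (2, D) X \<le> q) \<le> ennreal \<beta>"
      using uniform_power[OF \<open>0 < \<sigma>\<^sub>l\<close> ranges(4,3) less_imp_le[OF \<open>0 < L\<close>] \<open>0 < \<nu>\<close> \<open>0 < \<beta>\<close> \<open>\<beta> < 1\<close> e2 aML ranges(1,2), of \<phi>]
      unfolding K_def[symmetric] by blast
    show ?thesis
    proof (intro exI[of _ C] conjI allI impI C)
      fix \<psi> f f\<^sub>0 :: "real \<Rightarrow> real" and n :: nat and \<alpha> :: real and \<D>\<^sub>1 \<D>\<^sub>2 :: "nat set" and q :: "nat \<times> nat \<Rightarrow> real"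
      assume f: "bounded_density f" and fB: "sup_norm f = B" and f0: "bounded_density f\<^sub>0" and f0B: "sup_norm f\<^sub>0 = B\<^sub>0"
        and lip: "lipschitz_hyp f\<^sub>0 f K L" and mom: "moment_hyp f \<nu> c"
        and D2: "\<D>\<^sub>2 \<subseteq> \<D>\<^sub>2_max" "\<D>\<^sub>2 \<noteq> {}" and q: "\<forall>m\<in>models \<D>\<^sub>1 \<D>\<^sub>2. 0 < q m" and n: "3 \<le> n"
        and sep: "(1 + \<epsilon>) *
           (INF D\<in>\<D>\<^sub>2.
              (SUP (\<mu>, \<sigma>)\<in>K.
                 (L2_norm (\<lambda>x. \<sigma> * f (\<sigma> * x + \<mu>)
                      - L2_proj (wavelet_space \<phi> D) (\<lambda>y. \<sigma> * f (\<sigma> * y + \<mu>)) x))\<^sup>2)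
              + V_tilde C n D + q (2, D))
          \<le> (INF (\<mu>, \<sigma>)\<in>K. \<sigma> * (L2_norm (\<lambda>x. f x - loc_scale f\<^sub>0 (\<mu>, \<sigma>) x))\<^sup>2)"
      define bias where "bias D = (\<lambda>(\<mu>, \<sigma>). (L2_norm (\<lambda>x. \<sigma> * f (\<sigma> * x + \<mu>)
                      - L2_proj (wavelet_space \<phi> D) (\<lambda>y. \<sigma> * f (\<sigma> * y + \<mu>)) x))\<^sup>2)" for D
      define risk where "risk D = (SUP \<theta>\<in>K. bias D \<theta>) + V_tilde C n D + q (2, D)" for D
      define sdist where "sdist = (\<lambda>(\<mu>, \<sigma>). \<sigma> * (L2_norm (\<lambda>x. f x - loc_scale f\<^sub>0 (\<mu>, \<sigma>) x))\<^sup>2)"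
      have sep: "(1 + \<epsilon>) * (INF D\<in>\<D>\<^sub>2. risk D) \<le> (INF \<theta>\<in>K. sdist \<theta>)"
        using sep unfolding risk_def bias_def sdist_def by (simp only: case_prod_unfold)
      have SKD: "scaling_kernel \<phi> D a M Lip" if "D \<in> \<D>\<^sub>2" for D
        using D2 that SK unfolding \<D>\<^sub>2_max_def by auto
      have KI: "(\<mu>\<^sub>l, \<sigma>\<^sub>l) \<in> K" using ranges by (simp add: K_def)
      have n3: "3 \<le> real n" using n by simp
      have nn9: "9 \<le> real n ^ 2" using power_mono[of 3 "real n" 2] n3 by simp
      have bias_bdd: "bdd_above (bias D ` K)" if D: "D \<in> \<D>\<^sub>2" for D
      proof (rule bdd_aboveI2)
        interpret S: scaling_kernel \<phi> D a M Lip by (rule SKD[OF D])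
        fix \<theta> assume "\<theta> \<in> K"
        then obtain \<mu> \<sigma> where \<theta>: "\<theta> = (\<mu>, \<sigma>)" "\<sigma>\<^sub>l \<le> \<sigma>" "\<sigma> \<le> \<sigma>\<^sub>u" unfolding K_def by auto
        then have s: "0 < \<sigma>" using \<open>0 < \<sigma>\<^sub>l\<close> by linarith
        let ?g = "\<lambda>y. \<sigma> * f (\<sigma> * y + \<mu>)"
        note g = standardized_density[OF f s, where \<mu> = \<mu>]
        have "bias D \<theta> \<le> L2_inner ?g ?g"
          unfolding \<theta> bias_def prod.case S.proj_dist[OF g(6)]
          using L2_norm_sq[of "S.proj ?g"] zero_le_power2[of "L2_norm (S.proj ?g)"] by linarith
        also have "\<dots> \<le> (\<integral>y. \<sigma>\<^sub>u * B * ?g y \<partial>lborel)"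
          unfolding L2_inner_def
        proof (rule integral_mono[OF L2_times_integrable[OF g(6) g(6)]])
          show "integrable lborel (\<lambda>y. \<sigma>\<^sub>u * B * ?g y)" using g(2) by (rule integrable_mult_right)
          have "?g y \<le> \<sigma>\<^sub>u * B" for y
            using g(4)[of y] mult_right_mono[OF \<theta>(3) ranges(1)] unfolding fB by linarith
          then show "?g y * ?g y \<le> \<sigma>\<^sub>u * B * ?g y" for y using g(3)[of y] by (intro mult_right_mono)
        qed
        also have "\<dots> = \<sigma>\<^sub>u * B" using g(5) by simp
        finally show "bias D \<theta> \<le> \<sigma>\<^sub>u * B" .
      qed
      have bias0: "0 \<le> bias D \<theta>" for D \<theta> by (simp add: bias_def case_prod_unfold)
      \<comment> \<open>a lower bound uniform in \<open>D\<close>, so that the infimum is positive and can be exceeded by a factor\<close>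
      have risk_ge: "C * (ln 9 / real n) \<le> risk D" if D: "D \<in> \<D>\<^sub>2" for D
      proof -
        interpret S: scaling_kernel \<phi> D a M Lip by (rule SKD[OF D])
        have D1: "1 \<le> real D" using S.D by simp
        define Q where "Q = real n ^ 2 * real D"
        have Q9: "9 \<le> Q" unfolding Q_def using mult_mono[OF nn9 D1] by simp
        have l: "ln 9 \<le> ln Q" "0 \<le> ln Q" using Q9 by auto
        have "C * (ln 9 / real n) \<le> C * (sqrt (real D) / real n * sqrt (ln Q) + real D / real n ^ 2 * (ln Q)\<^sup>2 + ln Q / real n)"
        proof (intro mult_left_mono)
          have "ln 9 / real n \<le> ln Q / real n" using l by (intro divide_right_mono) auto
          moreover have "0 \<le> sqrt (real D) / real n * sqrt (ln Q)" "0 \<le> real D / real n ^ 2 * (ln Q)\<^sup>2" using l by auto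
          ultimately show "ln 9 / real n \<le> sqrt (real D) / real n * sqrt (ln Q) + real D / real n ^ 2 * (ln Q)\<^sup>2 + ln Q / real n" by linarith
        qed (use C in auto)
        then have "C * (ln 9 / real n) \<le> V_tilde C n D" by (simp add: V_tilde_def Q_def)
        moreover have "0 \<le> (SUP \<theta>\<in>K. bias D \<theta>)"
          by (rule order_trans[OF bias0 cSUP_upper[OF KI bias_bdd[OF D]]])
        moreover have "0 < q (2, D)" using q D by (auto simp: models_def)
        ultimately show ?thesis unfolding risk_def by linarith
      qed
      let ?I = "INF D\<in>\<D>\<^sub>2. risk D"
      have pos: "0 < C * (ln 9 / real n)" using C n3 by simp
      have I0: "0 < ?I" using cINF_greatest[OF D2(2) risk_ge] pos by (rule less_le_trans[rotated])
      have "?I < (1 + \<epsilon>) / (1 + \<epsilon> / 2) * ?I" using I0 \<open>0 < \<epsilon>\<close> by (simp add: field_simps)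
      moreover have "bdd_below (risk ` \<D>\<^sub>2)" using risk_ge by (intro bdd_belowI2)
      ultimately obtain D where D: "D \<in> \<D>\<^sub>2" and Dlt: "risk D < (1 + \<epsilon>) / (1 + \<epsilon> / 2) * ?I"
        using D2(2) by (auto simp: cINF_less_iff)
      have "(1 + \<epsilon> / 2) * risk D \<le> (1 + \<epsilon>) * ?I"
        using mult_left_mono[OF less_imp_le[OF Dlt], of "1 + \<epsilon> / 2"] \<open>0 < \<epsilon>\<close> by simp
      then have near: "(1 + \<epsilon> / 2) * risk D \<le> (INF \<theta>\<in>K. sdist \<theta>)" using sep by (rule order_trans)
      have mD: "(2, D) \<in> models \<D>\<^sub>1 \<D>\<^sub>2" using D by (simp add: models_def)
      have P: "sample_prob n f (\<lambda>X. T_tilde \<phi> f\<^sub>0 K n (2, D) X \<le> q (2, D)) \<le> ennreal \<beta>"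
      proof (rule power[OF SKD[OF D] f fB f0 f0B lip _ n])
        show "(\<integral>\<^sup>+x. ennreal (\<bar>x\<bar>\<^sup>2) \<partial>density_law f) \<le> ennreal \<nu>"
          using mom[unfolded moment_hyp_def, rule_format, of 2] by simp
        show "0 \<le> q (2, D)" using q mD by (auto intro: less_imp_le)
        fix \<mu> \<sigma> assume \<theta>: "(\<mu>, \<sigma>) \<in> K"
        have "bdd_below (sdist ` K)"
          by (rule bdd_belowI2[of _ 0]) (use \<open>0 < \<sigma>\<^sub>l\<close> in \<open>auto simp: sdist_def K_def\<close>)
        then have "(INF \<theta>\<in>K. sdist \<theta>) \<le> sdist (\<mu>, \<sigma>)" using \<theta> by (rule cINF_lower)
        moreover have "bias D (\<mu>, \<sigma>) \<le> (SUP \<theta>\<in>K. bias D \<theta>)" by (rule cSUP_upper[OF \<theta> bias_bdd[OF D]])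
        then have "(1 + \<epsilon> / 2) * (bias D (\<mu>, \<sigma>) + V_tilde C n D + q (2, D)) \<le> (1 + \<epsilon> / 2) * risk D"
          unfolding risk_def using \<open>0 < \<epsilon>\<close> by (intro mult_left_mono) auto
        ultimately have "(1 + \<epsilon> / 2) * (bias D (\<mu>, \<sigma>) + V_tilde C n D + q (2, D)) \<le> sdist (\<mu>, \<sigma>)" using near by linarith
        then show "(1 + \<epsilon> / 2) * ((L2_norm (\<lambda>x. \<sigma> * f (\<sigma> * x + \<mu>)
            - L2_proj (wavelet_space \<phi> D) (\<lambda>y. \<sigma> * f (\<sigma> * y + \<mu>)) x))\<^sup>2 + V_tilde C n D + q (2, D))
          \<le> \<sigma> * (L2_norm (\<lambda>x. f x - loc_scale f\<^sub>0 (\<mu>, \<sigma>) x))\<^sup>2"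
          unfolding bias_def sdist_def prod.case .
      qed
      have sub: "T_tilde \<phi> f\<^sub>0 K n (2, D) X \<le> q (2, D)" if "test_stat \<phi> f\<^sub>0 K n (models \<D>\<^sub>1 \<D>\<^sub>2) q X \<le> 0" for X
      proof -
        have "ereal (T_tilde \<phi> f\<^sub>0 K n (2, D) X - q (2, D)) \<le> test_stat \<phi> f\<^sub>0 K n (models \<D>\<^sub>1 \<D>\<^sub>2) q X"
          unfolding test_stat_def by (rule SUP_upper[OF mD])
        also note that
        finally show ?thesis by simp
      qed
      have "sample_prob n f (\<lambda>X. test_stat \<phi> f\<^sub>0 K n (models \<D>\<^sub>1 \<D>\<^sub>2) q X \<le> 0)
          \<le> sample_prob n f (\<lambda>X. T_tilde \<phi> f\<^sub>0 K n (2, D) X \<le> q (2, D))"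
        unfolding sample_prob_def by (rule outer_measure_of_mono) (use sub in auto)
      also note P
      finally show "sample_prob n f (\<lambda>X. test_stat \<phi> f\<^sub>0 K n (models \<D>\<^sub>1 \<D>\<^sub>2) q X \<le> 0) \<le> ennreal \<beta>" .
    qed
  qed
qed

end
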